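(* Let $(X,d)$ be a hyperbolic metric space, $o\in X$, $b>1$ a parameter admitting a visual metric $D=D_{b,o}$ on $\partial X$, and let $G\le\mathrm{Isom}(X)$ be a strongly discrete group of general type. Fix $\xi\in\partial X$. Let $\delta$ be the Poincaré exponent of $G$ and suppose that $\delta<\infty$. Then for each $c>0$, $$\dim_H(W_{c,\xi})=\sup\Big\{s\in(0,\delta):P_\xi(s)\le\frac{\delta-s}{c}\Big\}=\inf\Big\{s\in(0,\delta):P_\xi(s)\ge\frac{\delta-s}{c}\Big\}\le\frac{\delta}{c+1}.$$ In particular $$\dim_H(\mathrm{VWA}_\xi)=\sup\{s\in(0,\delta):P_\xi(s)<+\infty\}=\inf\{s\in(0,\delta):P_\xi(s)=+\infty\}$$ and $\dim_H(\mathrm{Liouville}_\xi)=0$. In these formulas $\sup\emptyset=0$ and $\inf\emptyset=\delta$.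
   Context: For a metric space $(X,d)$ let $\langle x|y\rangle_z=\frac12[d(x,z)+d(y,z)-d(x,y)]$. $(X,d)$ is (Gromov) hyperbolic if there is $C\ge 0$ with $\langle x|z\rangle_w\ge\min(\langle x|y\rangle_w,\langle y|z\rangle_w)-C$ for all $x,y,z,w\in X$ ($X$ need not be proper or geodesic). Fix a basepoint $o\in X$. A sequence $(x_n)$ in $X$ is a Gromov sequence if $\langle x_n|x_m\rangle_o\to\infty$ as $n,m\to\infty$; two Gromov sequences are equivalent if $\langle x_n|y_n\rangle_o\to\infty$; the Gromov boundary $\partial X$ is the set of equivalence classes, and isometries of $X$ act on it. For $\xi,\eta\in\partial X$ and $y,z\in X$: $\langle\xi|\eta\rangle_z=\inf\{\liminf_{n,m\to\infty}\langle x_n|y_m\rangle_z:(x_n)\in\xi,(y_m)\in\eta\}$ and $\langle\xi|y\rangle_z=\langle y|\xi\rangle_z=\inf\{\liminf_{n\to\infty}\langle x_n|y\rangle_z:(x_n)\in\xi\}$. A sequence $(x_n)$ in $X\cup\partial X$ converges to $\xi\in\partial X$ iff $\langle x_n|\xi\rangle_o\to\infty$. The parameter $b>1$ is close enough to $1$ that there is a complete metric $D=D_{b,o}$ on $\partial X$ (a visual metric) with $C^{-1}b^{-\langle\xi|\eta\rangle_o}\le D(\xi,\eta)\le Cb^{-\langle\xi|\eta\rangle_o}$ for some constant $C\geq 1$; such a $D$ is fixed, and all metric notions on $\partial X$ (diameter, closed balls $B(\xi,r)$, Hausdorff dimension $\dim_H$) refer to $D$. $G\le\mathrm{Isom}(X)$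 is strongly discrete if $\{g\in G:d(o,g(o))\le r\}$ is finite for every $r>0$. An isometry $g$ is loxodromic if it has two fixed points $g_+,g_-\in\partial X$ such that for every neighborhood $U$ of $g_-$ the iterates $g^n$ converge to $g_+$ uniformly on $\partial X\setminus U$, and $g^{-1}$ has the same property (with $g_+$ and $g_-$ exchanged). $G$ is of general type if it contains two loxodromic isometries with disjoint fixed-point sets in $\partial X$. The Poincaré exponent is $\delta=\inf\{s\ge0:\sum_{g\in G}b^{-s\,d(o,g(o))}<\infty\}$. For $\sigma>0$, $\Lambda_{r,\sigma}$ is the set of $\eta\in\partial X$ for which there is a sequence $(g_n)_1^\infty$ in $G$ with $g_n(o)\to\eta$ and $\langle o|\eta\rangle_{g_n(o)}\le\sigma$ for all $n$; the radial limit set is $\Lambda_r=\bigcup_{\sigma>0}\Lambda_{r,\sigma}$. For $\eta\in\Lambda_r$ let $$\omega_\xi(\eta)=\limsup_{g\in G,\ d(o,g(o))\to\infty}\frac{-\log_b D(g(\xi),\eta)}{d(o,g(o))},$$ and $W_{c,\xi}=\{\eta\in\Lambda_r:\omega_\xi(\eta)\ge1+c\}$ for $c>0$, $\mathrm{VWA}_\xi=\{\eta\in\Lambda_r:\omega_\xi(\eta)>1\}$, $\mathrm{Liouville}_\xi=\{\eta\in\Lambda_r:\omega_\xi(\eta)=\infty\}$. The Hausdorff content is $\mathcal H^s_\infty(S)=\inf\{\sum_{A\in\mathcal C}\mathrm{diam}(A)^s:\mathcal C\text{ a countable cover of }S\}$. For $s\in[0,\delta]$ and $r,\sigma>0$,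 $$H_{\xi,\sigma,s}(r)=\mathcal H^s_\infty(B(\xi,r)\cap\Lambda_{r,\sigma}),\qquad P_\xi(s)=\lim_{\sigma\to\infty}\liminf_{r\to0}\frac{\log_b H_{\xi,\sigma,s}(r)}{\log_b r}\in[0,\infty]$$ (where for $r<1$ the quotient is read as $+\infty$ if $H_{\xi,\sigma,s}(r)=0$). *)

theory Defs
  imports "HOL-Analysis.Analysis" "HOL-Algebra.Group"
begin

section \<open>Gromov hyperbolic spaces and their boundary\<close>

definition gromov_product :: "'a::metric_space \<Rightarrow> 'a \<Rightarrow> 'a \<Rightarrow> real" where
  \<comment> \<open>\<open>\<langle>x|y\<rangle>\<^sub>z\<close>, base point first\<close>
  "gromov_product z x y = (dist x z + dist y z - dist x y) / 2"

definition gromov_hyperbolic :: "'a::metric_space set \<Rightarrow> bool" where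
  "gromov_hyperbolic X \<longleftrightarrow>
     (\<exists>C\<ge>0. \<forall>x\<in>X. \<forall>y\<in>X. \<forall>z\<in>X. \<forall>w\<in>X.
        gromov_product w x z \<ge> min (gromov_product w x y) (gromov_product w y z) - C)"

definition gromov_sequence :: "'a::metric_space \<Rightarrow> (nat \<Rightarrow> 'a) \<Rightarrow> bool" where
  "gromov_sequence x\<^sub>0 x \<longleftrightarrow>
     filterlim (\<lambda>(n, m). gromov_product x\<^sub>0 (x n) (x m)) at_top (sequentially \<times>\<^sub>F sequentially)"

definition gromov_rel :: "'a::metric_space \<Rightarrow> (nat \<Rightarrow> 'a) rel" where
  "gromov_rel x\<^sub>0 = {(x, y). gromov_sequence x\<^sub>0 x \<and> gromov_sequence x\<^sub>0 y \<and>
     filterlim (\<lambda>n. gromov_product x\<^sub>0 (x n) (y n)) at_top sequentially}"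

text \<open>Boundary points are equivalence classes, i.e. sets of sequences.\<close>

type_synonym 'a bdpoint = "(nat \<Rightarrow> 'a) set"

definition gromov_boundary :: "'a::metric_space \<Rightarrow> 'a bdpoint set" where
  "gromov_boundary x\<^sub>0 = {x. gromov_sequence x\<^sub>0 x} // gromov_rel x\<^sub>0"

definition boundary_product :: "'a::metric_space \<Rightarrow> 'a bdpoint \<Rightarrow> 'a bdpoint \<Rightarrow> ereal" where
  \<comment> \<open>\<open>\<langle>\<xi>|\<eta>\<rangle>\<^sub>z\<close> for two boundary points, base point first\<close>
  "boundary_product z \<xi> \<eta> =
     (INF x\<in>\<xi>. INF y\<in>\<eta>.
        Liminf (sequentially \<times>\<^sub>F sequentially) (\<lambda>(n, m). ereal (gromov_product z (x n) (y m))))"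

definition point_boundary_product :: "'a::metric_space \<Rightarrow> 'a \<Rightarrow> 'a bdpoint \<Rightarrow> ereal" where
  \<comment> \<open>\<open>\<langle>y|\<xi>\<rangle>\<^sub>z\<close> for a point and a boundary point, base point first\<close>
  "point_boundary_product z y \<xi> =
     (INF x\<in>\<xi>. Liminf sequentially (\<lambda>n. ereal (gromov_product z (x n) y)))"

definition converges_to_boundary :: "'a::metric_space \<Rightarrow> (nat \<Rightarrow> 'a) \<Rightarrow> 'a bdpoint \<Rightarrow> bool" where
  "converges_to_boundary x\<^sub>0 x \<xi> \<longleftrightarrow>
     ((\<lambda>n. point_boundary_product x\<^sub>0 (x n) \<xi>) \<longlongrightarrow> \<infinity>) sequentially"

section \<open>Visual metrics\<close>

definition powr_neg :: "real \<Rightarrow> ereal \<Rightarrow> real" where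
  \<comment> \<open>\<open>b\<close> to the power \<open>-t\<close>, with value \<open>0\<close> at \<open>t = \<infinity>\<close>; used only for \<open>b > 1\<close>, \<open>t \<ge> 0\<close>\<close>
  "powr_neg b t = (if t = \<infinity> then 0 else b powr (- real_of_ereal t))"

definition visual_metric ::
    "real \<Rightarrow> 'a::metric_space \<Rightarrow> ('a bdpoint \<Rightarrow> 'a bdpoint \<Rightarrow> real) \<Rightarrow> bool" where
  "visual_metric b x\<^sub>0 D \<longleftrightarrow>
     Metric_space (gromov_boundary x\<^sub>0) D \<and>
     Metric_space.mcomplete (gromov_boundary x\<^sub>0) D \<and>
     (\<exists>C\<ge>1. \<forall>\<xi>\<in>gromov_boundary x\<^sub>0. \<forall>\<eta>\<in>gromov_boundary x\<^sub>0.
        inverse C * powr_neg b (boundary_product x\<^sub>0 \<xi> \<eta>) \<le> D \<xi> \<eta> \<and>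
        D \<xi> \<eta> \<le> C * powr_neg b (boundary_product x\<^sub>0 \<xi> \<eta>))"

section \<open>Groups of isometries\<close>

definition isometry_group :: "('a::metric_space \<Rightarrow> 'a) monoid" where
  "isometry_group =
     \<lparr>carrier = {g. bij g \<and> (\<forall>x y. dist (g x) (g y) = dist x y)}, mult = (\<circ>), one = id\<rparr>"

lemma group_isometry_group: "group (isometry_group :: ('a::metric_space \<Rightarrow> 'a) monoid)"
proof (rule groupI)
  fix g :: "'a \<Rightarrow> 'a"
  assume g: "g \<in> carrier isometry_group"
  then have b: "bij g" and d: "\<And>x y. dist (g x) (g y) = dist x y"
    by (auto simp: isometry_group_def)
  have "dist (inv_into UNIV g x) (inv_into UNIV g y) = dist x y" for x y
    using d[of "inv_into UNIV g x" "inv_into UNIV g y"] b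
    by (simp add: bij_is_surj surj_f_inv_f)
  then have "inv_into UNIV g \<in> carrier isometry_group"
    using b by (simp add: isometry_group_def bij_imp_bij_inv)
  moreover have "inv_into UNIV g \<circ> g = id"
    using b by (simp add: bij_is_inj)
  ultimately show "\<exists>h\<in>carrier isometry_group. h \<otimes>\<^bsub>isometry_group\<^esub> g = \<one>\<^bsub>isometry_group\<^esub>"
    by (auto simp: isometry_group_def)
qed (auto simp: isometry_group_def bij_comp)

definition boundary_action :: "('a \<Rightarrow> 'a) \<Rightarrow> 'a bdpoint \<Rightarrow> 'a bdpoint" where
  "boundary_action g \<xi> = (\<lambda>x. g \<circ> x) ` \<xi>"

definition boundary_fixed_points :: "'a::metric_space \<Rightarrow> ('a \<Rightarrow> 'a) \<Rightarrow> 'a bdpoint set" where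
  "boundary_fixed_points x\<^sub>0 g = {\<eta> \<in> gromov_boundary x\<^sub>0. boundary_action g \<eta> = \<eta>}"

definition strongly_discrete :: "'a::metric_space \<Rightarrow> ('a \<Rightarrow> 'a) set \<Rightarrow> bool" where
  "strongly_discrete x\<^sub>0 G \<longleftrightarrow> (\<forall>r>0. finite {g \<in> G. dist x\<^sub>0 (g x\<^sub>0) \<le> r})"

definition attracting ::
    "'a::metric_space \<Rightarrow> ('a bdpoint \<Rightarrow> 'a bdpoint \<Rightarrow> real) \<Rightarrow> ('a \<Rightarrow> 'a)
      \<Rightarrow> 'a bdpoint \<Rightarrow> 'a bdpoint \<Rightarrow> bool" where
  \<comment> \<open>The iterates of \<open>g\<close> converge to \<open>p\<close> uniformly off every open neighbourhood of \<open>q\<close>.\<close>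
  "attracting x\<^sub>0 D g p q \<longleftrightarrow>
     (\<forall>U. openin (Metric_space.mtopology (gromov_boundary x\<^sub>0) D) U \<and> q \<in> U \<longrightarrow>
        (\<forall>\<epsilon>>0. \<forall>\<^sub>F n in sequentially. \<forall>\<eta>\<in>gromov_boundary x\<^sub>0 - U.
           D (boundary_action (g ^^ n) \<eta>) p < \<epsilon>))"

definition loxodromic ::
    "'a::metric_space \<Rightarrow> ('a bdpoint \<Rightarrow> 'a bdpoint \<Rightarrow> real) \<Rightarrow> ('a \<Rightarrow> 'a) \<Rightarrow> bool" where
  "loxodromic x\<^sub>0 D g \<longleftrightarrow>
     (\<exists>p\<in>boundary_fixed_points x\<^sub>0 g. \<exists>q\<in>boundary_fixed_points x\<^sub>0 g.
        p \<noteq> q \<and> attracting x\<^sub>0 D g p q \<and> attracting x\<^sub>0 D (inv_into UNIV g) q p)"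

definition general_type ::
    "'a::metric_space \<Rightarrow> ('a bdpoint \<Rightarrow> 'a bdpoint \<Rightarrow> real) \<Rightarrow> ('a \<Rightarrow> 'a) set \<Rightarrow> bool" where
  "general_type x\<^sub>0 D G \<longleftrightarrow>
     (\<exists>g\<in>G. \<exists>h\<in>G. loxodromic x\<^sub>0 D g \<and> loxodromic x\<^sub>0 D h \<and>
        boundary_fixed_points x\<^sub>0 g \<inter> boundary_fixed_points x\<^sub>0 h = {})"

definition poincare_exponent :: "real \<Rightarrow> 'a::metric_space \<Rightarrow> ('a \<Rightarrow> 'a) set \<Rightarrow> ereal" where
  "poincare_exponent b x\<^sub>0 G =
     Inf (ereal ` {s. 0 \<le> s \<and> (\<lambda>g. b powr (- s * dist x\<^sub>0 (g x\<^sub>0))) summable_on G})"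

definition radial_limit_set_upto :: "'a::metric_space \<Rightarrow> ('a \<Rightarrow> 'a) set \<Rightarrow> real \<Rightarrow> 'a bdpoint set" where
  "radial_limit_set_upto x\<^sub>0 G \<sigma> =
     {\<eta> \<in> gromov_boundary x\<^sub>0.
        \<exists>g :: nat \<Rightarrow> 'a \<Rightarrow> 'a. (\<forall>n. g n \<in> G) \<and> converges_to_boundary x\<^sub>0 (\<lambda>n. g n x\<^sub>0) \<eta> \<and>
          (\<forall>n. point_boundary_product (g n x\<^sub>0) x\<^sub>0 \<eta> \<le> ereal \<sigma>)}"

definition radial_limit_set :: "'a::metric_space \<Rightarrow> ('a \<Rightarrow> 'a) set \<Rightarrow> 'a bdpoint set" where
  "radial_limit_set x\<^sub>0 G = (\<Union>\<sigma>\<in>{0<..}. radial_limit_set_upto x\<^sub>0 G \<sigma>)"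

section \<open>Hausdorff content, measure and dimension of subsets of a metric space \<open>(M, D)\<close>\<close>

definition ediam :: "('b \<Rightarrow> 'b \<Rightarrow> real) \<Rightarrow> 'b set \<Rightarrow> ennreal" where
  "ediam D A = (SUP x\<in>A. SUP y\<in>A. ennreal (D x y))"

definition ediam_powr :: "('b \<Rightarrow> 'b \<Rightarrow> real) \<Rightarrow> real \<Rightarrow> 'b set \<Rightarrow> ennreal" where
  \<comment> \<open>\<open>diam(A)\<^sup>s\<close> for \<open>s \<ge> 0\<close>, with \<open>diam(A)\<^sup>0 = 1\<close> for nonempty \<open>A\<close>, also for singletons
     (\<open>0 powr 0\<close> would be \<open>0\<close>)\<close>
  "ediam_powr D s A =
     (if A = {} then 0 else if s = 0 then 1 else if ediam D A = \<infinity> then \<infinity>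
      else ennreal (enn2real (ediam D A) powr s))"

definition hausdorff_premeasure ::
    "'b set \<Rightarrow> ('b \<Rightarrow> 'b \<Rightarrow> real) \<Rightarrow> ennreal \<Rightarrow> real \<Rightarrow> 'b set \<Rightarrow> ennreal" where
  "hausdorff_premeasure M D \<epsilon> s S =
     (INF \<C>\<in>{\<C>. countable \<C> \<and> \<C> \<subseteq> Pow M \<and> S \<subseteq> \<Union>\<C> \<and> (\<forall>A\<in>\<C>. ediam D A \<le> \<epsilon>)}.
        \<Sum>\<^sub>\<infinity>A\<in>\<C>. ediam_powr D s A)"

definition hausdorff_content :: "'b set \<Rightarrow> ('b \<Rightarrow> 'b \<Rightarrow> real) \<Rightarrow> real \<Rightarrow> 'b set \<Rightarrow> ennreal" where
  \<comment> \<open>no constraint on the diameters of the covering sets\<close>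
  "hausdorff_content M D = hausdorff_premeasure M D \<infinity>"

definition hausdorff_measure :: "'b set \<Rightarrow> ('b \<Rightarrow> 'b \<Rightarrow> real) \<Rightarrow> real \<Rightarrow> 'b set \<Rightarrow> ennreal" where
  "hausdorff_measure M D s S = (SUP \<epsilon>\<in>{0<..}. hausdorff_premeasure M D \<epsilon> s S)"

definition hausdorff_dim :: "'b set \<Rightarrow> ('b \<Rightarrow> 'b \<Rightarrow> real) \<Rightarrow> 'b set \<Rightarrow> ereal" where
  "hausdorff_dim M D S = Inf (ereal ` {s. 0 \<le> s \<and> hausdorff_measure M D s S = 0})"

section \<open>Diophantine approximation\<close>

definition elog :: "real \<Rightarrow> ennreal \<Rightarrow> ereal" where
  \<comment> \<open>\<open>log\<^sub>b\<close> on \<open>[0,\<infinity>]\<close>, with \<open>log\<^sub>b 0 = -\<infinity>\<close>\<close>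
  "elog b h = (if h = 0 then -\<infinity> else if h = \<infinity> then \<infinity> else ereal (log b (enn2real h)))"

definition approx_exponent ::
    "real \<Rightarrow> 'a::metric_space \<Rightarrow> ('a bdpoint \<Rightarrow> 'a bdpoint \<Rightarrow> real) \<Rightarrow> ('a \<Rightarrow> 'a) set
      \<Rightarrow> 'a bdpoint \<Rightarrow> 'a bdpoint \<Rightarrow> ereal" where
  \<comment> \<open>\<open>\<omega>\<^sub>\<xi>(\<eta>)\<close>; the filter is that of \<open>g \<in> G\<close>, \<open>d(x\<^sub>0, g x\<^sub>0) \<rightarrow> \<infinity>\<close>\<close>
  "approx_exponent b x\<^sub>0 D G \<xi> \<eta> =
     Limsup (inf (filtercomap (\<lambda>g. dist x\<^sub>0 (g x\<^sub>0)) at_top) (principal G))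
       (\<lambda>g. - elog b (ennreal (D (boundary_action g \<xi>) \<eta>)) / ereal (dist x\<^sub>0 (g x\<^sub>0)))"

definition well_approximable_set ::
    "real \<Rightarrow> 'a::metric_space \<Rightarrow> ('a bdpoint \<Rightarrow> 'a bdpoint \<Rightarrow> real) \<Rightarrow> ('a \<Rightarrow> 'a) set
      \<Rightarrow> real \<Rightarrow> 'a bdpoint \<Rightarrow> 'a bdpoint set" where
  \<comment> \<open>\<open>W\<^sub>c\<^sub>,\<^sub>\<xi>\<close>\<close>
  "well_approximable_set b x\<^sub>0 D G c \<xi> =
     {\<eta> \<in> radial_limit_set x\<^sub>0 G. approx_exponent b x\<^sub>0 D G \<xi> \<eta> \<ge> ereal (1 + c)}"

definition VWA ::
    "real \<Rightarrow> 'a::metric_space \<Rightarrow> ('a bdpoint \<Rightarrow> 'a bdpoint \<Rightarrow> real) \<Rightarrow> ('a \<Rightarrow> 'a) set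
      \<Rightarrow> 'a bdpoint \<Rightarrow> 'a bdpoint set" where
  "VWA b x\<^sub>0 D G \<xi> = {\<eta> \<in> radial_limit_set x\<^sub>0 G. approx_exponent b x\<^sub>0 D G \<xi> \<eta> > 1}"

definition Liouville ::
    "real \<Rightarrow> 'a::metric_space \<Rightarrow> ('a bdpoint \<Rightarrow> 'a bdpoint \<Rightarrow> real) \<Rightarrow> ('a \<Rightarrow> 'a) set
      \<Rightarrow> 'a bdpoint \<Rightarrow> 'a bdpoint set" where
  "Liouville b x\<^sub>0 D G \<xi> = {\<eta> \<in> radial_limit_set x\<^sub>0 G. approx_exponent b x\<^sub>0 D G \<xi> \<eta> = \<infinity>}"

definition local_content ::
    "'a::metric_space \<Rightarrow> ('a bdpoint \<Rightarrow> 'a bdpoint \<Rightarrow> real) \<Rightarrow> ('a \<Rightarrow> 'a) set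
      \<Rightarrow> 'a bdpoint \<Rightarrow> real \<Rightarrow> real \<Rightarrow> real \<Rightarrow> ennreal" where
  \<comment> \<open>\<open>H\<^sub>\<xi>\<^sub>,\<^sub>\<sigma>\<^sub>,\<^sub>s(r)\<close>\<close>
  "local_content x\<^sub>0 D G \<xi> \<sigma> s r =
     hausdorff_content (gromov_boundary x\<^sub>0) D s
       (Metric_space.mcball (gromov_boundary x\<^sub>0) D \<xi> r \<inter> radial_limit_set_upto x\<^sub>0 G \<sigma>)"

definition lower_local_exponent ::
    "real \<Rightarrow> 'a::metric_space \<Rightarrow> ('a bdpoint \<Rightarrow> 'a bdpoint \<Rightarrow> real) \<Rightarrow> ('a \<Rightarrow> 'a) set
      \<Rightarrow> 'a bdpoint \<Rightarrow> real \<Rightarrow> real \<Rightarrow> ereal" where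
  \<comment> \<open>For \<open>r < 1\<close> and vanishing content the quotient is \<open>-\<infinity>\<close> divided by a negative number,
     i.e. \<open>\<infinity>\<close>.\<close>
  "lower_local_exponent b x\<^sub>0 D G \<xi> s \<sigma> =
     Liminf (at_right 0) (\<lambda>r. elog b (local_content x\<^sub>0 D G \<xi> \<sigma> s r) / ereal (log b r))"

definition P_exponent ::
    "real \<Rightarrow> 'a::metric_space \<Rightarrow> ('a bdpoint \<Rightarrow> 'a bdpoint \<Rightarrow> real) \<Rightarrow> ('a \<Rightarrow> 'a) set
      \<Rightarrow> 'a bdpoint \<Rightarrow> real \<Rightarrow> ereal" where
  "P_exponent b x\<^sub>0 D G \<xi> s = Lim at_top (lower_local_exponent b x\<^sub>0 D G \<xi> s)"

text \<open>\<open>Lim\<close> is a definite description; the limit defining \<^const>\<open>P_exponent\<close> does exist,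
  by monotonicity.\<close>

lemma radial_limit_set_upto_mono:
  "\<sigma> \<le> \<sigma>' \<Longrightarrow> radial_limit_set_upto x\<^sub>0 G \<sigma> \<subseteq> radial_limit_set_upto x\<^sub>0 G \<sigma>'"
  unfolding radial_limit_set_upto_def by (blast intro: order_trans ereal_less_eq(3)[THEN iffD2])

lemma hausdorff_content_mono:
  "S \<subseteq> T \<Longrightarrow> hausdorff_content M D s S \<le> hausdorff_content M D s T"
  unfolding hausdorff_content_def hausdorff_premeasure_def by (rule INF_superset_mono) auto

lemma elog_mono:
  assumes "1 < b" "h \<le> k"
  shows "elog b h \<le> elog b k"
proof -
  have "log b (enn2real h) \<le> log b (enn2real k)" if "h \<noteq> 0" "k \<noteq> \<infinity>"
  proof -
    have "0 < enn2real h"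
      unfolding enn2real_positive_iff using that assms(2)
      by (metis infinity_ennreal_def le_less_trans not_gr_zero top.not_eq_extremum)
    moreover have "enn2real h \<le> enn2real k"
      using that assms(2) by (simp add: enn2real_mono top.not_eq_extremum)
    ultimately show ?thesis
      using assms(1) by (smt (verit) log_le_cancel_iff)
  qed
  then show ?thesis
    using assms(2) by (auto simp: elog_def top_unique)
qed

lemma lower_local_exponent_antimono:
  assumes "1 < b" "\<sigma> \<le> \<sigma>'"
  shows "lower_local_exponent b x\<^sub>0 D G \<xi> s \<sigma>' \<le> lower_local_exponent b x\<^sub>0 D G \<xi> s \<sigma>"
  unfolding lower_local_exponent_def
proof (rule Liminf_mono)
  have "\<forall>\<^sub>F r :: real in at_right 0. r \<in> {0<..<1}"
    by (rule eventually_at_right_real) simp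
  then show "\<forall>\<^sub>F r in at_right 0.
      elog b (local_content x\<^sub>0 D G \<xi> \<sigma>' s r) / ereal (log b r)
      \<le> elog b (local_content x\<^sub>0 D G \<xi> \<sigma> s r) / ereal (log b r)"
  proof eventually_elim
    case (elim r)
    then have neg: "log b r < 0"
      using assms(1) by simp
    have "local_content x\<^sub>0 D G \<xi> \<sigma> s r \<le> local_content x\<^sub>0 D G \<xi> \<sigma>' s r"
      unfolding local_content_def
      using radial_limit_set_upto_mono[OF assms(2)] by (intro hausdorff_content_mono) blast
    then have "elog b (local_content x\<^sub>0 D G \<xi> \<sigma> s r) \<le> elog b (local_content x\<^sub>0 D G \<xi> \<sigma>' s r)"
      by (rule elog_mono[OF assms(1)])
    then show ?case
      using neg ereal_divide_right_mono[of "elog b (local_content x\<^sub>0 D G \<xi> \<sigma> s r)" _ "ereal (- log b r)"]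
      by (cases "elog b (local_content x\<^sub>0 D G \<xi> \<sigma> s r)";
          cases "elog b (local_content x\<^sub>0 D G \<xi> \<sigma>' s r)")
        (auto simp: divide_right_mono_neg)
  qed
qed

lemma tendsto_P_exponent:
  assumes "1 < b"
  shows "(lower_local_exponent b x\<^sub>0 D G \<xi> s \<longlongrightarrow> P_exponent b x\<^sub>0 D G \<xi> s) at_top"
proof -
  let ?f = "lower_local_exponent b x\<^sub>0 D G \<xi> s"
  have "(?f \<longlongrightarrow> (INF \<sigma>. ?f \<sigma>)) at_top"
  proof (rule order_tendstoI)
    fix a assume "a < (INF \<sigma>. ?f \<sigma>)"
    then show "\<forall>\<^sub>F \<sigma> in at_top. a < ?f \<sigma>"
      by (simp add: less_INF_D)
  next
    fix a assume "(INF \<sigma>. ?f \<sigma>) < a"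
    then obtain \<sigma>\<^sub>0 where "?f \<sigma>\<^sub>0 < a"
      by (auto simp: INF_less_iff)
    then show "\<forall>\<^sub>F \<sigma> in at_top. ?f \<sigma> < a"
      by (rule_tac eventually_mono[OF eventually_ge_at_top[of \<sigma>\<^sub>0]],
          rule_tac le_less_trans[OF lower_local_exponent_antimono[OF assms]])
  qed
  then show ?thesis
    unfolding P_exponent_def by (simp add: tendsto_Lim)
qed

section \<open>Suprema and infima with a prescribed value on the empty set\<close>

definition Sup_or :: "real \<Rightarrow> real set \<Rightarrow> real" where
  "Sup_or a S = (if S = {} then a else Sup S)"

definition Inf_or :: "real \<Rightarrow> real set \<Rightarrow> real" where
  "Inf_or a S = (if S = {} then a else Inf S)"

end

theory Submission
  imports Defs
begin

text \<open>
  Write \<open>|g|\<close> for the distance from \<open>x0\<close> to \<open>g x0\<close>.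

  Upper bound: a radial point within \<open>b powr (- (1 + c) |g|)\<close> of \<open>g \<xi>\<close> is the image under \<open>g\<close> of a radial
  point in a ball about \<open>\<xi>\<close> of radius about \<open>b powr (- c |g|)\<close>, and \<open>g\<close> contracts this ball by about
  \<open>b powr (- |g|)\<close>. The \<open>s\<close>-content of these points is therefore about \<open>b powr (- (s + c P) |g|)\<close>, where
  \<open>P\<close> is the local exponent at \<open>\<xi>\<close>, and this is summable over the group if \<open>s + c P > \<delta>\<close>.

  Lower bound: instead of constructing a measure, one shows that a cover of small total weight misses a
  point. One descends through nodes \<open>h\<close> of the group whose shadow, of diameter about \<open>b powr (- |h|)\<close>,
  meets sets of the cover of total weight at most \<open>\<kappa> b powr (- s |h|)\<close>. For \<open>t < \<delta>\<close> divergence of the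
  Poincare series yields many \<open>g\<close> in some annulus. Two independent loxodromic elements yield a
  finite set of turns \<open>j\<close> such that \<open>|h j g|\<close> is \<open>|h| + |g|\<close> up to a constant for one of them. So every
  node has at least \<open>b powr (t N)\<close> children \<open>h j g\<close>, of norm at most \<open>|h| + N\<close>. Their shadows are so far
  apart that the sets of the cover, being small, meet at most one of them, whence the weight decays
  like \<open>b powr (- t |h|)\<close> along a suitable path. Let \<open>r\<close> be a radius at which the radial points of the
  ball of radius \<open>r\<close> about \<open>\<xi>\<close> have content at least \<open>r powr p\<close>, where \<open>s + c p < t\<close>, and stop when
  \<open>|h|\<close> is about \<open>- log b r / c\<close>. The image of this ball has content about \<open>b powr (- (s + c p) |h|)\<close>,
  far more than the weight left, so by a Vitali argument the descent can be continued along a radial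
  ray into this image. The limit point is well approximable and not covered.
\<close>

section \<open>Gromov products of sets of sequences\<close>

text \<open>The space need not be proper, so compactness cannot produce limit points or limit
  measures: limit points come from chains of nested shadows, whose orbit points form a Gromov
  sequence outright. Boundary products are infima of lower limits and obey the usual identities only
  up to multiples of the hyperbolicity constant. They are therefore tested only against real lower
  bounds, while upper bounds are statements about all representing sequences
  (\<open>asymp_le\<close>). Contents of a fixed exponent replace Hausdorff measures: they determine
  the dimension equally well and pass easily through Lipschitz maps. Both estimates need a strict
  inequality between \<open>P\<close> and \<open>(\<delta> - s) / c\<close>; monotonicity of
  \<open>P\<close> in \<open>s\<close> absorbs the case of equality. In the upper bound, the
  position of \<xi> relative to the inverse orbit point of \<open>g\<close> is arbitrary; the
  resulting distortion is absorbed as soon as the local exponent is at least \<open>s\<close>, which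
  covering a ball by itself always allows.\<close>

abbreviation "gp \<equiv> gromov_product"
abbreviation "bp \<equiv> boundary_product"
abbreviation "iv \<equiv> inv_into UNIV"

lemma gp_commute: "gp z x y = gp z y x"
  by (simp add: gromov_product_def dist_commute)

lemma gp_nonneg: "0 \<le> gp z x y"
  using dist_triangle[of x y z] by (simp add: gromov_product_def dist_commute)

lemma gp_le_dist: "gp z x y \<le> dist z x"
  using dist_triangle[of y z x] by (simp add: gromov_product_def dist_commute)

lemma gp_same: "gp z x x = dist z x"
  by (simp add: gromov_product_def dist_commute)

lemma gp_change_base: "gp w x y = gp z x y + dist z w - gp z x w - gp z y w"
  by (simp add: gromov_product_def dist_commute field_simps)

lemma gp_lipschitz_base: "gp z x y - dist z w \<le> gp w x y"
  using dist_triangle[of x z w] dist_triangle[of y z w]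
  by (simp add: gromov_product_def dist_commute field_simps)

lemma gp_lipschitz: "gp z x y - dist x x' \<le> gp z x' y"
  using dist_triangle[of x z x'] dist_triangle[of x' y x]
  by (simp add: gromov_product_def dist_commute field_simps)

lemma gp_sum: "gp z x y + gp y x z = dist y z"
  by (simp add: gromov_product_def dist_commute field_simps)

text \<open>Boundary products take values in \<open>[0,\<infinity>]\<close>. Testing them against
  real lower bounds turns infima of lower limits into epsilon-N statements and avoids arithmetic
  with infinity.\<close>

lemma ereal_leI_real:
  assumes "\<And>M::real. ereal M \<le> x \<Longrightarrow> ereal M \<le> y"
  shows "x \<le> y"
proof (rule ccontr)
  assume "\<not> x \<le> y"
  then have "y < x" by simp
  then obtain r where r: "y < ereal r" "ereal r < x"
    using ereal_dense2 by blast
  have "ereal r \<le> y" by (rule assms[OF less_imp_le[OF r(2)]])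
  then show False using r(1) by simp
qed

lemma ereal_eqI_le:
  assumes "\<And>M::real. ereal M \<le> x \<longleftrightarrow> ereal M \<le> y"
  shows "x = y"
proof (rule antisym)
  show "x \<le> y" by (rule ereal_leI_real) (rule iffD1[OF assms])
  show "y \<le> x" by (rule ereal_leI_real) (rule iffD2[OF assms])
qed

lemma le_Liminf_real_iff:
  fixes f :: "'b \<Rightarrow> real"
  shows "ereal M \<le> Liminf F (\<lambda>x. ereal (f x)) \<longleftrightarrow> (\<forall>e>0. \<forall>\<^sub>F x in F. M - e < f x)"
  unfolding le_Liminf_iff
proof safe
  fix e :: real assume "\<forall>y<ereal M. \<forall>\<^sub>F x in F. y < ereal (f x)" "0 < e"
  then show "\<forall>\<^sub>F x in F. M - e < f x"
    by (auto dest!: spec[of _ "ereal (M - e)"])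
next
  fix y assume *: "\<forall>e>0. \<forall>\<^sub>F x in F. M - e < f x" and y: "y < ereal M"
  show "\<forall>\<^sub>F x in F. y < ereal (f x)"
  proof (cases y)
    case (real r)
    then have "\<forall>\<^sub>F x in F. M - (M - r) < f x" using * y by (metis diff_gt_0_iff_gt less_ereal.simps(1))
    then show ?thesis using real by simp
  qed (use y in auto)
qed

lemma le_bp_iff:
  "ereal M \<le> bp z a c \<longleftrightarrow>
    (\<forall>x\<in>a. \<forall>y\<in>c. \<forall>e>0. \<exists>N. \<forall>n\<ge>N. \<forall>m\<ge>N. M - e < gp z (x n) (y m))"
proof -
  have "Liminf (sequentially \<times>\<^sub>F sequentially) (\<lambda>(n, m). ereal (gp z (x n) (y m)))
      = Liminf (sequentially \<times>\<^sub>F sequentially) (\<lambda>p. ereal (gp z (x (fst p)) (y (snd p))))" for x y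
    by (simp add: case_prod_unfold)
  then show ?thesis
    unfolding boundary_product_def le_INF_iff le_Liminf_real_iff eventually_prod_sequentially
    by (simp add: le_Liminf_real_iff eventually_prod_sequentially) blast
qed

lemma le_pbp_iff:
  "ereal M \<le> point_boundary_product z y \<xi> \<longleftrightarrow>
    (\<forall>x\<in>\<xi>. \<forall>e>0. \<exists>N. \<forall>n\<ge>N. M - e < gp z (x n) y)"
  unfolding point_boundary_product_def le_INF_iff le_Liminf_real_iff eventually_sequentially ..

text \<open>A point is encoded by the singleton of its constant sequence, so that one hyperbolicity
  inequality for \<^const>\<open>boundary_product\<close> covers all combinations of points and boundary points.\<close>

definition pt :: "'a::metric_space \<Rightarrow> 'a bdpoint" where
  "pt x = {\<lambda>_. x}"

lemma pt_nonempty: "pt x \<noteq> {}"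
  by (simp add: pt_def)

lemma pbp_eq_bp: "point_boundary_product z y \<xi> = bp z \<xi> (pt y)"
proof (rule ereal_eqI_le)
  fix M :: real
  have "(\<exists>N::nat. \<forall>n\<ge>N. \<forall>m::nat\<ge>N. P n) \<longleftrightarrow> (\<exists>N. \<forall>n\<ge>N. P n)" for P :: "nat \<Rightarrow> bool"
    by auto
  then show "ereal M \<le> point_boundary_product z y \<xi> \<longleftrightarrow> ereal M \<le> bp z \<xi> (pt y)"
    by (simp add: le_pbp_iff le_bp_iff pt_def)
qed

lemma le_bp_pt_right:
  "ereal M \<le> bp z \<xi> (pt y) \<longleftrightarrow> (\<forall>x\<in>\<xi>. \<forall>e>0. \<exists>N. \<forall>n\<ge>N. M - e < gp z (x n) y)"
  unfolding pbp_eq_bp[symmetric] le_pbp_iff ..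

lemma bp_commute: "bp z a b = bp z b a"
proof (rule ereal_eqI_le)
  have "ereal M \<le> bp z b a" if *: "ereal M \<le> bp z a b" for M a b
    unfolding le_bp_iff
  proof (intro ballI allI impI)
    fix x y and e :: real assume "x \<in> b" "y \<in> a" "0 < e"
    then obtain N where "\<forall>n\<ge>N. \<forall>m\<ge>N. M - e < gp z (y n) (x m)"
      using * unfolding le_bp_iff by blast
    then show "\<exists>N. \<forall>n\<ge>N. \<forall>m\<ge>N. M - e < gp z (x n) (y m)"
      by (subst gp_commute) blast
  qed
  then show "ereal M \<le> bp z a b \<longleftrightarrow> ereal M \<le> bp z b a" for M by blast
qed

lemma le_bp_pt_iff: "ereal M \<le> bp z (pt x) (pt y) \<longleftrightarrow> M \<le> gp z x y"
proof -
  have "(\<forall>e>0. M - e < gp z x y) \<longleftrightarrow> M \<le> gp z x y"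
    by (smt (verit, best) field_le_epsilon)
  then show ?thesis by (auto simp: le_bp_iff pt_def)
qed

lemma bp_nonneg: "0 \<le> bp z a b"
proof -
  have "ereal 0 \<le> bp z a b"
    unfolding le_bp_iff by (auto intro!: exI less_le_trans[OF _ gp_nonneg])
  then show ?thesis by (simp add: zero_ereal_def)
qed

lemma le_bp_ptD:
  assumes "ereal M \<le> bp z \<xi> (pt y)" "\<xi> \<noteq> {}"
  shows "M \<le> dist z y"
proof (rule field_le_epsilon)
  fix e :: real assume "0 < e"
  obtain x where "x \<in> \<xi>" using assms by auto
  then obtain n where "M - e < gp z (x n) y"
    using assms(1) \<open>0 < e\<close> unfolding le_bp_pt_right by blast
  then show "M \<le> dist z y + e"
    using gp_le_dist[of z y "x n"] gp_commute[of z "x n" y] by linarith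
qed

lemma le_bp_base:
  assumes "ereal M \<le> bp z a b"
  shows "ereal (M - dist z w) \<le> bp w a b"
  unfolding le_bp_iff
proof (intro ballI allI impI)
  fix x y and e :: real assume "x \<in> a" "y \<in> b" "0 < e"
  then obtain N where "\<forall>n\<ge>N. \<forall>m\<ge>N. M - e < gp z (x n) (y m)"
    using assms unfolding le_bp_iff by blast
  then have "\<forall>n\<ge>N. \<forall>m\<ge>N. M - dist z w - e < gp w (x n) (y m)"
    using gp_lipschitz_base by (smt (verit))
  then show "\<exists>N. \<forall>n\<ge>N. \<forall>m\<ge>N. M - dist z w - e < gp w (x n) (y m)" ..
qed

text \<open>The products of one sequence with \<open>y\<close> and with \<open>z\<close> add up to
  \<open>dist y z\<close> exactly (\<open>gp_sum\<close>). So a lower bound seen from one end is an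
  upper bound seen from the other, without loss of \<open>E\<close>.\<close>

lemma le_bp_sumD:
  assumes "ereal u \<le> bp z \<xi> (pt y)" "\<xi> \<noteq> {}" "ereal v \<le> bp y \<xi> (pt z)"
  shows "u + v \<le> dist y z"
proof (rule field_le_epsilon)
  fix e :: real assume e: "0 < e"
  obtain x where x: "x \<in> \<xi>" using assms by auto
  have "e/2 > 0" using e by simp
  then obtain N N' where "\<forall>n\<ge>N. u - e/2 < gp z (x n) y" "\<forall>n\<ge>N'. v - e/2 < gp y (x n) z"
    using assms(1,3) x unfolding le_bp_pt_right by blast
  then have "u - e/2 < gp z (x (max N N')) y" "v - e/2 < gp y (x (max N N')) z" by auto
  then show "u + v \<le> dist y z + e"
    using gp_sum[of z "x (max N N')" y] by linarith
qed

text \<open>As \<open>bp\<close> is an infimum, an upper bound on it may concern a few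
  representatives only. Base changes need an upper bound along every representative.\<close>

definition asymp_le :: "'a::metric_space \<Rightarrow> 'a \<Rightarrow> 'a bdpoint \<Rightarrow> real \<Rightarrow> bool" where
  "asymp_le z w a u \<longleftrightarrow> (\<forall>x\<in>a. \<exists>N. \<forall>n\<ge>N. gp z (x n) w \<le> u)"

lemma asymp_le_pt: "gp z y w \<le> u \<Longrightarrow> asymp_le z w (pt y) u"
  by (simp add: asymp_le_def pt_def)

lemma asymp_le_sum:
  assumes "asymp_le y z \<xi> u"
  shows "ereal (dist y z - u) \<le> bp z \<xi> (pt y)"
  unfolding le_bp_pt_right
proof (intro ballI allI impI)
  fix x and e :: real assume "x \<in> \<xi>" "0 < e"
  then obtain N where N: "\<forall>n\<ge>N. gp y (x n) z \<le> u"
    using assms unfolding asymp_le_def by blast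
  have "dist y z - u - e < gp z (x n) y" if "n \<ge> N" for n
    using N that gp_sum[of z "x n" y] \<open>0 < e\<close> by (smt (verit))
  then show "\<exists>N. \<forall>n\<ge>N. dist y z - u - e < gp z (x n) y" by blast
qed

text \<open>Moving the base point from \<open>z\<close> to \<open>w\<close> gains
  \<open>dist z w\<close>, less what either argument overlaps with the direction of \<open>w\<close>
  seen from \<open>z\<close> (\<open>gp_change_base\<close>). The contraction estimates for group
  elements come from this.\<close>

lemma le_bp_change_base:
  assumes "ereal M \<le> bp z a b" "asymp_le z w a u" "asymp_le z w b v"
  shows "ereal (M + dist z w - u - v) \<le> bp w a b"
  unfolding le_bp_iff
proof (intro ballI allI impI)
  fix x y and e :: real assume xy: "x \<in> a" "y \<in> b" "0 < e"
  obtain N1 where N1: "\<forall>n\<ge>N1. \<forall>m\<ge>N1. M - e < gp z (x n) (y m)"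
    using assms(1) xy unfolding le_bp_iff by blast
  obtain N2 where N2: "\<forall>n\<ge>N2. gp z (x n) w \<le> u"
    using assms(2) xy unfolding asymp_le_def by blast
  obtain N3 where N3: "\<forall>n\<ge>N3. gp z (y n) w \<le> v"
    using assms(3) xy unfolding asymp_le_def by blast
  have "M + dist z w - u - v - e < gp w (x n) (y m)" if "n \<ge> N1 + N2 + N3" "m \<ge> N1 + N2 + N3" for n m
  proof -
    have "M - e < gp z (x n) (y m)" "gp z (x n) w \<le> u" "gp z (y m) w \<le> v"
      using N1 N2 N3 that by auto
    then show ?thesis using gp_change_base[of w "x n" "y m" z] by linarith
  qed
  then show "\<exists>N. \<forall>n\<ge>N. \<forall>m\<ge>N. M + dist z w - u - v - e < gp w (x n) (y m)" by blast
qed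

section \<open>Isometries\<close>

lemma isometry_groupD:
  assumes "g \<in> carrier isometry_group"
  shows "bij g" "dist (g x) (g y) = dist x y" "g (iv g x) = x" "iv g (g x) = x"
    "iv g \<in> carrier isometry_group"
proof -
  have b: "bij g" and d: "\<And>x y. dist (g x) (g y) = dist x y"
    using assms by (auto simp: isometry_group_def)
  have i: "\<And>x. g (iv g x) = x"
    using b by (simp add: bij_is_surj surj_f_inv_f)
  have "dist (iv g x) (iv g y) = dist x y" for x y
    using d[of "iv g x" "iv g y"] by (simp add: i)
  then show "iv g \<in> carrier isometry_group"
    using b by (simp add: isometry_group_def bij_imp_bij_inv)
  show "bij g" "dist (g x) (g y) = dist x y" "g (iv g x) = x" "iv g (g x) = x"
    using b d i by (simp_all add: bij_is_inj)
qed

lemma inv_isometry_group: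
  assumes "g \<in> carrier isometry_group"
  shows "inv\<^bsub>isometry_group\<^esub> g = iv g"
proof (rule group.inv_equality[OF group_isometry_group])
  show "iv g \<otimes>\<^bsub>isometry_group\<^esub> g = \<one>\<^bsub>isometry_group\<^esub>"
    using assms by (simp add: isometry_group_def bij_is_inj)
qed (use assms isometry_groupD(5)[OF assms] in auto)

lemma subgroup_isometryD:
  assumes G: "subgroup G isometry_group"
  shows "g \<in> G \<Longrightarrow> g \<in> carrier isometry_group" "id \<in> G"
    "g \<in> G \<Longrightarrow> h \<in> G \<Longrightarrow> g \<circ> h \<in> G" "g \<in> G \<Longrightarrow> iv g \<in> G" "g \<in> G \<Longrightarrow> g ^^ n \<in> G"
proof -
  have one: "id \<in> G"
    using subgroup.one_closed[OF G] by (simp add: isometry_group_def)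
  have mult: "g \<circ> h \<in> G" if "g \<in> G" "h \<in> G" for g h
    using subgroup.m_closed[OF G that] by (simp add: isometry_group_def)
  have pow: "g ^^ n \<in> G" if "g \<in> G" for g
    by (induction n) (simp_all only: funpow.simps one mult that)
  have inv: "iv g \<in> G" if "g \<in> G" for g
    using subgroup.m_inv_closed[OF G that] inv_isometry_group[OF subgroup.mem_carrier[OF G that]] by simp
  show "g \<in> G \<Longrightarrow> g \<in> carrier isometry_group"
    by (rule subgroup.mem_carrier[OF G])
  show "id \<in> G" "g \<in> G \<Longrightarrow> h \<in> G \<Longrightarrow> g \<circ> h \<in> G" "g \<in> G \<Longrightarrow> iv g \<in> G" "g \<in> G \<Longrightarrow> g ^^ n \<in> G"
    by (fact one, fact mult, fact inv, fact pow)
qed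

lemma gp_isometry:
  assumes "g \<in> carrier isometry_group"
  shows "gp z (g x) (g y) = gp (iv g z) x y"
  using isometry_groupD(2)[OF assms, of _ "iv g z"] isometry_groupD[OF assms]
  by (simp add: gromov_product_def)

lemma dist_inv_isometry:
  assumes "g \<in> carrier isometry_group"
  shows "dist x (iv g y) = dist (g x) y"
  using isometry_groupD(2)[OF assms, of x "iv g y"] isometry_groupD(3)[OF assms] by simp

lemma bp_isometry:
  assumes "g \<in> carrier isometry_group"
  shows "bp z (boundary_action g a) (boundary_action g b) = bp (iv g z) a b"
  by (rule ereal_eqI_le)
    (simp add: le_bp_iff boundary_action_def gp_isometry[OF assms])

lemma boundary_action_pt: "boundary_action g (pt x) = pt (g x)"
  by (auto simp: boundary_action_def pt_def)

lemma boundary_action_comp: "boundary_action (g \<circ> h) a = boundary_action g (boundary_action h a)"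
  by (auto simp: boundary_action_def image_image comp_assoc)

lemma boundary_action_inv:
  assumes "g \<in> carrier isometry_group"
  shows "boundary_action g (boundary_action (iv g) a) = a"
    "boundary_action (iv g) (boundary_action g a) = a"
proof -
  have "g \<circ> iv g = id" "iv g \<circ> g = id"
    using isometry_groupD[OF assms] by auto
  then show "boundary_action g (boundary_action (iv g) a) = a"
    "boundary_action (iv g) (boundary_action g a) = a"
    by (simp_all add: boundary_action_comp[symmetric]) (simp_all add: boundary_action_def)
qed

lemma filterlim_gp_isometry:
  assumes g: "g \<in> carrier isometry_group"
    and "filterlim (\<lambda>i. gp x0 (u i) (v i)) at_top F"
  shows "filterlim (\<lambda>i. gp x0 (g (u i)) (g (v i))) at_top F"
proof (rule filterlim_at_top_mono)
  show "filterlim (\<lambda>i. - dist x0 (iv g x0) + gp x0 (u i) (v i)) at_top F"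
    using assms(2) by (rule filterlim_tendsto_add_at_top[OF tendsto_const])
  show "\<forall>\<^sub>F i in F. - dist x0 (iv g x0) + gp x0 (u i) (v i) \<le> gp x0 (g (u i)) (g (v i))"
    using gp_lipschitz_base[of x0 "u _" "v _" "iv g x0"] by (simp add: gp_isometry[OF g])
qed

lemma gromov_sequence_isometry:
  assumes "g \<in> carrier isometry_group" "gromov_sequence x0 x"
  shows "gromov_sequence x0 (g \<circ> x)"
  using filterlim_gp_isometry[OF assms(1), of x0 "\<lambda>p. x (fst p)" "\<lambda>p. x (snd p)"] assms(2)
  by (simp add: gromov_sequence_def case_prod_unfold)

lemma gromov_rel_isometry:
  assumes "g \<in> carrier isometry_group" "(x, y) \<in> gromov_rel x0"
  shows "(g \<circ> x, g \<circ> y) \<in> gromov_rel x0"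
  using assms by (simp add: gromov_rel_def gromov_sequence_isometry filterlim_gp_isometry)

text \<open>Applying the inverse isometry shows that the image of a class is a whole class, not
  merely contained in one.\<close>

lemma boundary_action_in_boundary:
  assumes g: "g \<in> carrier isometry_group" and "\<xi> \<in> gromov_boundary x0"
  shows "boundary_action g \<xi> \<in> gromov_boundary x0"
proof -
  from assms(2) obtain x where x: "gromov_sequence x0 x" "\<xi> = gromov_rel x0 `` {x}"
    by (auto simp: gromov_boundary_def quotient_def)
  have "boundary_action g \<xi> = gromov_rel x0 `` {g \<circ> x}"
  proof safe
    fix y assume "y \<in> boundary_action g \<xi>"
    then show "(g \<circ> x, y) \<in> gromov_rel x0"
      using gromov_rel_isometry[OF g] x(2) by (auto simp: boundary_action_def)
  next
    fix y assume "(g \<circ> x, y) \<in> gromov_rel x0"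
    then have "(iv g \<circ> (g \<circ> x), iv g \<circ> y) \<in> gromov_rel x0"
      by (rule gromov_rel_isometry[OF isometry_groupD(5)[OF g]])
    moreover have "iv g \<circ> (g \<circ> x) = x" "y = g \<circ> (iv g \<circ> y)"
      using isometry_groupD[OF g] by auto
    ultimately show "y \<in> boundary_action g \<xi>"
      unfolding boundary_action_def x(2) by (metis Image_singleton_iff image_eqI)
  qed
  then show ?thesis
    using gromov_sequence_isometry[OF g x(1)] by (auto simp: gromov_boundary_def quotientI)
qed

section \<open>Hyperbolicity\<close>

locale hyperbolic =
  fixes x0 :: "'a::metric_space" and E :: real
  assumes E_nonneg: "0 \<le> E"
    and gp_hyp: "\<And>x y z w :: 'a. min (gp w x y) (gp w y z) - E \<le> gp w x z"
begin

abbreviation "bdry \<equiv> gromov_boundary x0"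

lemma gp_hypD: "M \<le> gp w x y \<Longrightarrow> M \<le> gp w y z \<Longrightarrow> M - E \<le> gp w (x::'a) z"
  using gp_hyp[of w x y z] by linarith

text \<open>One sequence of \<open>b\<close> at one late index serves as middle point, so a single
  \<open>E\<close> is lost although \<open>bp\<close> is an infimum. An empty \<open>b\<close> would
  make both bounds vacuous.\<close>

lemma le_bp_trans:
  fixes z :: 'a
  assumes "ereal M \<le> bp z a b" "ereal M \<le> bp z b c" "b \<noteq> {}"
  shows "ereal (M - E) \<le> bp z a c"
  unfolding le_bp_iff
proof (intro ballI allI impI)
  fix x y and e :: real assume xy: "x \<in> a" "y \<in> c" "0 < e"
  obtain u where u: "u \<in> b" using assms by auto
  obtain N1 where N1: "\<forall>n\<ge>N1. \<forall>m\<ge>N1. M - e < gp z (x n) (u m)"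
    using assms(1) xy u unfolding le_bp_iff by blast
  obtain N2 where N2: "\<forall>n\<ge>N2. \<forall>m\<ge>N2. M - e < gp z (u n) (y m)"
    using assms(2) xy u unfolding le_bp_iff by blast
  have "M - E - e < gp z (x n) (y m)" if "n \<ge> max N1 N2" "m \<ge> max N1 N2" for n m
  proof -
    have "M - e < gp z (x n) (u (max N1 N2))" "M - e < gp z (u (max N1 N2)) (y m)"
      using N1 N2 that by auto
    then show ?thesis using gp_hyp[of z "x n" "u (max N1 N2)" "y m"] by linarith
  qed
  then show "\<exists>N. \<forall>n\<ge>N. \<forall>m\<ge>N. M - E - e < gp z (x n) (y m)" by blast
qed

lemma gromov_rel_refl:
  assumes "gromov_sequence x0 x"
  shows "(x, x) \<in> gromov_rel x0"
proof -
  have "filterlim (\<lambda>n. gp x0 (x n) (x n)) at_top sequentially"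
    unfolding filterlim_at_top
  proof
    fix Z
    have "\<forall>\<^sub>F p in sequentially \<times>\<^sub>F sequentially. Z \<le> (case p of (n, m) \<Rightarrow> gp x0 (x n) (x m))"
      using assms unfolding gromov_sequence_def filterlim_at_top by blast
    then show "\<forall>\<^sub>F n in sequentially. Z \<le> gp x0 (x n) (x n)"
      unfolding eventually_prod_sequentially eventually_sequentially by auto
  qed
  then show ?thesis using assms by (simp add: gromov_rel_def)
qed

lemma boundary_nonempty:
  assumes "\<xi> \<in> bdry"
  shows "\<xi> \<noteq> {}"
  using assms gromov_rel_refl by (fastforce simp: gromov_boundary_def quotient_def)

lemma boundary_class:
  assumes "gromov_sequence x0 x"
  obtains \<xi> where "\<xi> \<in> bdry" "x \<in> \<xi>"
proof
  show "gromov_rel x0 `` {x} \<in> bdry"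
    using assms by (auto simp: gromov_boundary_def quotientI)
  show "x \<in> gromov_rel x0 `` {x}" using gromov_rel_refl[OF assms] by simp
qed

lemma boundary_gp_unbounded:
  assumes "\<xi> \<in> bdry" "x \<in> \<xi>" "y \<in> \<xi>"
  obtains N where "\<And>n m. n \<ge> N \<Longrightarrow> m \<ge> N \<Longrightarrow> M \<le> gp z (x n) (y m)"
proof -
  from assms obtain u where u: "gromov_sequence x0 u" "(u, x) \<in> gromov_rel x0" "(u, y) \<in> gromov_rel x0"
    by (auto simp: gromov_boundary_def quotient_def)
  \<comment> \<open>Base change costs \<open>dist x0 z\<close>. Equivalence controls equal indices
    only, so the way from \<open>x n\<close> to \<open>y m\<close> passes through \<open>u n\<close>
    and \<open>u m\<close> and costs \<open>E\<close> twice.\<close>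
  define L where "L = M + dist x0 z + 2 * E"
  have "\<forall>\<^sub>F p in sequentially \<times>\<^sub>F sequentially. L \<le> (case p of (n, m) \<Rightarrow> gp x0 (u n) (u m))"
    using u(1) unfolding gromov_sequence_def filterlim_at_top by blast
  then obtain N1 where N1: "\<forall>m\<ge>N1. \<forall>n\<ge>N1. L \<le> gp x0 (u n) (u m)"
    unfolding eventually_prod_sequentially by auto
  obtain N2 where N2: "\<forall>n\<ge>N2. L \<le> gp x0 (u n) (x n)"
    using u(2) unfolding gromov_rel_def filterlim_at_top eventually_sequentially by blast
  obtain N3 where N3: "\<forall>n\<ge>N3. L \<le> gp x0 (u n) (y n)"
    using u(3) unfolding gromov_rel_def filterlim_at_top eventually_sequentially by blast
  show ?thesis
  proof
    fix n m assume "n \<ge> N1 + N2 + N3" "m \<ge> N1 + N2 + N3"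
    then have "L \<le> gp x0 (x n) (u n)" "L \<le> gp x0 (u n) (u m)" "L \<le> gp x0 (u m) (y m)"
      using N1 N2 N3 by (auto simp: gp_commute)
    then have "L - 2 * E \<le> gp x0 (x n) (y m)"
      using gp_hyp[of x0 "x n" "u n" "u m"] gp_hyp[of x0 "x n" "u m" "y m"] E_nonneg by linarith
    then show "M \<le> gp z (x n) (y m)"
      using gp_lipschitz_base[of x0 "x n" "y m" z] L_def by linarith
  qed
qed

text \<open>Representatives of one class are mutually close, so good values at infinitely many
  indices of one of them bound the infimum over all, at the cost of \<open>E\<close>.\<close>

lemma le_bp_boundaryI:
  assumes "\<xi> \<in> bdry" "x \<in> \<xi>" "\<And>N. \<exists>n\<ge>N. M \<le> gp z (x n) y"
  shows "ereal (M - E) \<le> bp z \<xi> (pt y)"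
  unfolding le_bp_pt_right
proof (intro ballI allI impI)
  fix x' and e :: real assume x': "x' \<in> \<xi>" and "0 < e"
  obtain N where N: "\<And>n m. n \<ge> N \<Longrightarrow> m \<ge> N \<Longrightarrow> M \<le> gp z (x' n) (x m)"
    using boundary_gp_unbounded[OF assms(1) x' assms(2)] by metis
  obtain m where m: "m \<ge> N" "M \<le> gp z (x m) y" using assms(3) by blast
  have "M - E - e < gp z (x' n) y" if "n \<ge> N" for n
    using gp_hypD[OF N[OF that m(1)] m(2)] \<open>0 < e\<close> by linarith
  then show "\<exists>N. \<forall>n\<ge>N. M - E - e < gp z (x' n) y" by blast
qed

text \<open>A representative violating the bound infinitely often would, by
  \<open>le_bp_boundaryI\<close>, produce the excluded lower bound.\<close>

lemma asymp_le_boundary: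
  assumes "\<xi> \<in> bdry" "\<not> ereal u \<le> bp z \<xi> (pt w)"
  shows "asymp_le z w \<xi> (u + E)"
  unfolding asymp_le_def
proof (rule ballI, rule ccontr)
  fix x assume x: "x \<in> \<xi>" and *: "\<nexists>N. \<forall>n\<ge>N. gp z (x n) w \<le> u + E"
  have "\<exists>n\<ge>N. u + E \<le> gp z (x n) w" for N
    using * by (meson less_eq_real_def not_le)
  then have "ereal (u + E - E) \<le> bp z \<xi> (pt w)"
    by (rule le_bp_boundaryI[OF assms(1) x])
  then show False using assms(2) by simp
qed

end

section \<open>Hausdorff content\<close>

lemma infsum_ennreal_leI:
  fixes f :: "'i \<Rightarrow> ennreal"
  assumes "\<And>F. finite F \<Longrightarrow> F \<subseteq> A \<Longrightarrow> sum f F \<le> c"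
  shows "infsum f A \<le> c"
  using assms by (auto simp: nonneg_infsum_complete intro!: SUP_least)

lemma sum_le_infsum_ennreal:
  fixes f :: "'i \<Rightarrow> ennreal"
  assumes "finite F" "F \<subseteq> A"
  shows "sum f F \<le> infsum f A"
  using assms by (auto simp: nonneg_infsum_complete intro!: SUP_upper)

lemma le_infsum_ennreal:
  fixes f :: "'i \<Rightarrow> ennreal"
  assumes "x \<in> A"
  shows "f x \<le> infsum f A"
  using sum_le_infsum_ennreal[of "{x}" A f] assms by simp

lemma infsum_ennreal_mono2:
  fixes f :: "'i \<Rightarrow> ennreal"
  assumes "A \<subseteq> B"
  shows "infsum f A \<le> infsum f B"
  using assms by (intro infsum_ennreal_leI sum_le_infsum_ennreal) auto

lemma infsum_ennreal_mono:
  fixes f g :: "'i \<Rightarrow> ennreal"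
  assumes "\<And>x. x \<in> A \<Longrightarrow> f x \<le> g x"
  shows "infsum f A \<le> infsum g A"
proof (rule infsum_ennreal_leI)
  fix F assume F: "finite F" "F \<subseteq> A"
  then have "sum f F \<le> sum g F" using assms by (intro sum_mono) auto
  also have "\<dots> \<le> infsum g A" by (rule sum_le_infsum_ennreal[OF F])
  finally show "sum f F \<le> infsum g A" .
qed

lemma infsum_ennreal_image_le:
  fixes g :: "'j \<Rightarrow> ennreal"
  shows "infsum g (f ` I) \<le> infsum (\<lambda>i. g (f i)) I"
proof (rule infsum_ennreal_leI)
  fix F assume F: "finite F" "F \<subseteq> f ` I"
  then obtain J where J: "J \<subseteq> I" "inj_on f J" "F = f ` J"
    by (meson subset_image_inj)
  then have "sum g F = sum (\<lambda>i. g (f i)) J"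
    by (simp add: sum.reindex)
  also have "\<dots> \<le> infsum (\<lambda>i. g (f i)) I"
    using J F by (intro sum_le_infsum_ennreal) (auto simp: finite_image_iff)
  finally show "sum g F \<le> infsum (\<lambda>i. g (f i)) I" .
qed

lemma infsum_ennreal_cmult_le:
  fixes f g :: "'i \<Rightarrow> ennreal"
  assumes "\<And>i. i \<in> I \<Longrightarrow> f i \<le> c * g i"
  shows "infsum f I \<le> c * infsum g I"
proof (rule infsum_ennreal_leI)
  fix F assume F: "finite F" "F \<subseteq> I"
  then have "sum f F \<le> (\<Sum>i\<in>F. c * g i)"
    using assms by (intro sum_mono) auto
  also have "\<dots> \<le> c * infsum g I"
    using sum_le_infsum_ennreal[OF F, of g] by (simp add: sum_distrib_left[symmetric] mult_left_mono)
  finally show "sum f F \<le> c * infsum g I" .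
qed

lemma infsum_ennreal_Sigma_le:
  fixes f :: "'i \<times> 'j \<Rightarrow> ennreal"
  shows "infsum f (Sigma I J) \<le> infsum (\<lambda>i. infsum (\<lambda>j. f (i, j)) (J i)) I"
proof (rule infsum_ennreal_leI)
  fix F assume F: "finite F" "F \<subseteq> Sigma I J"
  have "sum f F = (\<Sum>i\<in>fst ` F. \<Sum>j\<in>{j. (i, j) \<in> F}. f (i, j))"
  proof -
    have "F = Sigma (fst ` F) (\<lambda>i. {j. (i, j) \<in> F})" by force
    moreover have "finite {j. (i, j) \<in> F}" for i
      using finite_imageI[OF F(1), of snd] by (rule rev_finite_subset) force
    ultimately show ?thesis
      using F(1) by (subst sum.Sigma) auto
  qed
  also have "\<dots> \<le> (\<Sum>i\<in>fst ` F. infsum (\<lambda>j. f (i, j)) (J i))"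
  proof (intro sum_mono sum_le_infsum_ennreal)
    show "finite {j. (i, j) \<in> F}" for i
      using finite_imageI[OF F(1), of snd] by (rule rev_finite_subset) force
  qed (use F in auto)
  also have "\<dots> \<le> infsum (\<lambda>i. infsum (\<lambda>j. f (i, j)) (J i)) I"
    using F by (intro sum_le_infsum_ennreal) auto
  finally show "sum f F \<le> infsum (\<lambda>i. infsum (\<lambda>j. f (i, j)) (J i)) I" .
qed

lemma sum_disjoint_infsum_ennreal_le:
  fixes f :: "'j \<Rightarrow> ennreal"
  assumes "finite V" "disjoint_family_on J V" "\<And>v. v \<in> V \<Longrightarrow> J v \<subseteq> U"
  shows "(\<Sum>v\<in>V. infsum f (J v)) \<le> infsum f U"
  using assms
proof (induction V arbitrary: U rule: finite_induct)
  case (insert v V)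
  have "J v \<inter> J w = {}" if "w \<in> V" for w
    using insert that by (auto simp: disjoint_family_on_def)
  note disj = this
  have *: "(\<Sum>w\<in>V. infsum f (J w)) \<le> infsum f (U - J v)"
  proof (intro insert.IH)
    show "disjoint_family_on J V"
      using insert.prems(1) by (auto simp: disjoint_family_on_def)
    show "J w \<subseteq> U - J v" if "w \<in> V" for w
      using insert.prems(2)[of w] disj[OF that] that by blast
  qed
  have "(\<Sum>w\<in>insert v V. infsum f (J w)) = infsum f (J v) + (\<Sum>w\<in>V. infsum f (J w))"
    using insert by simp
  also have "\<dots> \<le> infsum f (J v) + infsum f (U - J v)"
    using * by (rule add_left_mono)
  also have "\<dots> = infsum f (J v \<union> (U - J v))"
    by (subst infsum_Un_disjoint) (auto intro: nonneg_summable_on_complete)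
  also have "J v \<union> (U - J v) = U" using insert.prems by auto
  finally show ?case .
qed simp

lemma infsum_disjoint_infsum_ennreal_le:
  fixes f :: "'j \<Rightarrow> ennreal"
  assumes "disjoint_family_on J V" "\<And>v. v \<in> V \<Longrightarrow> J v \<subseteq> U"
  shows "infsum (\<lambda>v. infsum f (J v)) V \<le> infsum f U"
proof (rule infsum_ennreal_leI)
  fix F assume "finite F" "F \<subseteq> V"
  then show "(\<Sum>v\<in>F. infsum f (J v)) \<le> infsum f U"
    using disjoint_family_on_mono[of F V J] assms by (intro sum_disjoint_infsum_ennreal_le) blast+
qed

lemma ennreal_geometric_weights:
  assumes "countable I" "0 < (\<epsilon>::real)"
  obtains w :: "'i \<Rightarrow> real" where "\<And>i. 0 < w i" "infsum (\<lambda>i. ennreal (w i)) I \<le> ennreal \<epsilon>"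
proof
  define w where "w i = \<epsilon> / 2 * (1/2) ^ to_nat_on I i" for i
  show "0 < w i" for i using assms by (simp add: w_def)
  show "infsum (\<lambda>i. ennreal (w i)) I \<le> ennreal \<epsilon>"
  proof (rule infsum_ennreal_leI)
    fix F assume F: "finite F" "F \<subseteq> I"
    have inj: "inj_on (to_nat_on I) F"
      using F assms inj_on_to_nat_on inj_on_subset by blast
    have "sum w F = (\<Sum>n\<in>to_nat_on I ` F. \<epsilon> / 2 * (1/2) ^ n)"
      using inj by (simp add: sum.reindex w_def)
    also have "\<dots> \<le> (\<Sum>n. \<epsilon> / 2 * (1/2) ^ n)"
      using F assms by (intro sum_le_suminf) auto
    also have "\<dots> = \<epsilon>"
      by (subst suminf_mult) (auto simp: suminf_geometric)
    finally have "sum w F \<le> \<epsilon>" .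
    then show "(\<Sum>i\<in>F. ennreal (w i)) \<le> ennreal \<epsilon>"
      using assms by (subst sum_ennreal) (auto simp: w_def ennreal_leI)
  qed
qed

section \<open>Powers of diameters\<close>

lemma ediam_powr_le:
  assumes "0 < s" "0 \<le> \<rho>" "\<And>x y. x \<in> A \<Longrightarrow> y \<in> A \<Longrightarrow> D x y \<le> \<rho>"
  shows "ediam_powr D s A \<le> ennreal (\<rho> powr s)"
proof -
  have "ediam D A \<le> ennreal \<rho>"
    unfolding ediam_def using assms by (intro SUP_least ennreal_leI) auto
  then have "ediam D A \<noteq> \<infinity>" "enn2real (ediam D A) \<le> \<rho>"
    using assms(2) by (auto simp: top_unique enn2real_leI)
  then show ?thesis
    using assms(1) by (auto simp: ediam_powr_def intro!: ennreal_leI powr_mono2)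
qed

lemma le_ediam_powr:
  assumes "0 < s" "x \<in> A" "y \<in> A" "0 \<le> D x y"
  shows "ennreal (D x y powr s) \<le> ediam_powr D s A"
proof (cases "ediam D A = \<infinity>")
  case True
  then show ?thesis using assms by (auto simp: ediam_powr_def)
next
  case False
  have "ennreal (D x y) \<le> ediam D A"
    unfolding ediam_def using assms by (meson SUP_upper2 SUP_upper order_trans)
  then have "D x y \<le> enn2real (ediam D A)"
    using False assms(4) by (metis enn2real_ennreal enn2real_mono infinity_ennreal_def top.not_eq_extremum)
  then show ?thesis
    using assms False by (auto simp: ediam_powr_def intro!: ennreal_leI powr_mono2)
qed

lemma ediam_powr_le_iff:
  assumes "0 < s" "0 \<le> \<rho>" "\<And>x y. x \<in> A \<Longrightarrow> y \<in> A \<Longrightarrow> 0 \<le> D x y"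
  shows "ediam_powr D s A \<le> ennreal (\<rho> powr s) \<longleftrightarrow> (\<forall>x\<in>A. \<forall>y\<in>A. D x y \<le> \<rho>)"
proof
  assume *: "ediam_powr D s A \<le> ennreal (\<rho> powr s)"
  show "\<forall>x\<in>A. \<forall>y\<in>A. D x y \<le> \<rho>"
  proof (intro ballI)
    fix x y assume xy: "x \<in> A" "y \<in> A"
    have "ennreal (D x y powr s) \<le> ennreal (\<rho> powr s)"
      using le_ediam_powr[of s x A y D] xy assms * by (meson order_trans)
    then have "D x y powr s \<le> \<rho> powr s" by (simp add: ennreal_le_iff)
    then show "D x y \<le> \<rho>"
      using assms(1,2) by (meson powr_less_mono2 not_le)
  qed
next
  assume "\<forall>x\<in>A. \<forall>y\<in>A. D x y \<le> \<rho>"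
  then show "ediam_powr D s A \<le> ennreal (\<rho> powr s)"
    using assms(1,2) by (intro ediam_powr_le) auto
qed

lemma ediam_powr_mono:
  assumes "A \<subseteq> B" "0 < s"
  shows "ediam_powr D s A \<le> ediam_powr D s B"
proof (cases "A = {} \<or> ediam D B = \<infinity>")
  case True
  then show ?thesis using assms by (auto simp: ediam_powr_def)
next
  case False
  have le: "ediam D A \<le> ediam D B"
    unfolding ediam_def using assms by (meson SUP_mono SUP_subset_mono order_refl)
  then have "ediam D A \<noteq> \<infinity>" using False by (auto simp: top_unique)
  moreover have "enn2real (ediam D A) \<le> enn2real (ediam D B)"
    using le False by (simp add: enn2real_mono top.not_eq_extremum)
  ultimately show ?thesis
    using False assms by (auto simp: ediam_powr_def intro!: ennreal_leI powr_mono2)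
qed

section \<open>Covers and contents\<close>

lemma hausdorff_content_le_cover:
  assumes "countable I" "\<And>i. i \<in> I \<Longrightarrow> A i \<subseteq> M" "S \<subseteq> (\<Union>i\<in>I. A i)"
  shows "hausdorff_content M D s S \<le> (\<Sum>\<^sub>\<infinity>i\<in>I. ediam_powr D s (A i))"
proof -
  have "hausdorff_content M D s S \<le> (\<Sum>\<^sub>\<infinity>B\<in>A ` I. ediam_powr D s B)"
    unfolding hausdorff_content_def hausdorff_premeasure_def
    using assms by (intro INF_lower) auto
  also have "\<dots> \<le> (\<Sum>\<^sub>\<infinity>i\<in>I. ediam_powr D s (A i))"
    by (rule infsum_ennreal_image_le)
  finally show ?thesis .
qed

lemma hausdorff_content_less_cover:
  assumes "hausdorff_content M D s S < c"
  obtains \<C> where "countable \<C>" "\<C> \<subseteq> Pow M" "S \<subseteq> \<Union>\<C>" "(\<Sum>\<^sub>\<infinity>A\<in>\<C>. ediam_powr D s A) < c"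
  using assms unfolding hausdorff_content_def hausdorff_premeasure_def INF_less_iff
  by (elim bexE CollectE conjE)

text \<open>Strict bounds \<open>c i\<close> let a cover of each piece be chosen below its bound
  directly, with no epsilon inside the proof.\<close>

lemma hausdorff_content_subadditive:
  assumes I: "countable I" and "\<And>i. i \<in> I \<Longrightarrow> hausdorff_content M D s (S i) < c i"
    and "T \<subseteq> (\<Union>i\<in>I. S i)"
  shows "hausdorff_content M D s T \<le> infsum c I"
proof -
  define P where "P i \<C> \<longleftrightarrow> countable \<C> \<and> \<C> \<subseteq> Pow M \<and> S i \<subseteq> \<Union>\<C> \<and> (\<Sum>\<^sub>\<infinity>A\<in>\<C>. ediam_powr D s A) < c i" for i \<C>
  have "\<exists>\<C>. P i \<C>" if i: "i \<in> I" for i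
  proof -
    obtain \<C> where "countable \<C>" "\<C> \<subseteq> Pow M" "S i \<subseteq> \<Union>\<C>" "(\<Sum>\<^sub>\<infinity>A\<in>\<C>. ediam_powr D s A) < c i"
      by (rule hausdorff_content_less_cover[OF assms(2)[OF i]])
    then have "P i \<C>" unfolding P_def by (intro conjI)
    then show ?thesis ..
  qed
  then obtain \<C> where P: "\<And>i. i \<in> I \<Longrightarrow> P i (\<C> i)" by metis
  have \<C>: "\<And>i. i \<in> I \<Longrightarrow> countable (\<C> i)" "\<And>i. i \<in> I \<Longrightarrow> \<C> i \<subseteq> Pow M"
    "\<And>i. i \<in> I \<Longrightarrow> S i \<subseteq> \<Union>(\<C> i)" "\<And>i. i \<in> I \<Longrightarrow> (\<Sum>\<^sub>\<infinity>A\<in>\<C> i. ediam_powr D s A) < c i"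
    using P unfolding P_def by (simp_all only: simp_thms)
  have "T \<subseteq> (\<Union>p\<in>Sigma I \<C>. snd p)"
  proof
    fix x assume "x \<in> T"
    then obtain i where i: "i \<in> I" "x \<in> S i" using assms(3) by blast
    then obtain A where "A \<in> \<C> i" "x \<in> A" using \<C>(3)[OF i(1)] by blast
    then show "x \<in> (\<Union>p\<in>Sigma I \<C>. snd p)" using i(1) by force
  qed
  moreover have "snd p \<subseteq> M" if "p \<in> Sigma I \<C>" for p
    using \<C>(2) that by fastforce
  moreover have "countable (Sigma I \<C>)"
    using I \<C>(1) by (rule countable_SIGMA)
  ultimately have "hausdorff_content M D s T \<le> (\<Sum>\<^sub>\<infinity>p\<in>Sigma I \<C>. ediam_powr D s (snd p))"
    by (intro hausdorff_content_le_cover)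
  also have "\<dots> \<le> (\<Sum>\<^sub>\<infinity>i\<in>I. \<Sum>\<^sub>\<infinity>A\<in>\<C> i. ediam_powr D s A)"
    using infsum_ennreal_Sigma_le[of "\<lambda>p. ediam_powr D s (snd p)" I \<C>] by simp
  also have "\<dots> \<le> infsum c I"
    using \<C>(4) by (intro infsum_ennreal_mono) (auto simp: less_imp_le)
  finally show ?thesis .
qed

lemma hausdorff_content_zero_UN:
  assumes "countable I" "\<And>i. i \<in> I \<Longrightarrow> hausdorff_content M D s (S i) = 0" "T \<subseteq> (\<Union>i\<in>I. S i)"
  shows "hausdorff_content M D s T = 0"
proof -
  have "hausdorff_content M D s T \<le> ennreal \<epsilon>" if \<epsilon>: "0 < \<epsilon>" for \<epsilon>
  proof -
    obtain w :: "_ \<Rightarrow> real" where w: "\<And>i. 0 < w i" "infsum (\<lambda>i. ennreal (w i)) I \<le> ennreal \<epsilon>"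
      by (rule ennreal_geometric_weights[OF assms(1) \<epsilon>]) blast
    have "hausdorff_content M D s T \<le> infsum (\<lambda>i. ennreal (w i)) I"
      using assms w(1) by (intro hausdorff_content_subadditive) auto
    then show ?thesis using w(2) by (meson order_trans)
  qed
  then show ?thesis
    by (metis ennreal_le_epsilon add_0 le_zero_eq)
qed

lemma hausdorff_content_Lipschitz_image:
  assumes s: "0 < s" and L: "0 < L" and f: "f ` S \<subseteq> M"
    and lip: "\<And>x y. x \<in> S \<Longrightarrow> y \<in> S \<Longrightarrow> D (f x) (f y) \<le> L * D x y"
    and D: "\<And>x y. 0 \<le> D x y"
    and c: "hausdorff_content M D s S < c"
  shows "hausdorff_content M D s (f ` S) \<le> ennreal (L powr s) * c"
proof -
  obtain \<C> where \<C>: "countable \<C>" "\<C> \<subseteq> Pow M" "S \<subseteq> \<Union>\<C>" "(\<Sum>\<^sub>\<infinity>A\<in>\<C>. ediam_powr D s A) < c"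
    by (rule hausdorff_content_less_cover[OF c])
  \<comment> \<open>The map is controlled on \<open>S\<close> only, so the cover is cut down to
    \<open>S\<close> before images are taken.\<close>
  have "hausdorff_content M D s (f ` S) \<le> (\<Sum>\<^sub>\<infinity>A\<in>\<C>. ediam_powr D s (f ` (A \<inter> S)))"
  proof (rule hausdorff_content_le_cover[OF \<C>(1)])
    show "f ` S \<subseteq> (\<Union>A\<in>\<C>. f ` (A \<inter> S))" using \<C>(3) by blast
  qed (use f in auto)
  also have "\<dots> \<le> ennreal (L powr s) * (\<Sum>\<^sub>\<infinity>A\<in>\<C>. ediam_powr D s A)"
  proof (rule infsum_ennreal_cmult_le)
    fix A
    show "ediam_powr D s (f ` (A \<inter> S)) \<le> ennreal (L powr s) * ediam_powr D s A"
    proof (cases "A = {} \<or> ediam D A = \<infinity>")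
      case True
      then show ?thesis using L s by (auto simp: ediam_powr_def ennreal_mult_top)
    next
      case False
      define \<rho> where "\<rho> = enn2real (ediam D A)"
      have \<rho>: "0 \<le> \<rho>" "ediam_powr D s A = ennreal (\<rho> powr s)"
        using False s by (auto simp: ediam_powr_def \<rho>_def)
      have "\<forall>x\<in>A. \<forall>y\<in>A. D x y \<le> \<rho>"
        using ediam_powr_le_iff[of s \<rho> A D] s \<rho> D by simp
      then have "D (f x) (f y) \<le> L * \<rho>" if "x \<in> A \<inter> S" "y \<in> A \<inter> S" for x y
        using lip[of x y] that L by (smt (verit) IntD1 IntD2 mult_left_mono)
      then have "ediam_powr D s (f ` (A \<inter> S)) \<le> ennreal ((L * \<rho>) powr s)"
        using s L \<rho> by (intro ediam_powr_le) auto
      then show ?thesis using \<rho> L by (simp add: powr_mult ennreal_mult)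
    qed
  qed
  also have "\<dots> \<le> ennreal (L powr s) * c"
    using \<C>(4) by (intro mult_left_mono) auto
  finally show ?thesis .
qed

text \<open>Cutting a cover down to \<open>S\<close> makes its diameters at most 1, where a larger
  exponent gives a smaller power.\<close>

lemma hausdorff_content_exponent_antimono:
  assumes s: "0 < s'" "s' \<le> s" and S: "S \<subseteq> M"
    and diam: "\<And>x y. x \<in> S \<Longrightarrow> y \<in> S \<Longrightarrow> D x y \<le> 1" and D: "\<And>x y. 0 \<le> D x y"
  shows "hausdorff_content M D s S \<le> hausdorff_content M D s' S"
proof (rule dense_ge)
  fix c assume "hausdorff_content M D s' S < c"
  then obtain \<C> where \<C>: "countable \<C>" "\<C> \<subseteq> Pow M" "S \<subseteq> \<Union>\<C>" "(\<Sum>\<^sub>\<infinity>A\<in>\<C>. ediam_powr D s' A) < c"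
    by (rule hausdorff_content_less_cover)
  have "hausdorff_content M D s S \<le> (\<Sum>\<^sub>\<infinity>A\<in>\<C>. ediam_powr D s (A \<inter> S))"
    using \<C> S by (intro hausdorff_content_le_cover) auto
  also have "\<dots> \<le> (\<Sum>\<^sub>\<infinity>A\<in>\<C>. ediam_powr D s' A)"
  proof (rule infsum_ennreal_mono)
    fix A
    have "ediam D (A \<inter> S) \<le> 1"
      unfolding ediam_def using diam by (intro SUP_least) auto
    then have "ediam D (A \<inter> S) \<noteq> \<infinity>" "enn2real (ediam D (A \<inter> S)) \<le> 1"
      by (auto simp: top_unique enn2real_leI)
    then have "ediam_powr D s (A \<inter> S) \<le> ediam_powr D s' (A \<inter> S)"
      using s by (auto simp: ediam_powr_def intro!: ennreal_leI powr_mono')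
    also have "\<dots> \<le> ediam_powr D s' A"
      using s by (intro ediam_powr_mono) auto
    finally show "ediam_powr D s (A \<inter> S) \<le> ediam_powr D s' A" .
  qed
  finally show "hausdorff_content M D s S \<le> c" using \<C>(4) by simp
qed

section \<open>Contents and Hausdorff dimension\<close>

lemma hausdorff_dim_nonneg: "0 \<le> hausdorff_dim M D S"
  unfolding hausdorff_dim_def by (rule INF_greatest) auto

text \<open>A cover of total weight below \<open>\<rho> powr s\<close> consists of sets of diameter
  at most \<open>\<rho>\<close>, so covers witnessing a small content are automatically fine enough
  for the premeasures.\<close>

lemma hausdorff_content_zero_imp_dim_le:
  assumes s: "0 < s" and D: "\<And>x y. 0 \<le> D x y" and c: "hausdorff_content M D s S = 0"
  shows "hausdorff_dim M D S \<le> ereal s"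
proof -
  have "hausdorff_premeasure M D \<epsilon> s S \<le> ennreal e" if \<epsilon>: "0 < \<epsilon>" and e: "0 < e" for \<epsilon> e
  proof -
    obtain \<rho> where \<rho>: "0 < \<rho>" "ennreal \<rho> \<le> \<epsilon>"
    proof (cases \<epsilon>)
      case (real r) then show ?thesis using that \<epsilon> by auto
    next
      case top then show ?thesis using that[of 1] by auto
    qed
    have "hausdorff_content M D s S < ennreal (min e (\<rho> powr s))"
      using c e \<rho> by simp
    then obtain \<C> where \<C>: "countable \<C>" "\<C> \<subseteq> Pow M" "S \<subseteq> \<Union>\<C>"
      "(\<Sum>\<^sub>\<infinity>A\<in>\<C>. ediam_powr D s A) < ennreal (min e (\<rho> powr s))"
      by (rule hausdorff_content_less_cover)
    have "ediam D A \<le> \<epsilon>" if "A \<in> \<C>" for A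
    proof -
      have "ediam_powr D s A \<le> ennreal (min e (\<rho> powr s))"
        using le_infsum_ennreal[OF that, of "ediam_powr D s"] \<C>(4) by simp
      also have "\<dots> \<le> ennreal (\<rho> powr s)" by (intro ennreal_leI) simp
      finally have "\<forall>x\<in>A. \<forall>y\<in>A. D x y \<le> \<rho>"
        using ediam_powr_le_iff[of s \<rho> A D] s \<rho> D by simp
      then have "ediam D A \<le> ennreal \<rho>"
        unfolding ediam_def by (intro SUP_least ennreal_leI) auto
      then show ?thesis using \<rho>(2) by simp
    qed
    then have "hausdorff_premeasure M D \<epsilon> s S \<le> (\<Sum>\<^sub>\<infinity>A\<in>\<C>. ediam_powr D s A)"
      unfolding hausdorff_premeasure_def using \<C> by (intro INF_lower) auto
    also have "\<dots> \<le> ennreal e"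
      using less_imp_le[OF \<C>(4)] by (rule order_trans) (simp add: ennreal_leI)
    finally show ?thesis .
  qed
  then have "hausdorff_premeasure M D \<epsilon> s S \<le> 0" if "0 < \<epsilon>" for \<epsilon>
    using that by (metis ennreal_le_epsilon add_0)
  then have "hausdorff_measure M D s S \<le> 0"
    unfolding hausdorff_measure_def by (intro SUP_least) auto
  then show ?thesis
    unfolding hausdorff_dim_def using s by (intro INF_lower) auto
qed

text \<open>A smaller exponent \<open>s'\<close> of measure zero would give covers by sets of
  diameter at most 1 with small \<open>s'\<close>-weight, and on such sets the
  \<open>s\<close>-weight is smaller still.\<close>

lemma hausdorff_content_nonzero_imp_dim_ge:
  assumes s: "0 < s" and S: "S \<subseteq> M" and D: "\<And>x y. 0 \<le> D x y" and c: "hausdorff_content M D s S \<noteq> 0"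
  shows "ereal s \<le> hausdorff_dim M D S"
  unfolding hausdorff_dim_def
proof (rule INF_greatest, rule ccontr)
  fix s' assume s': "s' \<in> {s. 0 \<le> s \<and> hausdorff_measure M D s S = 0}" and "\<not> ereal s \<le> ereal s'"
  then have *: "0 \<le> s'" "s' < s" "hausdorff_measure M D s' S = 0" by auto
  have "hausdorff_premeasure M D 1 s' S \<le> hausdorff_measure M D s' S"
    unfolding hausdorff_measure_def by (intro SUP_upper) simp
  then have zero: "hausdorff_premeasure M D 1 s' S = 0" using *(3) by simp
  have "hausdorff_content M D s S \<le> 0 + ennreal e" if e: "0 < e" for e
  proof -
    have "hausdorff_premeasure M D 1 s' S < ennreal e"
      using zero e by simp
    then obtain \<C> where \<C>: "countable \<C>" "\<C> \<subseteq> Pow M" "S \<subseteq> \<Union>\<C>" "\<forall>A\<in>\<C>. ediam D A \<le> 1"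
      "(\<Sum>\<^sub>\<infinity>A\<in>\<C>. ediam_powr D s' A) < ennreal e"
      unfolding hausdorff_premeasure_def INF_less_iff by (elim bexE CollectE conjE)
    have "hausdorff_content M D s S \<le> (\<Sum>\<^sub>\<infinity>A\<in>\<C>. ediam_powr D s A)"
      using \<C>(1-3) by (intro hausdorff_content_le_cover) auto
    also have "\<dots> \<le> (\<Sum>\<^sub>\<infinity>A\<in>\<C>. ediam_powr D s' A)"
    proof (rule infsum_ennreal_mono)
      fix A assume "A \<in> \<C>"
      then have "ediam D A \<noteq> \<infinity>" "enn2real (ediam D A) \<le> 1"
        using \<C>(4) by (auto simp: top_unique enn2real_leI)
      \<comment> \<open>The exponent \<open>s'\<close> may be 0, where nonempty sets have weight 1
        by convention; this case needs \<open>powr_le1\<close>.\<close>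
      then show "ediam_powr D s A \<le> ediam_powr D s' A"
        using * s
        by (auto simp: ediam_powr_def intro!: ennreal_leI powr_mono')
          (simp add: powr_le1)
    qed
    also have "\<dots> \<le> ennreal e" using \<C>(5) by simp
    finally show ?thesis by simp
  qed
  then have "hausdorff_content M D s S \<le> 0" by (rule ennreal_le_epsilon) auto
  then show False using c by simp
qed

section \<open>Visual metrics and groups of general type\<close>

locale visual_group = hyperbolic x0 E
  for x0 :: "'a::metric_space" and E :: real +
  fixes b Cv :: real and D :: "'a bdpoint \<Rightarrow> 'a bdpoint \<Rightarrow> real" and G :: "('a \<Rightarrow> 'a) set"
  assumes b_gt_1: "1 < b" and Cv_ge_1: "1 \<le> Cv"
    and metric: "Metric_space bdry D"
    and visual_ge: "\<And>\<xi> \<eta>. \<xi> \<in> bdry \<Longrightarrow> \<eta> \<in> bdry \<Longrightarrow> inverse Cv * powr_neg b (bp x0 \<xi> \<eta>) \<le> D \<xi> \<eta>"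
    and visual_le: "\<And>\<xi> \<eta>. \<xi> \<in> bdry \<Longrightarrow> \<eta> \<in> bdry \<Longrightarrow> D \<xi> \<eta> \<le> Cv * powr_neg b (bp x0 \<xi> \<eta>)"
    and subgroup: "subgroup G isometry_group"
    and discrete: "strongly_discrete x0 G"
begin

abbreviation nrm :: "('a \<Rightarrow> 'a) \<Rightarrow> real" where "nrm g \<equiv> dist x0 (g x0)"
abbreviation "act \<equiv> boundary_action :: ('a \<Rightarrow> 'a) \<Rightarrow> _"

lemma D_nonneg: "0 \<le> D \<xi> \<eta>" and D_commute: "D \<xi> \<eta> = D \<eta> \<xi>"
  using metric by (simp_all add: Metric_space_def)

lemma D_triangle: "\<xi> \<in> bdry \<Longrightarrow> \<eta> \<in> bdry \<Longrightarrow> \<zeta> \<in> bdry \<Longrightarrow> D \<xi> \<zeta> \<le> D \<xi> \<eta> + D \<eta> \<zeta>"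
  by (rule Metric_space.triangle[OF metric])

lemma D_eq_0_iff: "\<xi> \<in> bdry \<Longrightarrow> \<eta> \<in> bdry \<Longrightarrow> D \<xi> \<eta> = 0 \<longleftrightarrow> \<xi> = \<eta>"
  by (rule Metric_space.zero[OF metric])

lemma carrier_G: "g \<in> G \<Longrightarrow> g \<in> carrier isometry_group"
  by (rule subgroup_isometryD(1)[OF subgroup])

lemmas id_G = subgroup_isometryD(2)[OF subgroup]
lemmas comp_G = subgroup_isometryD(3)[OF subgroup]
lemmas inv_G = subgroup_isometryD(4)[OF subgroup]
lemmas pow_G = subgroup_isometryD(5)[OF subgroup]

lemma act_boundary: "g \<in> G \<Longrightarrow> \<xi> \<in> bdry \<Longrightarrow> act g \<xi> \<in> bdry"
  by (intro boundary_action_in_boundary carrier_G)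

lemma act_inv:
  assumes "g \<in> G"
  shows "act g (act (iv g) \<xi>) = \<xi>" "act (iv g) (act g \<xi>) = \<xi>"
  using boundary_action_inv[OF carrier_G[OF assms]] by auto

lemma dist_isometry: "g \<in> G \<Longrightarrow> dist (g x) (g y) = dist x y"
  by (rule isometry_groupD(2)[OF carrier_G])

lemma nrm_inv: "g \<in> G \<Longrightarrow> dist x0 (iv g x0) = nrm g"
  using dist_inv_isometry[OF carrier_G, of g x0 x0] by (simp add: dist_commute)

lemma bp_act: "g \<in> G \<Longrightarrow> bp x0 (act g a) (act g c) = bp (iv g x0) a c"
  by (rule bp_isometry[OF carrier_G])

lemma le_bp_act:
  assumes "g \<in> G" "ereal M \<le> bp x0 a c"
  shows "ereal (M - nrm g) \<le> bp x0 (act g a) (act g c)"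
  using le_bp_base[OF assms(2), of "iv g x0"] assms(1) by (simp add: bp_act nrm_inv)

lemma nrm_comp_le: "g \<in> G \<Longrightarrow> nrm (g \<circ> h) \<le> nrm g + nrm h"
  using dist_triangle[of x0 "g (h x0)" "g x0"] dist_isometry[of g x0 "h x0"] by simp

lemma nrm_comp_ge: "g \<in> G \<Longrightarrow> nrm h - nrm g \<le> nrm (g \<circ> h)"
  using dist_triangle[of "g x0" "g (h x0)" x0] dist_isometry[of g x0 "h x0"]
  by (simp add: dist_commute)

lemma nrm_comp:
  assumes "g \<in> G"
  shows "nrm (g \<circ> h) = nrm g + nrm h - 2 * gp x0 (iv g x0) (h x0)"
proof -
  have "dist (iv g x0) (h x0) = dist x0 (g (h x0))"
    using dist_inv_isometry[OF carrier_G[OF assms], of "h x0" x0] by (simp add: dist_commute)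
  then show ?thesis using nrm_inv[OF assms] by (simp add: gromov_product_def dist_commute field_simps)
qed

lemma gp_comp:
  assumes "g \<in> G"
  shows "gp x0 (g x0) (g (h x0)) = nrm g - gp x0 (iv g x0) (h x0)"
  using nrm_comp[OF assms, of h] dist_isometry[OF assms, of x0 "h x0"]
  by (simp add: gromov_product_def dist_commute field_simps)

text \<open>On the scale of exponents, each passage between \<open>D\<close> and \<open>bp\<close>
  costs an additive \<open>kv\<close>.\<close>

definition kv :: real where "kv = log b Cv"

lemma kv_nonneg: "0 \<le> kv" and b_powr_kv: "b powr kv = Cv"
  using b_gt_1 Cv_ge_1 by (simp_all add: kv_def)

lemma powr_neg_le:
  assumes "ereal M \<le> t"
  shows "powr_neg b t \<le> b powr - M"
  using assms b_gt_1 by (cases t) (auto simp: powr_neg_def)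

lemma D_le_of_bp:
  assumes "\<xi> \<in> bdry" "\<eta> \<in> bdry" "ereal M \<le> bp x0 \<xi> \<eta>"
  shows "D \<xi> \<eta> \<le> b powr (kv - M)"
proof -
  have "D \<xi> \<eta> \<le> Cv * b powr - M"
    using visual_le[OF assms(1,2)] powr_neg_le[OF assms(3)] Cv_ge_1
    by (smt (verit) mult_left_mono)
  also have "\<dots> = b powr (kv - M)"
    by (simp add: powr_diff powr_minus b_powr_kv divide_inverse)
  finally show ?thesis .
qed

lemma bp_of_D_le:
  assumes "\<xi> \<in> bdry" "\<eta> \<in> bdry" "D \<xi> \<eta> \<le> b powr - (M + kv)"
  shows "ereal M \<le> bp x0 \<xi> \<eta>"
proof (rule ccontr)
  assume "\<not> ereal M \<le> bp x0 \<xi> \<eta>"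
  then obtain r where r: "bp x0 \<xi> \<eta> = ereal r" "r < M"
    using bp_nonneg[of x0 \<xi> \<eta>] by (cases "bp x0 \<xi> \<eta>") auto
  have "b powr - (M + kv) < b powr - (r + kv)"
    using b_gt_1 r by simp
  also have "\<dots> = inverse Cv * b powr - r"
    by (simp add: powr_diff powr_minus b_powr_kv field_simps)
  also have "\<dots> \<le> D \<xi> \<eta>"
    using visual_ge[OF assms(1,2)] r by (simp add: powr_neg_def)
  finally show False using assms(3) by simp
qed

text \<open>The comparison of \<open>D\<close> with \<open>bp\<close> is used once on each side,
  hence \<open>2 * kv\<close>. Expressing the gain \<open>k\<close> through real lower bounds also
  covers infinite products, that is, distance 0.\<close>

lemma D_compare:
  assumes "\<xi> \<in> bdry" "\<eta> \<in> bdry" "\<xi>' \<in> bdry" "\<eta>' \<in> bdry"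
    and le: "\<And>M. ereal M \<le> bp x0 \<xi> \<eta> \<Longrightarrow> ereal (M + k) \<le> bp x0 \<xi>' \<eta>'"
  shows "D \<xi>' \<eta>' \<le> b powr (2 * kv - k) * D \<xi> \<eta>"
proof (cases "bp x0 \<xi> \<eta>")
  case (real r)
  have "D \<xi>' \<eta>' \<le> b powr (kv - (r + k))"
    using assms real by (intro D_le_of_bp) auto
  also have "\<dots> = b powr (2 * kv - k) * b powr - (r + kv)"
    by (subst powr_add[symmetric]) (simp add: algebra_simps)
  also have "b powr - (r + kv) \<le> D \<xi> \<eta>"
  proof (rule ccontr)
    assume "\<not> b powr - (r + kv) \<le> D \<xi> \<eta>"
    then have D: "D \<xi> \<eta> < b powr - (r + kv)" by simp
    have "inverse Cv * b powr - r = b powr - (r + kv)"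
      by (simp add: powr_diff powr_minus b_powr_kv field_simps)
    then show False
      using visual_ge[OF assms(1,2)] real D by (simp add: powr_neg_def)
  qed
  finally show ?thesis using b_gt_1 by (simp add: mult_left_mono)
next
  case PInf
  have "bp x0 \<xi>' \<eta>' = \<infinity>"
  proof (rule ereal_top)
    fix B show "ereal B \<le> bp x0 \<xi>' \<eta>'" using le[of "B - k"] PInf by simp
  qed
  then have "D \<xi>' \<eta>' \<le> 0"
    using visual_le[OF assms(3,4)] by (simp add: powr_neg_def)
  then show ?thesis using D_nonneg by (smt (verit) mult_nonneg_nonneg powr_ge_zero)
next
  case MInf
  then show ?thesis using bp_nonneg[of x0 \<xi> \<eta>] by simp
qed

lemma D_act_le:
  assumes "g \<in> G" "\<xi> \<in> bdry" "\<eta> \<in> bdry"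
  shows "D (act g \<xi>) (act g \<eta>) \<le> b powr (2 * kv + nrm g) * D \<xi> \<eta>"
proof -
  have "ereal (M + - nrm g) \<le> bp x0 (act g \<xi>) (act g \<eta>)" if "ereal M \<le> bp x0 \<xi> \<eta>" for M
    using le_bp_act[OF assms(1) that] by simp
  then show ?thesis
    using D_compare[of \<xi> \<eta> "act g \<xi>" "act g \<eta>" "- nrm g"] assms by (simp add: act_boundary)
qed

lemma bp_bounded_of_D_ge:
  assumes "0 < c"
  obtains M where "0 \<le> M" "\<And>\<xi> \<eta>. \<xi> \<in> bdry \<Longrightarrow> \<eta> \<in> bdry \<Longrightarrow> c \<le> D \<xi> \<eta> \<Longrightarrow> \<not> ereal M \<le> bp x0 \<xi> \<eta>"
proof
  \<comment> \<open>\<open>c / 2\<close> instead of \<open>c\<close> brings the bound on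
    \<open>D\<close> strictly below \<open>c\<close>.\<close>
  define M where "M = \<bar>kv - log b (c / 2)\<bar>"
  show "0 \<le> M" by (simp add: M_def)
  fix \<xi> \<eta> assume *: "\<xi> \<in> bdry" "\<eta> \<in> bdry" "c \<le> D \<xi> \<eta>"
  show "\<not> ereal M \<le> bp x0 \<xi> \<eta>"
  proof
    assume "ereal M \<le> bp x0 \<xi> \<eta>"
    then have "D \<xi> \<eta> \<le> b powr (kv - M)" using * by (intro D_le_of_bp)
    also have "\<dots> \<le> b powr (log b (c / 2))"
      using b_gt_1 by (intro powr_mono) (auto simp: M_def)
    also have "\<dots> = c / 2" using b_gt_1 assms by simp
    finally show False using * assms by simp
  qed
qed

lemma finite_ball_G: "finite {g \<in> G. nrm g \<le> r}"
proof -
  have "finite {g \<in> G. nrm g \<le> max r 1}"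
    using discrete unfolding strongly_discrete_def by (simp add: less_max_iff_disj)
  then show ?thesis by (rule rev_finite_subset) auto
qed

lemma countable_G: "countable G"
proof -
  have "G = (\<Union>n::nat. {g \<in> G. nrm g \<le> n})"
    by (auto intro: real_arch_simple)
  moreover have "countable (\<Union>n::nat. {g \<in> G. nrm g \<le> n})"
    using finite_ball_G by (intro countable_UN) (auto intro: countable_finite)
  ultimately show ?thesis by simp
qed

section \<open>Turning\<close>

lemma attractingD:
  assumes "attracting x0 D g p q" "q \<in> bdry" "0 < e"
  obtains n where "\<And>\<eta>. \<eta> \<in> bdry \<Longrightarrow> e \<le> D q \<eta> \<Longrightarrow> D (act (g ^^ n) \<eta>) p < e"
proof -
  let ?U = "Metric_space.mball bdry D q e"
  have "openin (Metric_space.mtopology bdry D) ?U" "q \<in> ?U"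
    using Metric_space.openin_mball[OF metric] Metric_space.centre_in_mball_iff[OF metric] assms by auto
  then have "\<forall>\<^sub>F n in sequentially. \<forall>\<eta>\<in>bdry - ?U. D (act (g ^^ n) \<eta>) p < e"
    using assms unfolding attracting_def by blast
  then obtain n where "\<forall>\<eta>\<in>bdry - ?U. D (act (g ^^ n) \<eta>) p < e"
    unfolding eventually_sequentially by blast
  then show ?thesis
    using that Metric_space.in_mball[OF metric] by force
qed

text \<open>No boundary point is close to both fixed points, so a power of \<open>g\<close> moves it
  near \<open>p\<close> or a power of the inverse moves it near \<open>q\<close>. By uniformity the
  two powers do not depend on the point.\<close>

lemma loxodromic_dynamics:
  assumes "loxodromic x0 D g" "g \<in> G"
  obtains p q where "p \<in> boundary_fixed_points x0 g" "q \<in> boundary_fixed_points x0 g" "p \<noteq> q"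
    "\<And>e. 0 < e \<Longrightarrow> \<exists>g1\<in>G. \<exists>g2\<in>G. \<forall>\<eta>\<in>bdry. D (act g1 \<eta>) p < e \<or> D (act g2 \<eta>) q < e"
proof -
  from assms obtain p q where pq: "p \<in> boundary_fixed_points x0 g" "q \<in> boundary_fixed_points x0 g" "p \<noteq> q"
    "attracting x0 D g p q" "attracting x0 D (iv g) q p"
    unfolding loxodromic_def by blast
  then have bd: "p \<in> bdry" "q \<in> bdry" by (auto simp: boundary_fixed_points_def)
  then have "0 < D p q" using pq(3) D_eq_0_iff[of p q] D_nonneg[of p q] by linarith
  have "\<exists>g1\<in>G. \<exists>g2\<in>G. \<forall>\<eta>\<in>bdry. D (act g1 \<eta>) p < e \<or> D (act g2 \<eta>) q < e" if "0 < e" for e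
  proof -
    define e' where "e' = min e (D p q / 2)"
    have "0 < e'" using \<open>0 < D p q\<close> \<open>0 < e\<close> by (simp add: e'_def)
    obtain n where n: "\<And>\<eta>. \<eta> \<in> bdry \<Longrightarrow> e' \<le> D q \<eta> \<Longrightarrow> D (act (g ^^ n) \<eta>) p < e'"
      using attractingD[OF pq(4) bd(2) \<open>0 < e'\<close>] by metis
    obtain m where m: "\<And>\<eta>. \<eta> \<in> bdry \<Longrightarrow> e' \<le> D p \<eta> \<Longrightarrow> D (act (iv g ^^ m) \<eta>) q < e'"
      using attractingD[OF pq(5) bd(1) \<open>0 < e'\<close>] by metis
    have "D (act (g ^^ n) \<eta>) p < e \<or> D (act (iv g ^^ m) \<eta>) q < e" if \<eta>: "\<eta> \<in> bdry" for \<eta>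
    proof -
      have "D p q \<le> D p \<eta> + D q \<eta>"
        using D_triangle[OF bd(1) \<eta> bd(2)] D_commute[of q \<eta>] by simp
      then have "e' \<le> D q \<eta> \<or> e' \<le> D p \<eta>"
        unfolding e'_def by linarith
      then show ?thesis using n[OF \<eta>] m[OF \<eta>] unfolding e'_def by fastforce
    qed
    moreover have "g ^^ n \<in> G" "iv g ^^ m \<in> G"
      using assms(2) by (auto intro: pow_G inv_G)
    ultimately show ?thesis by blast
  qed
  then show ?thesis using that pq by blast
qed

text \<open>One element carries \<open>\<eta>\<close> near a fixed point of \<open>g\<close>,
  another near a fixed point of \<open>h\<close>, and these fixed points differ. By uniformity four
  elements serve all \<open>\<eta>\<close>. The pair \<open>p\<close>, \<open>q\<close> is kept for
  \<open>turning\<close>.\<close>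

lemma general_type_spread:
  assumes "general_type x0 D G"
  obtains J c p q where "finite J" "J \<subseteq> G" "0 < c" "p \<in> bdry" "q \<in> bdry" "p \<noteq> q"
    "\<And>\<eta>. \<eta> \<in> bdry \<Longrightarrow> \<exists>j\<in>J. \<exists>j'\<in>J. c \<le> D (act j \<eta>) (act j' \<eta>)"
proof -
  from assms obtain g h where gh: "g \<in> G" "h \<in> G" "loxodromic x0 D g" "loxodromic x0 D h"
    and disj: "boundary_fixed_points x0 g \<inter> boundary_fixed_points x0 h = {}"
    unfolding general_type_def by blast
  obtain p q where pq: "p \<in> boundary_fixed_points x0 g" "q \<in> boundary_fixed_points x0 g" "p \<noteq> q"
    and dyn: "\<And>e. 0 < e \<Longrightarrow> \<exists>g1\<in>G. \<exists>g2\<in>G. \<forall>\<eta>\<in>bdry. D (act g1 \<eta>) p < e \<or> D (act g2 \<eta>) q < e"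
    by (rule loxodromic_dynamics[OF gh(3,1)]) blast
  obtain p' q' where pq': "p' \<in> boundary_fixed_points x0 h" "q' \<in> boundary_fixed_points x0 h" "p' \<noteq> q'"
    and dyn': "\<And>e. 0 < e \<Longrightarrow> \<exists>g1\<in>G. \<exists>g2\<in>G. \<forall>\<eta>\<in>bdry. D (act g1 \<eta>) p' < e \<or> D (act g2 \<eta>) q' < e"
    by (rule loxodromic_dynamics[OF gh(4,2)]) blast
  have bd: "p \<in> bdry" "q \<in> bdry" "p' \<in> bdry" "q' \<in> bdry"
    using pq pq' by (auto simp: boundary_fixed_points_def)
  have ne: "u \<noteq> v" if "u \<in> {p, q}" "v \<in> {p', q'}" for u v using that pq pq' disj by auto
  \<comment> \<open>A quarter of the smallest distance between the two fixed pairs: moving both ends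
    by less than \<open>e\<close> leaves at least \<open>2 * e\<close>.\<close>
  define e where "e = Min ((\<lambda>(u, v). D u v) ` ({p, q} \<times> {p', q'})) / 4"
  have le: "4 * e \<le> D u v" if "u \<in> {p, q}" "v \<in> {p', q'}" for u v
    unfolding e_def using that by (auto intro!: Min_le)
  have pos: "0 < D u v" if "u \<in> {p, q}" "v \<in> {p', q'}" for u v
    using that ne[OF that] bd D_eq_0_iff[of u v] D_nonneg[of u v] by auto
  have "0 < e" unfolding e_def using pos by auto
  obtain g1 g2 where g: "g1 \<in> G" "g2 \<in> G" "\<And>\<eta>. \<eta> \<in> bdry \<Longrightarrow> D (act g1 \<eta>) p < e \<or> D (act g2 \<eta>) q < e"
    using dyn[OF \<open>0 < e\<close>] by blast
  obtain h1 h2 where h: "h1 \<in> G" "h2 \<in> G" "\<And>\<eta>. \<eta> \<in> bdry \<Longrightarrow> D (act h1 \<eta>) p' < e \<or> D (act h2 \<eta>) q' < e"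
    using dyn'[OF \<open>0 < e\<close>] by blast
  have far: "2 * e \<le> D a a'"
    if "a \<in> bdry" "a' \<in> bdry" "u \<in> {p, q}" "v \<in> {p', q'}" "D a u < e" "D a' v < e" for a a' u v
  proof -
    have "u \<in> bdry" "v \<in> bdry" using that bd by auto
    then have "D u v \<le> D u a + D a a' + D a' v"
      using D_triangle[of u a v] D_triangle[of a a' v] that by fastforce
    then show ?thesis using le[OF that(3,4)] that(5,6) D_commute[of u a] by linarith
  qed
  show ?thesis
  proof (rule that[of "{g1, g2, h1, h2}" "2 * e" p q])
    fix \<eta> assume \<eta>: "\<eta> \<in> bdry"
    obtain j u where j: "j \<in> {g1, g2}" "u \<in> {p, q}" "D (act j \<eta>) u < e" using g(3)[OF \<eta>] by auto
    obtain j' v where j': "j' \<in> {h1, h2}" "v \<in> {p', q'}" "D (act j' \<eta>) v < e" using h(3)[OF \<eta>] by auto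
    have "act j \<eta> \<in> bdry" "act j' \<eta> \<in> bdry" using j j' g h \<eta> act_boundary by auto
    then have "2 * e \<le> D (act j \<eta>) (act j' \<eta>)" using far j j' by blast
    then show "\<exists>j\<in>{g1, g2, h1, h2}. \<exists>j'\<in>{g1, g2, h1, h2}. 2 * e \<le> D (act j \<eta>) (act j' \<eta>)"
      using j(1) j'(1) by blast
  qed (use g h bd pq \<open>0 < e\<close> in auto)
qed

text \<open>If \<open>x\<close> had a large product with \<open>j (g x0)\<close> for all
  \<open>j\<close>, these points would have large products with each other; with a boundary point
  \<open>\<eta>\<close> shadowing \<open>g x0\<close>, all \<open>act j \<eta>\<close> would be
  close together, against \<open>general_type_spread\<close>.\<close>

lemma turning:
  assumes "general_type x0 D G"
  shows "\<exists>J K. finite J \<and> J \<subseteq> G \<and> J \<noteq> {} \<and> 0 \<le> K \<and> (\<forall>j\<in>J. nrm j \<le> K) \<and>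
    (\<forall>x. \<forall>g\<in>G. \<exists>j\<in>J. gp x0 x (j (g x0)) \<le> K) \<and>
    (\<forall>x. \<forall>\<eta>\<in>bdry. \<exists>j\<in>J. \<not> ereal K \<le> bp x0 (act j \<eta>) (pt x))"
proof -
  obtain J c p q where J: "finite J" "J \<subseteq> G" and c: "0 < c" and pq: "p \<in> bdry" "q \<in> bdry" "p \<noteq> q"
    and spread: "\<And>\<eta>. \<eta> \<in> bdry \<Longrightarrow> \<exists>j\<in>J. \<exists>j'\<in>J. c \<le> D (act j \<eta>) (act j' \<eta>)"
    by (rule general_type_spread[OF assms]) blast
  obtain M0 where M0: "0 \<le> M0" "\<And>\<xi> \<eta>. \<xi> \<in> bdry \<Longrightarrow> \<eta> \<in> bdry \<Longrightarrow> c \<le> D \<xi> \<eta> \<Longrightarrow> \<not> ereal M0 \<le> bp x0 \<xi> \<eta>"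
    using bp_bounded_of_D_ge[OF c] by metis
  have "0 < D p q" using pq D_eq_0_iff[of p q] D_nonneg[of p q] by auto
  obtain M1 where M1: "0 \<le> M1" "\<And>\<xi> \<eta>. \<xi> \<in> bdry \<Longrightarrow> \<eta> \<in> bdry \<Longrightarrow> D p q \<le> D \<xi> \<eta> \<Longrightarrow> \<not> ereal M1 \<le> bp x0 \<xi> \<eta>"
    using bp_bounded_of_D_ge[OF \<open>0 < D p q\<close>] by metis
  have "bdd_above (nrm ` J)" using J(1) by (intro bdd_above_finite) simp
  then obtain K0' where "\<And>j. j \<in> J \<Longrightarrow> nrm j \<le> K0'"
    by (auto simp: bdd_above_def)
  then obtain K0 where K0: "0 \<le> K0" "\<And>j. j \<in> J \<Longrightarrow> nrm j \<le> K0"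
    by (metis max.cobounded1 max.coboundedI2)
  define K1 where "K1 = M1 + 2 * E"
  \<comment> \<open>Room for the spread bound \<open>M0\<close>, three uses of hyperbolicity, the
    norms of two elements of \<open>J\<close> and the shadowing error \<open>K1\<close>.\<close>
  define K where "K = M0 + 3 * E + 2 * K0 + K1"
  have "K1 \<ge> 0" "K \<ge> K0" "K \<ge> M0 + E" "K \<ge> 0"
    using M0 M1 E_nonneg K0 by (auto simp: K_def K1_def)
  \<comment> \<open>The boundary point is \<open>act g r\<close>, where \<open>r\<close> is one of
    \<open>p\<close>, \<open>q\<close> not in the direction of \<open>iv g x0\<close>. Not both lie
    there, because their product is bounded.\<close>
  have shadow: "\<exists>\<eta>\<in>bdry. ereal (nrm g - K1) \<le> bp x0 \<eta> (pt (g x0))" if g: "g \<in> G" for g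
  proof -
    let ?w = "iv g x0"
    have "\<not> ereal M1 \<le> bp x0 p q" using M1(2) pq by blast
    then have "\<not> (ereal (M1 + E) \<le> bp x0 p (pt ?w) \<and> ereal (M1 + E) \<le> bp x0 q (pt ?w))"
      using le_bp_trans[of "M1 + E" x0 p "pt ?w" q] by (auto simp: bp_commute[of _ q] pt_nonempty)
    then obtain r where r: "r \<in> bdry" "\<not> ereal (M1 + E) \<le> bp x0 r (pt ?w)"
      using pq by blast
    have "asymp_le x0 ?w r K1"
      using asymp_le_boundary[OF r] by (simp add: K1_def add.assoc)
    then have "ereal (nrm g - K1) \<le> bp ?w r (pt x0)"
      using asymp_le_sum[of x0 ?w r K1] by (simp add: nrm_inv[OF g])
    also have "\<dots> = bp x0 (act g r) (pt (g x0))"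
      using bp_act[OF g, of r "pt x0"] by (simp add: boundary_action_pt)
    finally show ?thesis using act_boundary[OF g r(1)] by blast
  qed
  have turn: "\<exists>j\<in>J. gp x0 x (j (g x0)) \<le> K" if g: "g \<in> G" for x g
  proof (rule ccontr)
    assume "\<not> (\<exists>j\<in>J. gp x0 x (j (g x0)) \<le> K)"
    then have far: "\<And>j. j \<in> J \<Longrightarrow> K \<le> gp x0 x (j (g x0))" by auto
    obtain \<eta> where \<eta>: "\<eta> \<in> bdry" "ereal (nrm g - K1) \<le> bp x0 \<eta> (pt (g x0))" using shadow[OF g] by blast
    obtain j j' where j: "j \<in> J" "j' \<in> J" "c \<le> D (act j \<eta>) (act j' \<eta>)" using spread[OF \<eta>(1)] by blast
    have bd: "act j \<eta> \<in> bdry" "act j' \<eta> \<in> bdry" using act_boundary \<eta> j J by auto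
    \<comment> \<open>A product is at most the distance to either point, so a violation forces
      \<open>g\<close> to be long.\<close>
    have "K \<le> dist x0 (j (g x0))"
      using far[OF j(1)] gp_le_dist[of x0 "j (g x0)" x] gp_commute[of x0] by (metis order_trans)
    then have "K - K0 \<le> nrm g"
      using nrm_comp_le[of j g] K0(2)[OF j(1)] j J by fastforce
    define L where "L = M0 + 2 * E"
    have near: "ereal L \<le> bp x0 (act i \<eta>) (pt (i (g x0)))" if "i \<in> J" for i
    proof -
      have "ereal (nrm g - K1 - nrm i) \<le> bp x0 (act i \<eta>) (pt (i (g x0)))"
        using le_bp_act[of i, OF _ \<eta>(2)] that J by (auto simp: boundary_action_pt)
      moreover have "L \<le> nrm g - K1 - nrm i"
        using \<open>K - K0 \<le> nrm g\<close> K0(2)[OF that] E_nonneg by (simp add: L_def K_def)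
      ultimately show ?thesis by (meson ereal_less_eq(3) order_trans)
    qed
    have "K - E \<le> gp x0 (j (g x0)) (j' (g x0))"
      using far[OF j(1)] far[OF j(2)] gp_hypD[of K x0 "j (g x0)" x "j' (g x0)"]
      by (simp add: gp_commute)
    moreover have "L \<le> K - E" using K0 \<open>0 \<le> K1\<close> E_nonneg by (simp add: L_def K_def)
    ultimately have "ereal L \<le> bp x0 (pt (j (g x0))) (pt (j' (g x0)))"
      by (simp add: le_bp_pt_iff)
    with near[OF j(1)] have "ereal (L - E) \<le> bp x0 (act j \<eta>) (pt (j' (g x0)))"
      by (rule le_bp_trans) (rule pt_nonempty)
    moreover have "ereal (L - E) \<le> bp x0 (pt (j' (g x0))) (act j' \<eta>)"
      using near[OF j(2)] E_nonneg by (subst bp_commute) (meson diff_left_mono diff_zero ereal_less_eq(3) order_trans diff_le_eq le_add_same_cancel1)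
    ultimately have "ereal (L - E - E) \<le> bp x0 (act j \<eta>) (act j' \<eta>)"
      by (rule le_bp_trans) (rule pt_nonempty)
    then show False using M0(2)[OF bd j(3)] by (simp add: L_def)
  qed
  have turn_bd: "\<exists>j\<in>J. \<not> ereal K \<le> bp x0 (act j \<eta>) (pt x)" if \<eta>: "\<eta> \<in> bdry" for x \<eta>
  proof (rule ccontr)
    assume "\<not> (\<exists>j\<in>J. \<not> ereal K \<le> bp x0 (act j \<eta>) (pt x))"
    then have far: "\<And>j. j \<in> J \<Longrightarrow> ereal K \<le> bp x0 (act j \<eta>) (pt x)" by blast
    obtain j j' where j: "j \<in> J" "j' \<in> J" "c \<le> D (act j \<eta>) (act j' \<eta>)" using spread[OF \<eta>(1)] by blast
    have bd: "act j \<eta> \<in> bdry" "act j' \<eta> \<in> bdry" using act_boundary \<eta> j J by auto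
    have "ereal K \<le> bp x0 (pt x) (act j' \<eta>)" using far[OF j(2)] by (simp add: bp_commute)
    with far[OF j(1)] have "ereal (K - E) \<le> bp x0 (act j \<eta>) (act j' \<eta>)"
      by (rule le_bp_trans) (rule pt_nonempty)
    moreover have "ereal M0 \<le> ereal (K - E)" using \<open>M0 + E \<le> K\<close> by simp
    ultimately show False using M0(2)[OF bd j(3)] by (meson order_trans)
  qed
  have "J \<noteq> {}" using spread[OF pq(1)] by blast
  have nrm_le: "nrm j \<le> K" if "j \<in> J" for j using K0(2)[OF that] \<open>K0 \<le> K\<close> by simp
  show ?thesis
    by (intro exI[of _ J] exI[of _ K] conjI ballI allI J \<open>J \<noteq> {}\<close> \<open>0 \<le> K\<close> nrm_le turn turn_bd)
qed

end

section \<open>The upper bound\<close>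

lemma summable_on_tail:
  fixes f :: "'i \<Rightarrow> real"
  assumes "f summable_on A" "0 < e" "\<And>i. i \<in> A \<Longrightarrow> 0 \<le> f i"
  obtains F where "finite F" "F \<subseteq> A" "infsum (\<lambda>i. ennreal (f i)) (A - F) \<le> ennreal e"
proof -
  have "infsum f A - e < infsum f A" using assms by simp
  then have "\<forall>\<^sub>F F in finite_subsets_at_top A. infsum f A - e < sum f F"
    using infsum_tendsto[OF assms(1)] by (rule order_tendstoD(1)[rotated])
  then obtain F where F: "finite F" "F \<subseteq> A" "\<forall>Y. finite Y \<and> F \<subseteq> Y \<and> Y \<subseteq> A \<longrightarrow> infsum f A - e < sum f Y"
    unfolding eventually_finite_subsets_at_top by (elim exE conjE)
  have "infsum (\<lambda>i. ennreal (f i)) (A - F) \<le> ennreal e"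
  proof (rule infsum_ennreal_leI)
    fix H assume H: "finite H" "H \<subseteq> A - F"
    have "sum f (F \<union> H) \<le> infsum f A"
      using F(1,2) H assms(3) by (intro finite_sum_le_infsum[OF assms(1)]) auto
    moreover have "sum f (F \<union> H) = sum f F + sum f H"
      using F(1,2) H by (intro sum.union_disjoint) (auto intro: finite_subset)
    moreover have "infsum f A - e < sum f F" using F(1,2) by (intro F(3)[rule_format]) auto
    ultimately have "sum f H \<le> e" by linarith
    then show "(\<Sum>i\<in>H. ennreal (f i)) \<le> ennreal e"
      using H assms(3) by (subst sum_ennreal) (auto intro: ennreal_leI)
  qed
  then show ?thesis by (rule that[OF F(1,2)])
qed

lemma poincare_exponent_less_imp_summable:
  assumes "1 < b" "poincare_exponent b x0 G < ereal u"
  shows "(\<lambda>g. b powr (- u * dist x0 (g x0))) summable_on G"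
proof -
  obtain s where s: "s < u" "(\<lambda>g. b powr (- s * dist x0 (g x0))) summable_on G"
    using assms(2) unfolding poincare_exponent_def Inf_less_iff by auto
  show ?thesis
  proof (rule summable_on_comparison_test[OF s(2)])
    fix g
    show "b powr (- u * dist x0 (g x0)) \<le> b powr (- s * dist x0 (g x0))"
      using assms(1) s(1) by (intro powr_mono) (auto simp: mult_right_mono)
  qed auto
qed

context visual_group
begin

abbreviation "rad \<equiv> radial_limit_set_upto x0 G"

text \<open>One suitable orbit point at each depth \<open>M\<close> captures radiality;
  \<open>radI\<close> is the converse.\<close>

lemma radD:
  assumes "\<eta> \<in> rad \<sigma>"
  shows "\<eta> \<in> bdry" "\<exists>h\<in>G. ereal M \<le> bp x0 \<eta> (pt (h x0)) \<and> bp (h x0) \<eta> (pt x0) \<le> ereal \<sigma>"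
proof -
  from assms obtain g where g: "\<eta> \<in> bdry" "\<And>n. g n \<in> G" "converges_to_boundary x0 (\<lambda>n. g n x0) \<eta>"
    "\<And>n. point_boundary_product (g n x0) x0 \<eta> \<le> ereal \<sigma>"
    by (auto simp: radial_limit_set_upto_def)
  show "\<eta> \<in> bdry" by (rule g(1))
  have "\<forall>\<^sub>F n in sequentially. ereal M < bp x0 \<eta> (pt (g n x0))"
    using g(3) by (simp add: converges_to_boundary_def tendsto_PInfty pbp_eq_bp)
  then obtain n where "ereal M < bp x0 \<eta> (pt (g n x0))"
    using eventually_happens trivial_limit_sequentially by blast
  then show "\<exists>h\<in>G. ereal M \<le> bp x0 \<eta> (pt (h x0)) \<and> bp (h x0) \<eta> (pt x0) \<le> ereal \<sigma>"
    using g(2)[of n] g(4)[of n] by (auto simp: pbp_eq_bp intro: less_imp_le)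
qed

lemma radI:
  assumes "\<eta> \<in> bdry"
    and "\<And>M. \<exists>h\<in>G. ereal M \<le> bp x0 \<eta> (pt (h x0)) \<and> bp (h x0) \<eta> (pt x0) \<le> ereal \<sigma>"
  shows "\<eta> \<in> rad \<sigma>"
proof -
  have "\<forall>n::nat. \<exists>h. h \<in> G \<and> ereal n \<le> bp x0 \<eta> (pt (h x0)) \<and> bp (h x0) \<eta> (pt x0) \<le> ereal \<sigma>"
    using assms(2) by blast
  then obtain g where g: "\<And>n::nat. g n \<in> G" "\<And>n. ereal n \<le> bp x0 \<eta> (pt (g n x0))"
    "\<And>n. bp (g n x0) \<eta> (pt x0) \<le> ereal \<sigma>"
    by metis
  have "((\<lambda>n. bp x0 \<eta> (pt (g n x0))) \<longlongrightarrow> \<infinity>) sequentially"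
    unfolding tendsto_PInfty
  proof
    fix r :: real
    obtain k :: nat where "r < k" using reals_Archimedean2 by blast
    have "ereal r < bp x0 \<eta> (pt (g n x0))" if "k \<le> n" for n
    proof -
      have "ereal r < ereal n" using \<open>r < k\<close> that by simp
      then show ?thesis using g(2)[of n] by (rule less_le_trans)
    qed
    then show "\<forall>\<^sub>F n in sequentially. ereal r < bp x0 \<eta> (pt (g n x0))"
      unfolding eventually_sequentially by blast
  qed
  then show ?thesis
    using assms(1) g by (auto simp: radial_limit_set_upto_def converges_to_boundary_def pbp_eq_bp)
qed

lemma rad_boundary: "rad \<sigma> \<subseteq> bdry"
  using radD(1) by blast

text \<open>Seen from a far orbit point \<open>h x0\<close>, the points \<open>x0\<close> and
  \<open>iv g x0\<close> have a huge product, so exchanging them in the radiality bound costs only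
  \<open>E\<close>; the extra 1 provides strictness.\<close>

lemma rad_act:
  assumes g: "g \<in> G" and \<eta>: "\<eta> \<in> rad \<sigma>"
  shows "act g \<eta> \<in> rad (\<sigma> + E + 1)"
proof (rule radI)
  have bd: "\<eta> \<in> bdry" using \<eta> rad_boundary by auto
  then show "act g \<eta> \<in> bdry" by (rule act_boundary[OF g])
  fix M
  \<comment> \<open>The first bound makes \<open>g \<circ> h\<close> deep enough, the second puts
    \<open>h x0\<close> far beyond \<open>iv g x0\<close>.\<close>
  define M' where "M' = max (M + nrm g) (\<sigma> + E + 1 + nrm g)"
  obtain h where h: "h \<in> G" "ereal M' \<le> bp x0 \<eta> (pt (h x0))" "bp (h x0) \<eta> (pt x0) \<le> ereal \<sigma>"
    using radD(2)[OF \<eta>] by blast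
  let ?w = "iv g x0" and ?y = "h x0"
  have "ereal M \<le> bp x0 (act g \<eta>) (pt ((g \<circ> h) x0))"
  proof -
    have "ereal (M' - nrm g) \<le> bp x0 (act g \<eta>) (pt ((g \<circ> h) x0))"
      using le_bp_act[OF g h(2)] by (simp add: boundary_action_pt)
    moreover have "ereal M \<le> ereal (M' - nrm g)" by (simp add: M'_def)
    ultimately show ?thesis by (rule order_trans[rotated])
  qed
  moreover have "bp ((g \<circ> h) x0) (act g \<eta>) (pt x0) \<le> ereal (\<sigma> + E + 1)"
  proof (rule ccontr)
    assume "\<not> ?thesis"
    moreover have "bp ((g \<circ> h) x0) (act g \<eta>) (pt x0) = bp ?y \<eta> (pt ?w)"
      using bp_isometry[OF carrier_G[OF g], of "g ?y" \<eta> "pt ?w"] isometry_groupD(3,4)[OF carrier_G[OF g]]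
      by (simp add: boundary_action_pt)
    ultimately have 1: "ereal (\<sigma> + E + 1) \<le> bp ?y \<eta> (pt ?w)" by simp
    have "M' \<le> nrm h" using le_bp_ptD[OF h(2) boundary_nonempty[OF bd]] .
    then have "\<sigma> + E + 1 \<le> gp ?y ?w x0"
      using gp_lipschitz[of ?y x0 x0 ?w] gp_same[of ?y x0] nrm_inv[OF g]
      by (simp add: M'_def dist_commute)
    then have "ereal (\<sigma> + E + 1) \<le> bp ?y (pt ?w) (pt x0)" by (simp add: le_bp_pt_iff)
    with 1 have "ereal (\<sigma> + E + 1 - E) \<le> bp ?y \<eta> (pt x0)"
      by (rule le_bp_trans) (rule pt_nonempty)
    then have "ereal (\<sigma> + E + 1 - E) \<le> ereal \<sigma>" using h(3) by (rule order_trans)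
    then show False by simp
  qed
  ultimately show "\<exists>k\<in>G. ereal M \<le> bp x0 (act g \<eta>) (pt (k x0)) \<and>
      bp (k x0) (act g \<eta>) (pt x0) \<le> ereal (\<sigma> + E + 1)"
    using comp_G[OF g h(1)] by blast
qed

text \<open>Near \<open>\<xi>\<close> the map \<open>g\<close> contracts by \<open>b powr (2 * t - nrm g)\<close>, which is weak for large \<open>t\<close>; the gain
  \<open>- 2 * t\<close> in the exponent of the distance compensates for it.\<close>

lemma pullback_approximation:
  assumes g: "g \<in> G" and \<xi>: "\<xi> \<in> bdry" and a: "a \<in> bdry"
    and t: "bp x0 \<xi> (pt (iv g x0)) = ereal t"
    and large: "kv + 2 + 2 * E \<le> c * nrm g"
    and close: "D (act g \<xi>) (act g a) \<le> b powr (- (1 + c) * nrm g)"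
  shows "D \<xi> a \<le> b powr (2 * kv + 2 + 3 * E - c * nrm g - 2 * t)"
    "asymp_le x0 (iv g x0) a (t + 2 + 3 * E + kv)"
proof -
  let ?w = "iv g x0"
  define N where "N = nrm g"
  have dN: "dist x0 ?w = N" "dist ?w x0 = N" using nrm_inv[OF g] by (auto simp: N_def dist_commute)
  have "0 \<le> t" using bp_nonneg[of x0 \<xi> "pt ?w"] t by simp
  have ne: "\<xi> \<noteq> {}" "a \<noteq> {}" using boundary_nonempty \<xi> a by auto
  \<comment> \<open>The closeness of \<open>act g \<xi>\<close> and \<open>act g a\<close>, read as
    a product seen from \<open>iv g x0\<close>.\<close>
  define M where "M = (1 + c) * N - kv"
  have "ereal M \<le> bp x0 (act g \<xi>) (act g a)"
    using close by (intro bp_of_D_le act_boundary g \<xi> a) (simp add: M_def N_def algebra_simps)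
  then have \<xi>a: "ereal M \<le> bp ?w \<xi> a" by (simp add: bp_act[OF g])
  have MN: "N + 2 + 2 * E \<le> M" using large by (simp add: M_def N_def algebra_simps)
  \<comment> \<open>The direction of \<xi> splits the distance \<open>N\<close> between
    \<open>x0\<close> and \<open>iv g x0\<close> into \<open>t\<close> and, up to constants,
    \<open>N - t\<close>.\<close>
  have "\<not> ereal (t + 1) \<le> bp x0 \<xi> (pt ?w)" using t by simp
  then have "asymp_le x0 ?w \<xi> (t + 1 + E)" by (rule asymp_le_boundary[OF \<xi>])
  then have \<xi>1: "ereal (N - (t + 1 + E)) \<le> bp ?w \<xi> (pt x0)"
    using asymp_le_sum[of x0 ?w \<xi> "t + 1 + E"] dN by simp
  have \<xi>2: "v \<le> N - t" if "ereal v \<le> bp ?w \<xi> (pt x0)" for v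
    using le_bp_sumD[OF that ne(1), of t] t dN by simp
  have \<xi>3: "asymp_le ?w x0 \<xi> (N - t + 1 + E)"
    using asymp_le_boundary[OF \<xi>, of "N - t + 1" ?w x0] \<xi>2[of "N - t + 1"] by fastforce
  \<comment> \<open>\<open>M\<close> exceeds \<open>N - t\<close>, so \<open>a\<close> inherits the
    position of \<xi> up to a further \<open>E\<close>.\<close>
  have "ereal (N - t - 1 - E) \<le> ereal M" using MN \<open>0 \<le> t\<close> E_nonneg by simp
  then have "ereal (N - t - 1 - E) \<le> bp ?w a \<xi>" using \<xi>a bp_commute by (metis order_trans)
  moreover have "ereal (N - t - 1 - E) \<le> bp ?w \<xi> (pt x0)" using \<xi>1 by (simp add: algebra_simps)
  ultimately have a1: "ereal (N - t - 1 - E - E) \<le> bp ?w a (pt x0)"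
    using ne(1) by (rule le_bp_trans)
  have "\<not> ereal (t + 2 + 2 * E + kv) \<le> bp x0 a (pt ?w)"
    using le_bp_sumD[OF a1 ne(2), of "t + 2 + 2 * E + kv"] dN kv_nonneg by auto
  then show "asymp_le x0 ?w a (t + 2 + 3 * E + kv)"
    using asymp_le_boundary[OF a, of "t + 2 + 2 * E + kv" x0 ?w] by (simp add: algebra_simps)
  have "\<not> ereal (N - t + 1 + E) \<le> bp ?w a (pt x0)"
  proof
    assume *: "ereal (N - t + 1 + E) \<le> bp ?w a (pt x0)"
    have "ereal (N - t + 1 + E) \<le> ereal M" using MN \<open>0 \<le> t\<close> E_nonneg by simp
    then have "ereal (N - t + 1 + E) \<le> bp ?w \<xi> a" using \<xi>a by (rule order_trans)
    then have "ereal (N - t + 1 + E - E) \<le> bp ?w \<xi> (pt x0)"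
      using * ne(2) by (rule le_bp_trans)
    then show False using \<xi>2[of "N - t + 1 + E - E"] by simp
  qed
  then have a3: "asymp_le ?w x0 a (N - t + 1 + E + E)" by (rule asymp_le_boundary[OF a])
  \<comment> \<open>Changing the base back to \<open>x0\<close> turns \<open>M\<close> into about
    \<open>M + N - 2 * (N - t)\<close>, whence the gain \<open>2 * t\<close>.\<close>
  have "ereal (M + dist ?w x0 - (N - t + 1 + E) - (N - t + 1 + E + E)) \<le> bp x0 \<xi> a"
    by (rule le_bp_change_base[OF \<xi>a \<xi>3 a3])
  then have "D \<xi> a \<le> b powr (kv - (M + dist ?w x0 - (N - t + 1 + E) - (N - t + 1 + E + E)))"
    by (rule D_le_of_bp[OF \<xi> a])
  also have "kv - (M + dist ?w x0 - (N - t + 1 + E) - (N - t + 1 + E + E))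
      = 2 * kv + 2 + 3 * E - c * nrm g - 2 * t"
    using dN by (simp add: M_def N_def[symmetric] algebra_simps)
  finally show "D \<xi> a \<le> b powr (2 * kv + 2 + 3 * E - c * nrm g - 2 * t)" .
qed

lemma D_act_contract:
  assumes "g \<in> G" "a \<in> bdry" "a' \<in> bdry"
    and "asymp_le x0 (iv g x0) a u" "asymp_le x0 (iv g x0) a' u"
  shows "D (act g a) (act g a') \<le> b powr (2 * kv - nrm g + 2 * u) * D a a'"
proof -
  have "ereal (M + (nrm g - 2 * u)) \<le> bp x0 (act g a) (act g a')" if "ereal M \<le> bp x0 a a'" for M
    using le_bp_change_base[OF that assms(4,5)] assms(1) by (simp add: bp_act nrm_inv algebra_simps)
  then show ?thesis
    using D_compare[of a a' "act g a" "act g a'" "nrm g - 2 * u"] assms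
    by (simp add: act_boundary algebra_simps)
qed

text \<open>The set is pulled back by \<open>g\<close>, bounded by the local content at \<xi>, and
  pushed forward. The overlap \<open>t\<close> of \<xi> with \<open>iv g x0\<close> is unknown, but
  the radius contributes \<open>- 2 * t * p\<close> to the exponent and the contraction
  \<open>2 * t * s\<close>, so \<open>s \<le> p\<close> lets it drop out.\<close>

lemma content_approximation_ball:
  assumes \<xi>: "\<xi> \<in> bdry" and s: "0 < s" "s \<le> p" and c: "0 < c"
    and r0: "0 < r0" and A: "0 < A"
    and local: "\<forall>r. 0 < r \<and> r < r0 \<longrightarrow> local_content x0 D G \<xi> (\<sigma> + E + 1) s r \<le> ennreal (A * r powr p)"
  shows "\<exists>A'>0. \<exists>N. \<forall>g\<in>G. N \<le> nrm g \<longrightarrow>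
      hausdorff_content bdry D s {\<eta> \<in> rad \<sigma>. D (act g \<xi>) \<eta> \<le> b powr (- (1 + c) * nrm g)}
        < ennreal (A' * b powr (- (s + p * c) * nrm g))"
proof -
  define k where "k = 2 * kv + 2 + 3 * E"
  define k' where "k' = 2 * kv + 2 * (2 + 3 * E + kv)"
  define A' where "A' = 3 * A * b powr (s * k' + p * k)"
  \<comment> \<open>The first entry is what \<open>pullback_approximation\<close> requires; the
    second brings the radius \<open>r\<close> below \<open>r0\<close> whatever \<open>t\<close>
    is.\<close>
  define N where "N = max ((kv + 2 + 2 * E) / c) ((k - log b r0 + 1) / c)"
  have "0 < A'" using A b_gt_1 by (simp add: A'_def)
  moreover have "hausdorff_content bdry D s {\<eta> \<in> rad \<sigma>. D (act g \<xi>) \<eta> \<le> b powr (- (1 + c) * nrm g)}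
        < ennreal (A' * b powr (- (s + p * c) * nrm g))" (is "hausdorff_content bdry D s ?S < _")
    if g: "g \<in> G" and N: "N \<le> nrm g" for g
  proof -
    let ?w = "iv g x0"
    have g': "iv g \<in> G" by (rule inv_G[OF g])
    have large: "kv + 2 + 2 * E \<le> c * nrm g" "k - log b r0 + 1 \<le> c * nrm g"
      using N c by (simp_all add: N_def field_simps)
    have "bp x0 \<xi> (pt ?w) \<noteq> \<infinity>"
      using le_bp_ptD[of "dist x0 ?w + 1" x0 \<xi> ?w] boundary_nonempty[OF \<xi>] by auto
    then obtain t where t: "bp x0 \<xi> (pt ?w) = ereal t" "0 \<le> t"
      using bp_nonneg[of x0 \<xi> "pt ?w"] by (cases "bp x0 \<xi> (pt ?w)") auto
    define r where "r = b powr (k - c * nrm g - 2 * t)"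
    have r: "0 < r" "r < r0"
    proof -
      show "0 < r" using b_gt_1 by (simp add: r_def)
      have "r < b powr (log b r0)"
        unfolding r_def using b_gt_1 large(2) t(2) by (intro powr_less_mono) auto
      then show "r < r0" using b_gt_1 r0 by simp
    qed
    define F where "F = act (iv g) ` ?S"
    have S: "?S = act g ` F"
      unfolding F_def image_image using act_inv[OF g] by simp
    have F: "a \<in> rad (\<sigma> + E + 1)" "a \<in> bdry" "D \<xi> a \<le> r" "asymp_le x0 ?w a (t + 2 + 3 * E + kv)"
      if aF: "a \<in> F" for a
    proof -
      obtain \<eta> where \<eta>: "\<eta> \<in> rad \<sigma>" "D (act g \<xi>) \<eta> \<le> b powr (- (1 + c) * nrm g)" "a = act (iv g) \<eta>"
        using aF unfolding F_def by blast
      show "a \<in> rad (\<sigma> + E + 1)" using rad_act[OF g' \<eta>(1)] \<eta>(3) by simp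
      then show a: "a \<in> bdry" using rad_boundary by blast
      have "act g a = \<eta>" using act_inv[OF g] \<eta>(3) by simp
      then have "D (act g \<xi>) (act g a) \<le> b powr (- (1 + c) * nrm g)" using \<eta>(2) by simp
      from pullback_approximation[OF g \<xi> a t(1) large(1) this]
      show "D \<xi> a \<le> r" "asymp_le x0 ?w a (t + 2 + 3 * E + kv)"
        by (simp_all add: r_def k_def)
    qed
    have "F \<subseteq> Metric_space.mcball bdry D \<xi> r \<inter> rad (\<sigma> + E + 1)"
      using F \<xi> by (auto simp: Metric_space.in_mcball[OF metric])
    then have "hausdorff_content bdry D s F \<le> local_content x0 D G \<xi> (\<sigma> + E + 1) s r"
      unfolding local_content_def by (rule hausdorff_content_mono)
    also have "\<dots> \<le> ennreal (A * r powr p)" using local r by blast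
    also have "\<dots> < ennreal (2 * A * r powr p)"
      using A r(1) by (simp add: ennreal_less_iff)
    finally have cF: "hausdorff_content bdry D s F < ennreal (2 * A * r powr p)" .
    define L where "L = b powr (2 * kv - nrm g + 2 * (t + 2 + 3 * E + kv))"
    have "0 < L" using b_gt_1 by (simp add: L_def)
    have "hausdorff_content bdry D s ?S \<le> ennreal (L powr s) * ennreal (2 * A * r powr p)"
      unfolding S
    proof (rule hausdorff_content_Lipschitz_image[OF s(1) \<open>0 < L\<close> _ _ D_nonneg cF])
      show "act g ` F \<subseteq> bdry" using F(2) act_boundary[OF g] by auto
      show "D (act g x) (act g y) \<le> L * D x y" if "x \<in> F" "y \<in> F" for x y
        unfolding L_def
        by (rule D_act_contract[OF g F(2)[OF that(1)] F(2)[OF that(2)] F(4)[OF that(1)] F(4)[OF that(2)]])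
    qed
    also have "\<dots> = ennreal (2 * A * (L powr s * r powr p))"
      using A by (simp add: ennreal_mult[symmetric] mult.commute mult.left_commute)
    also have "\<dots> \<le> ennreal (2 * A * (b powr (s * k' + p * k) * b powr (- (s + p * c) * nrm g)))"
    proof (intro ennreal_leI mult_left_mono)
      have "L powr s * r powr p = b powr (s * (2 * kv - nrm g + 2 * (t + 2 + 3 * E + kv)) + p * (k - c * nrm g - 2 * t))"
        unfolding L_def r_def powr_powr powr_add[symmetric] by (simp only: mult.commute)
      also have "\<dots> \<le> b powr (s * k' + p * k + - (s + p * c) * nrm g)"
      proof (rule powr_mono)
        have "s * (2 * t) \<le> p * (2 * t)" using s t by (intro mult_right_mono) auto
        then show "s * (2 * kv - nrm g + 2 * (t + 2 + 3 * E + kv)) + p * (k - c * nrm g - 2 * t)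
            \<le> s * k' + p * k + - (s + p * c) * nrm g"
          by (simp add: k'_def algebra_simps)
      qed (use b_gt_1 in simp)
      finally show "L powr s * r powr p \<le> b powr (s * k' + p * k) * b powr (- (s + p * c) * nrm g)"
        by (simp add: powr_add)
    qed (use A in simp)
    also have "\<dots> < ennreal (A' * b powr (- (s + p * c) * nrm g))"
      using A b_gt_1 by (simp add: A'_def ennreal_less_iff)
    finally show ?thesis .
  qed
  ultimately show ?thesis by blast
qed

lemma approx_exponent_frequently:
  assumes "ereal u < approx_exponent b x0 D G \<xi> \<eta>"
  shows "\<exists>g\<in>G. N < nrm g \<and> D (act g \<xi>) \<eta> \<le> b powr (- u * nrm g)"
proof (rule ccontr)
  assume *: "\<not> ?thesis"
  let ?F = "inf (filtercomap (\<lambda>g. nrm g) at_top) (principal G)"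
  have "\<forall>\<^sub>F g in ?F. - elog b (ennreal (D (act g \<xi>) \<eta>)) / ereal (nrm g) \<le> ereal u"
    unfolding eventually_inf_principal
  proof (rule eventually_mono)
    show "\<forall>\<^sub>F g in filtercomap (\<lambda>g. nrm g) at_top. max N 1 < nrm g"
      by (rule eventually_filtercomapI) (rule eventually_gt_at_top)
    fix g assume N: "max N 1 < nrm g"
    show "g \<in> G \<longrightarrow> - elog b (ennreal (D (act g \<xi>) \<eta>)) / ereal (nrm g) \<le> ereal u"
    proof
      assume "g \<in> G"
      then have D: "b powr (- u * nrm g) < D (act g \<xi>) \<eta>" using * N by auto
      then have pos: "0 < D (act g \<xi>) \<eta>" by (smt (verit) powr_ge_zero)
      have "- u * nrm g < log b (D (act g \<xi>) \<eta>)"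
        using D pos b_gt_1 by (simp add: less_log_iff)
      moreover have n0: "0 < nrm g" using N by linarith
      ultimately have le: "- log b (D (act g \<xi>) \<eta>) / nrm g \<le> u"
        unfolding pos_divide_le_eq[OF n0] by simp
      have "elog b (ennreal (D (act g \<xi>) \<eta>)) = ereal (log b (D (act g \<xi>) \<eta>))"
        using pos by (simp add: elog_def)
      moreover have "ereal x / ereal (nrm g) = ereal (x / nrm g)" for x
        using n0 by simp
      ultimately show "- elog b (ennreal (D (act g \<xi>) \<eta>)) / ereal (nrm g) \<le> ereal u"
        using le by (metis ereal_less_eq(3) uminus_ereal.simps(1))
    qed
  qed
  then have "approx_exponent b x0 D G \<xi> \<eta> \<le> ereal u"
    unfolding approx_exponent_def by (rule Limsup_bounded)
  then show False using assms by simp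
qed

text \<open>Borel-Cantelli over the group: every well approximable point lies in sets of
  \<open>content_approximation_ball\<close> with arbitrarily large \<open>nrm g\<close>, and the
  content bounds are summable.\<close>

lemma content_well_approximable_zero:
  assumes \<xi>: "\<xi> \<in> bdry" and s: "0 < s" "s \<le> p" and c: "0 < c"
    and \<delta>: "poincare_exponent b x0 G < ereal (s + p * c)"
    and local: "\<And>\<sigma>. 0 < \<sigma> \<Longrightarrow> \<exists>A>0. \<exists>r0>0. \<forall>r. 0 < r \<and> r < r0 \<longrightarrow>
      local_content x0 D G \<xi> \<sigma> s r \<le> ennreal (A * r powr p)"
  shows "hausdorff_content bdry D s (well_approximable_set b x0 D G c \<xi>) = 0"
proof -
  let ?W = "well_approximable_set b x0 D G c \<xi>"
  obtain u where u: "poincare_exponent b x0 G < ereal u" "u < s + p * c"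
    using ereal_dense2[OF \<delta>] by auto
  \<comment> \<open>An exponent of at least \<open>1 + c\<close> yields approximations only to
    orders \<open>1 + c'\<close> with \<open>c' < c\<close>; \<open>s + p * c'\<close> must still
    exceed the Poincare exponent.\<close>
  define c' where "c' = max (c / 2) ((u - s) / p)"
  have "0 < p" using s by simp
  have c': "0 < c'" "c' < c" "u \<le> s + p * c'"
  proof -
    show "0 < c'" using c by (simp add: c'_def less_max_iff_disj)
    have "(u - s) / p < c" using u(2) \<open>0 < p\<close> by (simp add: divide_less_eq algebra_simps)
    then show "c' < c" using c by (simp add: c'_def)
    have "(u - s) / p \<le> c'" by (simp add: c'_def)
    then show "u \<le> s + p * c'" using \<open>0 < p\<close> by (simp add: divide_le_eq algebra_simps)
  qed
  have "ereal u \<le> ereal (s + p * c')" using c' by simp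
  with u(1) have "poincare_exponent b x0 G < ereal (s + p * c')" by (rule less_le_trans)
  then have summ: "(\<lambda>g. b powr (- (s + p * c') * nrm g)) summable_on G"
    by (rule poincare_exponent_less_imp_summable[OF b_gt_1])
  have zero: "hausdorff_content bdry D s (?W \<inter> rad \<sigma>) = 0" if \<sigma>: "0 < \<sigma>" for \<sigma>
  proof -
    have "0 < \<sigma> + E + 1" using \<sigma> E_nonneg by simp
    from local[OF this] obtain A r0 where Ar: "0 < A" "0 < r0"
      "\<forall>r. 0 < r \<and> r < r0 \<longrightarrow> local_content x0 D G \<xi> (\<sigma> + E + 1) s r \<le> ennreal (A * r powr p)"
      by blast
    obtain A' N where A': "0 < A'" and
      small: "\<forall>g\<in>G. N \<le> nrm g \<longrightarrow>
      hausdorff_content bdry D s {\<eta> \<in> rad \<sigma>. D (act g \<xi>) \<eta> \<le> b powr (- (1 + c') * nrm g)}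
        < ennreal (A' * b powr (- (s + p * c') * nrm g))"
      using content_approximation_ball[OF \<xi> s c'(1) Ar(2,1,3)] by (elim exE conjE)
    have "hausdorff_content bdry D s (?W \<inter> rad \<sigma>) \<le> 0 + ennreal e" if e: "0 < e" for e
    proof -
      have summ': "(\<lambda>g. A' * b powr (- (s + p * c') * nrm g)) summable_on G"
        by (rule summable_on_cmult_right[OF summ])
      obtain F where F: "finite F" "F \<subseteq> G"
        "infsum (\<lambda>g. ennreal (A' * b powr (- (s + p * c') * nrm g))) (G - F) \<le> ennreal e"
        by (rule summable_on_tail[OF summ' e]) (use A' in auto)
      have "bdd_above (nrm ` F)" using F(1) by (intro bdd_above_finite) simp
      then obtain N' where N': "\<And>g. g \<in> F \<Longrightarrow> nrm g \<le> N'" by (auto simp: bdd_above_def)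
      \<comment> \<open>Norm above \<open>N'\<close> keeps \<open>g\<close> outside
        \<open>F\<close>, norm above \<open>N\<close> makes the content bound available.\<close>
      define H where "H = {g \<in> G. max N N' < nrm g}"
      have "hausdorff_content bdry D s (?W \<inter> rad \<sigma>) \<le> infsum (\<lambda>g. ennreal (A' * b powr (- (s + p * c') * nrm g))) H"
      proof (rule hausdorff_content_subadditive)
        show "countable H" by (rule countable_subset[OF _ countable_G]) (auto simp: H_def)
        show "hausdorff_content bdry D s {\<eta> \<in> rad \<sigma>. D (act g \<xi>) \<eta> \<le> b powr (- (1 + c') * nrm g)}
            < ennreal (A' * b powr (- (s + p * c') * nrm g))" if "g \<in> H" for g
          using that by (intro small[rule_format]) (auto simp: H_def)
        show "?W \<inter> rad \<sigma> \<subseteq> (\<Union>g\<in>H. {\<eta> \<in> rad \<sigma>. D (act g \<xi>) \<eta> \<le> b powr (- (1 + c') * nrm g)})"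
        proof
          fix \<eta> assume \<eta>: "\<eta> \<in> ?W \<inter> rad \<sigma>"
          then have "ereal (1 + c) \<le> approx_exponent b x0 D G \<xi> \<eta>"
            by (simp add: well_approximable_set_def)
          moreover have "ereal (1 + c') < ereal (1 + c)" using c' by simp
          ultimately have "ereal (1 + c') < approx_exponent b x0 D G \<xi> \<eta>" by (rule less_le_trans[rotated])
          then obtain g where "g \<in> G" "max N N' < nrm g" "D (act g \<xi>) \<eta> \<le> b powr (- (1 + c') * nrm g)"
            using approx_exponent_frequently by blast
          then show "\<eta> \<in> (\<Union>g\<in>H. {\<eta> \<in> rad \<sigma>. D (act g \<xi>) \<eta> \<le> b powr (- (1 + c') * nrm g)})"
            using \<eta> by (auto simp: H_def)
        qed
      qed
      also have "\<dots> \<le> infsum (\<lambda>g. ennreal (A' * b powr (- (s + p * c') * nrm g))) (G - F)"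
        using N' by (intro infsum_ennreal_mono2) (force simp: H_def)
      also have "\<dots> \<le> ennreal e" by (rule F(3))
      finally show ?thesis by simp
    qed
    then have "hausdorff_content bdry D s (?W \<inter> rad \<sigma>) \<le> 0" by (rule ennreal_le_epsilon) auto
    then show ?thesis by simp
  qed
  show ?thesis
  proof (rule hausdorff_content_zero_UN[of "UNIV :: nat set"])
    show "?W \<subseteq> (\<Union>n::nat. ?W \<inter> rad (real n + 1))"
    proof
      fix \<eta> assume \<eta>: "\<eta> \<in> ?W"
      then obtain \<sigma> where \<sigma>: "0 < \<sigma>" "\<eta> \<in> rad \<sigma>"
        by (auto simp: well_approximable_set_def radial_limit_set_def)
      obtain n :: nat where "\<sigma> \<le> n" using real_arch_simple by blast
      then have "\<eta> \<in> rad (real n + 1)"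
        using \<sigma>(2) radial_limit_set_upto_mono[of \<sigma> "real n + 1" x0 G] by auto
      then show "\<eta> \<in> (\<Union>n::nat. ?W \<inter> rad (real n + 1))" using \<eta> by blast
    qed
  qed (use zero in auto)
qed

end

section \<open>Shadows and descendants\<close>

lemma finite_separated_net:
  fixes f :: "'i \<Rightarrow> 'b::metric_space"
  assumes "finite S" "0 \<le> R"
  shows "\<exists>A\<subseteq>S. (\<forall>x\<in>A. \<forall>y\<in>A. x \<noteq> y \<longrightarrow> R \<le> dist (f x) (f y)) \<and> (\<forall>x\<in>S. \<exists>y\<in>A. dist (f y) (f x) \<le> R)"
  using assms(1)
proof (induction S)
  case (insert x S)
  then obtain A where A: "A \<subseteq> S" "\<forall>x\<in>A. \<forall>y\<in>A. x \<noteq> y \<longrightarrow> R \<le> dist (f x) (f y)"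
    "\<forall>x\<in>S. \<exists>y\<in>A. dist (f y) (f x) \<le> R"
    by (elim exE conjE)
  show ?case
  proof (cases "\<exists>y\<in>A. dist (f y) (f x) \<le> R")
    case True
    show ?thesis
    proof (intro exI[of _ A] conjI)
      show "\<forall>z\<in>insert x S. \<exists>y\<in>A. dist (f y) (f z) \<le> R" using A(3) True by simp
    qed (use A in auto)
  next
    case False
    then have far: "R \<le> dist (f y) (f x)" "R \<le> dist (f x) (f y)" if "y \<in> A" for y
      using that by (auto simp: dist_commute not_le dest: less_imp_le)
    show ?thesis
    proof (intro exI[of _ "insert x A"] conjI)
      show "\<forall>z\<in>insert x S. \<exists>y\<in>insert x A. dist (f y) (f z) \<le> R" using A(3) assms(2) by auto
      show "\<forall>y\<in>insert x A. \<forall>z\<in>insert x A. y \<noteq> z \<longrightarrow> R \<le> dist (f y) (f z)"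
        using A(2) far by simp
    qed (use A(1) in auto)
  qed
qed simp

text \<open>Run through \<open>B\<close> in an order compatible with \<nu> and keep \<open>u\<close>
  if \<open>I u\<close> is disjoint from all kept predecessors; a dropped element meets an earlier
  kept one.\<close>

lemma greedy_disjoint_selection:
  fixes \<nu> :: "'i \<Rightarrow> real" and I :: "'i \<Rightarrow> 'j set"
  assumes B: "countable B" and fin: "\<And>r. finite {u \<in> B. \<nu> u \<le> r}" and ne: "\<And>u. u \<in> B \<Longrightarrow> I u \<noteq> {}"
  shows "\<exists>B'\<subseteq>B. disjoint_family_on I B' \<and> (\<forall>u\<in>B. \<exists>v\<in>B'. \<nu> v \<le> \<nu> u \<and> I u \<inter> I v \<noteq> {})"
proof -
  \<comment> \<open>Recursion needs a well-founded order, so the real value \<nu> is replaced by the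
    number of elements of smaller value, with ties broken by an enumeration.\<close>
  define c where "c u = card {v \<in> B. \<nu> v < \<nu> u}" for u
  define rk where "rk u = (c u, to_nat_on B u)" for u
  define R where "R = inv_image (less_than <*lex*> less_than) rk"
  have "wf R" unfolding R_def by (intro wf_inv_image wf_lex_prod wf_less_than)
  have R_iff: "(u, v) \<in> R \<longleftrightarrow> c u < c v \<or> c u = c v \<and> to_nat_on B u < to_nat_on B v" for u v
    by (simp add: R_def rk_def)
  define sel where "sel = wfrec R (\<lambda>sel u. u \<in> B \<and> (\<forall>v\<in>B. (v, u) \<in> R \<and> sel v \<longrightarrow> I u \<inter> I v = {}))"
  have sel: "sel u \<longleftrightarrow> u \<in> B \<and> (\<forall>v\<in>B. (v, u) \<in> R \<and> sel v \<longrightarrow> I u \<inter> I v = {})" for u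
    unfolding sel_def by (subst wfrec[OF \<open>wf R\<close>]) (auto simp: cut_apply)
  have total: "(u, v) \<in> R \<or> (v, u) \<in> R" if "u \<in> B" "v \<in> B" "u \<noteq> v" for u v
  proof -
    have "to_nat_on B u \<noteq> to_nat_on B v" using that B by simp
    then show ?thesis unfolding R_iff by linarith
  qed
  have le: "\<nu> v \<le> \<nu> u" if "(v, u) \<in> R" "u \<in> B" "v \<in> B" for u v
  proof (rule ccontr)
    assume *: "\<not> \<nu> v \<le> \<nu> u"
    have "{w \<in> B. \<nu> w < \<nu> u} \<subset> {w \<in> B. \<nu> w < \<nu> v}"
    proof (rule psubsetI)
      show "{w \<in> B. \<nu> w < \<nu> u} \<subseteq> {w \<in> B. \<nu> w < \<nu> v}" using * by auto
      have "u \<in> {w \<in> B. \<nu> w < \<nu> v}" "u \<notin> {w \<in> B. \<nu> w < \<nu> u}" using * that(2) by simp_all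
      then show "{w \<in> B. \<nu> w < \<nu> u} \<noteq> {w \<in> B. \<nu> w < \<nu> v}" by metis
    qed
    moreover have "finite {w \<in> B. \<nu> w < \<nu> v}"
      by (rule finite_subset[OF _ fin[of "\<nu> v"]]) auto
    ultimately have "card {w \<in> B. \<nu> w < \<nu> u} < card {w \<in> B. \<nu> w < \<nu> v}"
      by (intro psubset_card_mono)
    then have "c u < c v" by (simp add: c_def)
    then show False using that(1) unfolding R_iff by linarith
  qed
  show ?thesis
  proof (intro exI[of _ "{u \<in> B. sel u}"] conjI ballI)
    show "disjoint_family_on I {u \<in> B. sel u}"
      unfolding disjoint_family_on_def
    proof (intro ballI impI)
      fix u v assume uv: "u \<in> {u \<in> B. sel u}" "v \<in> {u \<in> B. sel u}" "u \<noteq> v"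
      then consider "(u, v) \<in> R" | "(v, u) \<in> R" using total by blast
      then show "I u \<inter> I v = {}"
        using uv sel[of u] sel[of v] by cases auto
    qed
    fix u assume u: "u \<in> B"
    show "\<exists>v\<in>{u \<in> B. sel u}. \<nu> v \<le> \<nu> u \<and> I u \<inter> I v \<noteq> {}"
    proof (cases "sel u")
      case True
      then show ?thesis using u ne by auto
    next
      case False
      then obtain v where "v \<in> B" "(v, u) \<in> R" "sel v" "I u \<inter> I v \<noteq> {}" using sel[of u] u by blast
      then show ?thesis using le[of v u] u by blast
    qed
  qed auto
qed

context visual_group
begin

section \<open>Orbit growth in annuli\<close>

definition annulus :: "nat \<Rightarrow> ('a \<Rightarrow> 'a) set" where
  "annulus n = {g \<in> G. real n \<le> nrm g \<and> nrm g < real n + 1}"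

lemma finite_annulus: "finite (annulus n)"
  by (rule finite_subset[OF _ finite_ball_G[of "real n + 1"]]) (auto simp: annulus_def)

lemma not_summable_below_exponent:
  assumes "0 \<le> t" "ereal t < poincare_exponent b x0 G"
  shows "\<not> (\<lambda>g. b powr (- t * nrm g)) summable_on G"
proof
  assume "(\<lambda>g. b powr (- t * nrm g)) summable_on G"
  then have "poincare_exponent b x0 G \<le> ereal t"
    unfolding poincare_exponent_def using assms(1) by (intro INF_lower) auto
  then show False using assms(2) by simp
qed

text \<open>If all late annuli were this small, a geometric series would dominate the Poincare
  series at an exponent \<open>t'\<close> strictly between \<open>t\<close> and the Poincare
  exponent.\<close>

lemma large_annulus:
  assumes t: "0 \<le> t" "ereal t < poincare_exponent b x0 G" and C: "0 \<le> C"
  shows "\<exists>n\<ge>n0. C * b powr (t * n) < card (annulus n)"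
proof (rule ccontr)
  assume "\<not> ?thesis"
  then have small: "card (annulus n) \<le> C * b powr (t * n)" if "n \<ge> n0" for n
    using that by (auto simp: not_less)
  obtain t' where t': "t < t'" "ereal t' < poincare_exponent b x0 G"
    using ereal_dense2[OF t(2)] by auto
  define q where "q = b powr (t - t')"
  have q: "0 < q" "q < 1" using b_gt_1 t' by (auto simp: q_def powr_less_one)
  have q_pow: "b powr (t * n) * b powr (- t' * n) = q ^ n" for n :: nat
    using q(1) b_gt_1 by (simp add: q_def powr_realpow[symmetric] powr_powr powr_add[symmetric] algebra_simps)
  define c where "c = (\<Sum>n<n0. real (card (annulus n)))"
  have "(\<lambda>g. b powr (- t' * nrm g)) summable_on G"
  proof (rule nonneg_bdd_above_summable_on)
    show "bdd_above (sum (\<lambda>g. b powr (- t' * nrm g)) ` {F. F \<subseteq> G \<and> finite F})"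
    proof (rule bdd_aboveI2)
      fix F assume F: "F \<in> {F. F \<subseteq> G \<and> finite F}"
      define \<phi> where "\<phi> g = nat \<lfloor>nrm g\<rfloor>" for g
      have in_annulus: "g \<in> annulus (\<phi> g)" if "g \<in> G" for g
        using that by (simp add: annulus_def \<phi>_def)
      obtain m where m: "\<phi> ` F \<subseteq> {..<m}"
        using finite_nat_iff_bounded[of "\<phi> ` F"] F by auto
      have "(\<Sum>g\<in>F. b powr (- t' * nrm g)) = (\<Sum>n<m. \<Sum>g\<in>{g \<in> F. \<phi> g = n}. b powr (- t' * nrm g))"
        using F m by (intro sum.group[symmetric]) auto
      also have "\<dots> \<le> (\<Sum>n<m. (if n < n0 then real (card (annulus n)) else 0) + C * q ^ n)"
      proof (rule sum_mono)
        fix n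
        have sub: "{g \<in> F. \<phi> g = n} \<subseteq> annulus n" using F in_annulus by auto
        have "(\<Sum>g\<in>{g \<in> F. \<phi> g = n}. b powr (- t' * nrm g)) \<le> (\<Sum>g\<in>{g \<in> F. \<phi> g = n}. b powr (- t' * n))"
          using sub t' t b_gt_1 by (intro sum_mono powr_mono) (auto simp: annulus_def mult_left_mono)
        also have "\<dots> = card {g \<in> F. \<phi> g = n} * b powr (- t' * n)" by simp
        also have "\<dots> \<le> card (annulus n) * b powr (- t' * n)"
          by (intro mult_right_mono of_nat_mono card_mono finite_annulus sub) auto
        also have "\<dots> \<le> (if n < n0 then real (card (annulus n)) else 0) + C * q ^ n"
        proof (cases "n < n0")
          case True
          have "b powr (- t' * n) \<le> b powr 0" using t t' b_gt_1 by (intro powr_mono) auto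
          also have "b powr 0 = 1" using b_gt_1 by simp
          finally have "b powr (- t' * n) \<le> 1" .
          then have "card (annulus n) * b powr (- t' * n) \<le> real (card (annulus n)) * (1::real)"
            by (intro mult_left_mono) auto
          moreover have "0 \<le> C * q ^ n" using C q by simp
          ultimately show ?thesis using True by simp
        next
          case False
          then have "card (annulus n) * b powr (- t' * n) \<le> C * b powr (t * n) * b powr (- t' * n)"
            using small[of n] by (intro mult_right_mono) auto
          also have "\<dots> = C * q ^ n" using q_pow[of n] by (simp add: mult.assoc)
          finally show ?thesis using False by simp
        qed
        finally show "(\<Sum>g\<in>{g \<in> F. \<phi> g = n}. b powr (- t' * nrm g))
            \<le> (if n < n0 then real (card (annulus n)) else 0) + C * q ^ n" .
      qed
      also have "\<dots> = (\<Sum>n<m. (if n < n0 then real (card (annulus n)) else 0)) + C * (\<Sum>n<m. q ^ n)"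
        by (simp add: sum.distrib sum_distrib_left)
      also have "\<dots> \<le> c + C * (1 / (1 - q))"
      proof (intro add_mono mult_left_mono C)
        have "(\<Sum>n<m. (if n < n0 then real (card (annulus n)) else 0)) = (\<Sum>n\<in>{..<m} \<inter> {..<n0}. real (card (annulus n)))"
          by (subst sum.inter_restrict) (auto intro!: sum.cong)
        also have "\<dots> \<le> c" unfolding c_def by (intro sum_mono2) auto
        finally show "(\<Sum>n<m. (if n < n0 then real (card (annulus n)) else 0)) \<le> c" .
        have "(\<Sum>n<m. q ^ n) \<le> (\<Sum>n. q ^ n)"
          using q by (intro sum_le_suminf) auto
        also have "\<dots> = 1 / (1 - q)" using q by (intro suminf_geometric) auto
        finally show "(\<Sum>n<m. q ^ n) \<le> 1 / (1 - q)" .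
      qed
      finally show "(\<Sum>g\<in>F. b powr (- t' * nrm g)) \<le> c + C * (1 / (1 - q))" .
    qed
  qed auto
  then show False using not_summable_below_exponent[of t'] t t' by simp
qed

text \<open>By translation, at most \<open>k\<close> group elements have orbit points within
  \<open>R\<close> of a given one, so an \<open>R\<close>-dense separated subset retains a fixed
  proportion of the annulus.\<close>

lemma large_separated_annulus:
  assumes t: "0 \<le> t" "ereal t < poincare_exponent b x0 G" and C: "0 \<le> C" and R: "0 \<le> R"
  shows "\<exists>n\<ge>n0. \<exists>A\<subseteq>annulus n. C * b powr (t * n) \<le> card A \<and>
    (\<forall>g\<in>A. \<forall>h\<in>A. g \<noteq> h \<longrightarrow> R \<le> dist (g x0) (h x0))"
proof -
  define k where "k = card {g \<in> G. nrm g \<le> R}"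
  have "{id} \<subseteq> {g \<in> G. nrm g \<le> R}" using id_G R by auto
  then have k: "1 \<le> k" unfolding k_def using card_mono[OF finite_ball_G[of R], of "{id}"] by simp
  obtain n where n: "n \<ge> n0" "C * real k * b powr (t * n) < card (annulus n)"
    using large_annulus[OF t, of "C * real k" n0] C by auto
  obtain A where A: "A \<subseteq> annulus n" "\<forall>x\<in>A. \<forall>y\<in>A. x \<noteq> y \<longrightarrow> R \<le> dist (x x0) (y x0)"
    "\<forall>x\<in>annulus n. \<exists>y\<in>A. dist (y x0) (x x0) \<le> R"
    using finite_separated_net[OF finite_annulus[of n] R, of "\<lambda>g. g x0"] by (elim exE conjE)
  have "finite A" using A(1) finite_annulus finite_subset by blast
  have AG: "y \<in> G" if "y \<in> A" for y using A(1) that by (auto simp: annulus_def)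
  have sub: "annulus n \<subseteq> (\<Union>y\<in>A. (\<lambda>h. y \<circ> h) ` {g \<in> G. nrm g \<le> R})"
  proof
    fix x assume x: "x \<in> annulus n"
    then obtain y where y: "y \<in> A" "dist (y x0) (x x0) \<le> R" using A(3) by blast
    let ?h = "iv y \<circ> x"
    have "?h \<in> G" using comp_G[OF inv_G[OF AG[OF y(1)]]] x by (simp add: annulus_def)
    moreover have "x = y \<circ> ?h" using isometry_groupD(3)[OF carrier_G[OF AG[OF y(1)]]] by auto
    moreover have "nrm ?h \<le> R"
      using y(2) dist_inv_isometry[OF carrier_G[OF AG[OF y(1)]], of x0 "x x0"] by simp
    ultimately show "x \<in> (\<Union>y\<in>A. (\<lambda>h. y \<circ> h) ` {g \<in> G. nrm g \<le> R})" using y(1) by blast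
  qed
  have "card (annulus n) \<le> card (\<Union>y\<in>A. (\<lambda>h. y \<circ> h) ` {g \<in> G. nrm g \<le> R})"
    using \<open>finite A\<close> finite_ball_G by (intro card_mono[OF _ sub]) auto
  also have "\<dots> \<le> (\<Sum>y\<in>A. card ((\<lambda>h. y \<circ> h) ` {g \<in> G. nrm g \<le> R}))"
    by (rule card_UN_le[OF \<open>finite A\<close>])
  also have "\<dots> \<le> (\<Sum>y\<in>A. k)"
    unfolding k_def by (intro sum_mono card_image_le finite_ball_G)
  finally have "card (annulus n) \<le> card A * k" by simp
  then have "real (card (annulus n)) \<le> real (card A) * real k"
    by (metis of_nat_le_iff of_nat_mult)
  then have "C * b powr (t * n) * real k < card A * real k" using n(2) by (simp add: mult_ac)
  then have "C * b powr (t * n) \<le> card A" using k by simp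
  then show ?thesis using n(1) A(1,2) by blast
qed

end

text \<open>The constant \<open>4 * K + E\<close> in the definition of \<open>link\<close> also covers the steps that follow a
  radial ray from a point near \<open>\<xi>\<close>, not only those to the children of a node.\<close>

locale turning_group = visual_group x0 E b Cv D G
  for x0 :: "'a::metric_space" and E b Cv D G +
  fixes J :: "('a \<Rightarrow> 'a) set" and K :: real
  assumes finite_J: "finite J" and J_G: "J \<subseteq> G" and J_nonempty: "J \<noteq> {}"
    and K_nonneg: "0 \<le> K" and nrm_J: "\<And>j. j \<in> J \<Longrightarrow> nrm j \<le> K"
    and turn: "\<And>x g. g \<in> G \<Longrightarrow> \<exists>j\<in>J. gp x0 x (j (g x0)) \<le> K"
    and turn_boundary: "\<And>x \<eta>. \<eta> \<in> bdry \<Longrightarrow> \<exists>j\<in>J. \<not> ereal K \<le> bp x0 (act j \<eta>) (pt x)"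
begin

definition Q :: real where "Q = 4 * K + E"
text \<open>Shadows must be nested along chains and contain the limits of chains. One
  \<open>E\<close> is lost along a chain (\<open>descD\<close>), another in the comparison with a
  boundary point.\<close>

definition \<tau> :: real where "\<tau> = Q + 2 * E"

lemma Q_tau: "0 \<le> Q" "K \<le> Q" "0 \<le> \<tau>" "E \<le> \<tau>"
  using K_nonneg E_nonneg by (auto simp: Q_def \<tau>_def)

definition link :: "('a \<Rightarrow> 'a) \<Rightarrow> ('a \<Rightarrow> 'a) \<Rightarrow> bool" where
  "link h h' \<longleftrightarrow> h \<in> G \<and> h' \<in> G \<and> nrm h - Q \<le> gp x0 (h x0) (h' x0) \<and> nrm h + \<tau> + 1 \<le> nrm h'"

abbreviation "desc \<equiv> link\<^sup>+\<^sup>+"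

text \<open>The boundary version of the shadow cast from \<open>x0\<close> by a ball of radius about
  \<open>\<rho>\<close> around \<open>h x0\<close>.\<close>

definition wide_shadow :: "real \<Rightarrow> ('a \<Rightarrow> 'a) \<Rightarrow> 'a bdpoint set" where
  "wide_shadow \<rho> h = {\<eta> \<in> bdry. ereal (nrm h - \<rho>) \<le> bp x0 \<eta> (pt (h x0))}"

abbreviation "shadow \<equiv> wide_shadow \<tau>"

lemma wide_shadow_boundary: "wide_shadow \<rho> h \<subseteq> bdry"
  by (auto simp: wide_shadow_def)

lemma wide_shadow_mono: "\<rho> \<le> \<rho>' \<Longrightarrow> wide_shadow \<rho> h \<subseteq> wide_shadow \<rho>' h"
  by (auto simp: wide_shadow_def intro: order_trans[rotated])

lemma wide_shadow_diam:
  assumes "\<eta> \<in> wide_shadow \<rho> h" "\<eta>' \<in> wide_shadow \<rho> h"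
  shows "D \<eta> \<eta>' \<le> b powr (kv + \<rho> + E - nrm h)"
proof -
  have "ereal (nrm h - \<rho>) \<le> bp x0 \<eta> (pt (h x0))" "ereal (nrm h - \<rho>) \<le> bp x0 (pt (h x0)) \<eta>'"
    using assms by (auto simp: wide_shadow_def bp_commute)
  then have "ereal (nrm h - \<rho> - E) \<le> bp x0 \<eta> \<eta>'"
    by (rule le_bp_trans) (rule pt_nonempty)
  then have "D \<eta> \<eta>' \<le> b powr (kv - (nrm h - \<rho> - E))"
    using assms wide_shadow_boundary by (intro D_le_of_bp) auto
  then show ?thesis by (simp add: algebra_simps)
qed

text \<open>Errors do not accumulate: a link raises the norm by more than \<open>E\<close>, so the
  weaker bound inherited for \<open>z\<close> is still at least \<open>nrm y - Q\<close>, and only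
  the last comparison costs \<open>E\<close>.\<close>

lemma descD:
  assumes "desc h h'"
  shows "h \<in> G" "h' \<in> G" "nrm h - Q - E \<le> gp x0 (h x0) (h' x0)" "nrm h + \<tau> + 1 \<le> nrm h'"
proof -
  have "h \<in> G \<and> h' \<in> G \<and> nrm h - Q - E \<le> gp x0 (h x0) (h' x0) \<and> nrm h + \<tau> + 1 \<le> nrm h'"
    using assms
  proof (induction rule: converse_tranclp_induct)
    case (base y)
    then show ?case using E_nonneg by (auto simp: link_def)
  next
    case (step y z)
    have "nrm y - Q \<le> gp x0 (y x0) (z x0)" "nrm y + \<tau> + 1 \<le> nrm z" "y \<in> G"
      using step(1) by (auto simp: link_def)
    moreover have "nrm y - Q \<le> gp x0 (z x0) (h' x0)" using step.IH calculation(2) Q_tau by linarith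
    ultimately show ?case
      using gp_hypD[of "nrm y - Q" x0 "y x0" "z x0" "h' x0"] step.IH Q_tau by auto
  qed
  then show "h \<in> G" "h' \<in> G" "nrm h - Q - E \<le> gp x0 (h x0) (h' x0)" "nrm h + \<tau> + 1 \<le> nrm h'" by auto
qed

lemma desc_shadow:
  assumes "desc h h'"
  shows "shadow h' \<subseteq> shadow h"
proof
  fix \<eta> assume \<eta>: "\<eta> \<in> shadow h'"
  have "ereal (nrm h - Q - E) \<le> ereal (nrm h' - \<tau>)"
    using descD(4)[OF assms] Q_tau E_nonneg by simp
  also have "\<dots> \<le> bp x0 \<eta> (pt (h' x0))" using \<eta> by (simp add: wide_shadow_def)
  finally have "ereal (nrm h - Q - E) \<le> bp x0 \<eta> (pt (h' x0))" .
  moreover have "ereal (nrm h - Q - E) \<le> bp x0 (pt (h' x0)) (pt (h x0))"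
    using descD(3)[OF assms] by (simp add: le_bp_pt_iff gp_commute)
  ultimately have "ereal (nrm h - Q - E - E) \<le> bp x0 \<eta> (pt (h x0))"
    by (rule le_bp_trans) (rule pt_nonempty)
  then show "\<eta> \<in> shadow h" using \<eta> by (simp add: wide_shadow_def \<tau>_def algebra_simps)
qed

lemma desc_chain:
  assumes "\<And>k. desc (u k) (u (Suc k))" "k < l"
  shows "desc (u k) (u l)"
  using assms(2) by (induction l) (auto simp: less_Suc_eq intro: assms(1) tranclp_trans)

lemma desc_chain_nrm:
  assumes "\<And>k. desc (u k) (u (Suc k))"
  shows "real k \<le> nrm (u k)"
proof (induction k)
  case (Suc k)
  then show ?case using descD(4)[OF assms[of k]] Q_tau by simp
qed simp

text \<open>Products between the orbit points grow with their norms, so they form a Gromov sequence;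
  its class lies in every shadow by \<open>le_bp_boundaryI\<close>.\<close>

lemma desc_chain_limit:
  assumes u: "\<And>k. desc (u k) (u (Suc k))"
  obtains \<eta> where "\<eta> \<in> bdry" "\<And>k. \<eta> \<in> shadow (u k)"
proof -
  have gp: "nrm (u k) - Q - E \<le> gp x0 (u k x0) (u l x0)" if "k < l" for k l
    using descD(3)[OF desc_chain[of u, OF u that]] .
  have "gromov_sequence x0 (\<lambda>k. u k x0)"
    unfolding gromov_sequence_def filterlim_at_top eventually_prod_sequentially
  proof
    fix Z
    obtain N :: nat where N: "Z + Q + E \<le> N" using real_arch_simple by blast
    have "Z \<le> gp x0 (u n x0) (u m x0)" if "N \<le> m" "N \<le> n" for m n
    proof -
      have "real N \<le> nrm (u m)" "real N \<le> nrm (u n)"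
        using desc_chain_nrm[of u m, OF u] desc_chain_nrm[of u n, OF u] that by auto
      then show ?thesis
        using gp[of n m] gp[of m n] gp_same[of x0 "u n x0"] gp_commute[of x0 "u n x0" "u m x0"] N Q_tau E_nonneg
        by (cases n m rule: linorder_cases) auto
    qed
    then show "\<exists>N. \<forall>m\<ge>N. \<forall>n\<ge>N. Z \<le> (case (n, m) of (n, m) \<Rightarrow> gp x0 (u n x0) (u m x0))"
      by auto
  qed
  then obtain \<eta> where \<eta>: "\<eta> \<in> bdry" "(\<lambda>k. u k x0) \<in> \<eta>" by (rule boundary_class)
  have "\<eta> \<in> shadow (u k)" for k
  proof -
    have "\<exists>n\<ge>N. nrm (u k) - Q - E \<le> gp x0 (u n x0) (u k x0)" for N
      using gp[of k "max N (Suc k)"] by (intro exI[of _ "max N (Suc k)"]) (simp add: gp_commute)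
    then have "ereal (nrm (u k) - Q - E - E) \<le> bp x0 \<eta> (pt (u k x0))"
      by (rule le_bp_boundaryI[OF \<eta>])
    then show ?thesis using \<eta>(1) by (simp add: wide_shadow_def \<tau>_def algebra_simps)
  qed
  then show ?thesis using that \<eta>(1) by blast
qed

text \<open>A product of at least \<open>nrm (u k) - \<tau>\<close> seen from \<open>x0\<close>
  leaves at most \<tau> seen from \<open>u k x0\<close>, by \<open>le_bp_sumD\<close>.\<close>

lemma desc_chain_limit_radial:
  assumes u: "\<And>k. desc (u k) (u (Suc k))" and \<eta>: "\<eta> \<in> bdry" "\<And>k. \<eta> \<in> shadow (u k)"
  shows "\<eta> \<in> rad \<tau>"
proof (rule radI[OF \<eta>(1)])
  fix M
  obtain k :: nat where k: "M + \<tau> \<le> k" using real_arch_simple by blast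
  have sh: "ereal (nrm (u k) - \<tau>) \<le> bp x0 \<eta> (pt (u k x0))" using \<eta>(2) by (simp add: wide_shadow_def)
  have "ereal M \<le> ereal (nrm (u k) - \<tau>)" using desc_chain_nrm[of u k, OF u] k by simp
  then have "ereal M \<le> bp x0 \<eta> (pt (u k x0))" using sh by (rule order_trans)
  moreover have "bp (u k x0) \<eta> (pt x0) \<le> ereal \<tau>"
  proof (rule ereal_leI_real)
    fix v assume "ereal v \<le> bp (u k x0) \<eta> (pt x0)"
    from le_bp_sumD[OF sh boundary_nonempty[OF \<eta>(1)] this] show "ereal v \<le> ereal \<tau>"
      by (simp add: dist_commute)
  qed
  moreover have "u k \<in> G" using descD(1)[OF u[of k]] .
  ultimately show "\<exists>h\<in>G. ereal M \<le> bp x0 \<eta> (pt (h x0)) \<and> bp (h x0) \<eta> (pt x0) \<le> ereal \<tau>" by blast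
qed

text \<open>The count uses the same \<open>N\<close> that bounds the norm increase, so dividing mass
  by the number of children gives decay at rate \<open>t\<close> in the norm. Siblings are separated
  at the scale of the parent.\<close>

definition children :: "real \<Rightarrow> real \<Rightarrow> real \<Rightarrow> ('a \<Rightarrow> 'a) \<Rightarrow> ('a \<Rightarrow> 'a) set \<Rightarrow> bool" where
  "children t N c0 h Ch \<longleftrightarrow> finite Ch \<and> b powr (t * N) \<le> card Ch \<and>
    (\<forall>h'\<in>Ch. link h h' \<and> nrm h' \<le> nrm h + N) \<and>
    (\<forall>h1\<in>Ch. \<forall>h2\<in>Ch. h1 \<noteq> h2 \<longrightarrow> (\<forall>\<eta>1\<in>shadow h1. \<forall>\<eta>2\<in>shadow h2. c0 * b powr (- nrm h) < D \<eta>1 \<eta>2))"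

definition branching :: "real \<Rightarrow> real \<Rightarrow> real \<Rightarrow> bool" where
  "branching t N c0 \<longleftrightarrow> 0 \<le> N \<and> 0 < c0 \<and> (\<forall>h\<in>G. \<exists>Ch. children t N c0 h Ch)"

text \<open>A common turn \<open>j\<close> for all children makes \<open>h \<circ> j\<close> a
  single isometry, so the separation of the points \<open>g x0\<close> survives and the count loses
  only the factor \<open>card J\<close>.\<close>

lemma branching_exists:
  assumes t: "0 \<le> t" "ereal t < poincare_exponent b x0 G"
  shows "\<exists>N c0. branching t N c0"
proof -
  \<comment> \<open>Chosen to contradict \<open>far\<close> with 1 to spare: siblings with shadows
    too close would give \<open>R / 2 \<le> 4 * K + \<tau> + 2 * E + 1\<close>.\<close>
  define R where "R = 2 * (4 * K + \<tau> + 2 * E + 2)"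
  have "0 < R" using K_nonneg Q_tau E_nonneg by (simp add: R_def)
  \<comment> \<open>Pigeonhole over the turns costs \<open>card J\<close>; the other factor accounts
    for \<open>N = n + 1 + K\<close> in place of \<open>n\<close>.\<close>
  define C where "C = real (card J) * b powr (t * (1 + K))"
  have "0 \<le> C" by (simp add: C_def)
  obtain n0 :: nat where n0: "3 * K + \<tau> + 1 \<le> n0" using real_arch_simple by blast
  obtain n A where n: "n \<ge> n0" and A: "A \<subseteq> annulus n" "C * b powr (t * n) \<le> card A"
    and sep: "\<forall>g\<in>A. \<forall>h\<in>A. g \<noteq> h \<longrightarrow> R \<le> dist (g x0) (h x0)"
    using large_separated_annulus[OF t \<open>0 \<le> C\<close> less_imp_le[OF \<open>0 < R\<close>], of n0] by (elim exE conjE)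
  have "finite A" using A(1) finite_annulus finite_subset by blast
  have ann: "g \<in> G" "real n \<le> nrm g" "nrm g \<le> real n + 1" if "g \<in> A" for g
    using A(1) that by (auto simp: annulus_def)
  define N where "N = real n + 1 + K"
  define c0 where "c0 = b powr (- (n - 3 * K - \<tau>) - kv)"
  have main: "\<exists>Ch. children t N c0 h Ch" if h: "h \<in> G" for h
  proof -
    have "\<forall>g\<in>A. \<exists>j. j \<in> J \<and> gp x0 (iv h x0) (j (g x0)) \<le> K"
      using turn ann(1) by blast
    from bchoice[OF this] obtain jj where jj: "\<forall>g\<in>A. jj g \<in> J \<and> gp x0 (iv h x0) (jj g (g x0)) \<le> K" ..
    \<comment> \<open>Pigeonhole: some turn serves at least the average number of elements of
      \<open>A\<close>.\<close>
    have "\<exists>j\<in>J. card A \<le> card J * card {g \<in> A. jj g = j}"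
    proof (rule ccontr)
      assume "\<not> ?thesis"
      then have small: "card J * card {g \<in> A. jj g = j} < card A" if "j \<in> J" for j using that by (auto simp: not_le)
      have "jj ` A \<subseteq> J" using jj by auto
      then have "card J * card A = card J * (\<Sum>j\<in>J. card {g \<in> A. jj g = j})"
        using sum.group[OF \<open>finite A\<close> finite_J, of jj "\<lambda>_. 1::nat"] by simp
      also have "\<dots> = (\<Sum>j\<in>J. card J * card {g \<in> A. jj g = j})" by (simp add: sum_distrib_left)
      also have "\<dots> < (\<Sum>j\<in>J. card A)" using small finite_J J_nonempty by (intro sum_strict_mono) auto
      finally show False by simp
    qed
    then obtain j where j: "j \<in> J" "card A \<le> card J * card {g \<in> A. jj g = j}" by blast
    define A' where "A' = {g \<in> A. jj g = j}"
    have "j \<in> G" using j J_G by auto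
    define f where "f = h \<circ> j"
    have f: "f \<in> G" using comp_G[OF h \<open>j \<in> G\<close>] by (simp add: f_def)
    have nf: "nrm f \<le> nrm h + K" using nrm_comp_le[OF h, of j] nrm_J[OF j(1)] by (simp add: f_def)
    have A'g: "g \<in> A" "g \<in> G" "gp x0 (iv h x0) (j (g x0)) \<le> K" if "g \<in> A'" for g
      using that jj ann(1) by (auto simp: A'_def)
    have low: "nrm h + n - 3 * K \<le> nrm (f \<circ> g)" "link h (f \<circ> g)" "nrm (f \<circ> g) \<le> nrm h + N" if g: "g \<in> A'" for g
    proof -
      have "real n - K \<le> nrm (j \<circ> g)"
        using nrm_comp_ge[OF \<open>j \<in> G\<close>, of g] ann(2)[OF A'g(1)[OF g]] nrm_J[OF j(1)] by simp
      then show 1: "nrm h + n - 3 * K \<le> nrm (f \<circ> g)"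
        using nrm_comp[OF h, of "j \<circ> g"] A'g(3)[OF g] by (simp add: f_def)
      have "nrm h - Q \<le> gp x0 (h x0) ((f \<circ> g) x0)"
        using gp_comp[OF h, of "j \<circ> g"] A'g(3)[OF g] Q_tau by (simp add: f_def)
      moreover have "nrm h + \<tau> + 1 \<le> nrm (f \<circ> g)" using 1 n n0 by linarith
      ultimately show "link h (f \<circ> g)" using h comp_G[OF f A'g(2)[OF g]] by (simp add: link_def)
      show "nrm (f \<circ> g) \<le> nrm h + N"
        using nrm_comp_le[OF f, of g] nf ann(3)[OF A'g(1)[OF g]] by (simp add: N_def)
    qed
    have far: "c0 * b powr (- nrm h) < D \<eta>1 \<eta>2"
      if g: "g1 \<in> A'" "g2 \<in> A'" "g1 \<noteq> g2" and \<eta>: "\<eta>1 \<in> shadow (f \<circ> g1)" "\<eta>2 \<in> shadow (f \<circ> g2)" for g1 g2 \<eta>1 \<eta>2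
    proof (rule ccontr)
      define M where "M = nrm h + n - 3 * K - \<tau>"
      assume "\<not> ?thesis"
      then have "D \<eta>1 \<eta>2 \<le> b powr - (M + kv)"
        by (simp add: c0_def M_def powr_add[symmetric] algebra_simps)
      then have 12: "ereal M \<le> bp x0 \<eta>1 \<eta>2"
        using \<eta> wide_shadow_boundary by (intro bp_of_D_le) auto
      have ne: "\<eta>1 \<noteq> {}" "\<eta>2 \<noteq> {}" using \<eta> wide_shadow_boundary boundary_nonempty by blast+
      have 1: "ereal M \<le> bp x0 (pt ((f \<circ> g1) x0)) \<eta>1"
      proof -
        have "ereal M \<le> ereal (nrm (f \<circ> g1) - \<tau>)" using low(1)[OF g(1)] by (simp add: M_def)
        also have "\<dots> \<le> bp x0 \<eta>1 (pt ((f \<circ> g1) x0))" using \<eta>(1) by (simp add: wide_shadow_def)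
        finally show ?thesis by (simp add: bp_commute)
      qed
      have 2: "ereal (M - E) \<le> bp x0 \<eta>2 (pt ((f \<circ> g2) x0))"
      proof -
        have "ereal (M - E) \<le> ereal (nrm (f \<circ> g2) - \<tau>)" using low(1)[OF g(2)] E_nonneg by (simp add: M_def)
        also have "\<dots> \<le> bp x0 \<eta>2 (pt ((f \<circ> g2) x0))" using \<eta>(2) by (simp add: wide_shadow_def)
        finally show ?thesis .
      qed
      from le_bp_trans[OF le_bp_trans[OF 1 12 ne(1)] 2 ne(2)]
      have "M - E - E \<le> gp x0 (f (g1 x0)) (f (g2 x0))" by (simp add: le_bp_pt_iff)
      also have "\<dots> = gp (iv f x0) (g1 x0) (g2 x0)" by (rule gp_isometry[OF carrier_G[OF f]])
      also have "\<dots> \<le> gp x0 (g1 x0) (g2 x0) + nrm f"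
        using gp_lipschitz_base[of "iv f x0" "g1 x0" "g2 x0" x0] nrm_inv[OF f] by (simp add: dist_commute)
      finally have "M - E - E \<le> gp x0 (g1 x0) (g2 x0) + nrm h + K" using nf by simp
      moreover have "gp x0 (g1 x0) (g2 x0) \<le> real n + 1 - R / 2"
        using sep[rule_format, OF A'g(1)[OF g(1)] A'g(1)[OF g(2)] g(3)] ann(3)[OF A'g(1)[OF g(1)]] ann(3)[OF A'g(1)[OF g(2)]]
        by (simp add: gromov_product_def dist_commute field_simps)
      ultimately show False by (simp add: M_def R_def field_simps)
    qed
    define Ch where "Ch = (\<lambda>g. f \<circ> g) ` A'"
    have "finite Ch" using \<open>finite A\<close> by (simp add: Ch_def A'_def)
    moreover have "b powr (t * N) \<le> card Ch"
    proof -
      have "inj_on (\<lambda>g. f \<circ> g) A'"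
      proof (rule inj_onI)
        fix g g' assume "g \<in> A'" "g' \<in> A'" and eq: "f \<circ> g = f \<circ> g'"
        have "f (g x) = f (g' x)" for x using eq by (metis comp_apply)
        then show "g = g'" using isometry_groupD(4)[OF carrier_G[OF f]] by (metis ext)
      qed
      then have "card Ch = card A'" by (simp add: Ch_def card_image)
      have "real (card J) * b powr (t * N) = C * b powr (t * n)"
        by (simp add: C_def N_def powr_add[symmetric] algebra_simps)
      also have "\<dots> \<le> card A" by (rule A(2))
      also have "\<dots> \<le> real (card J) * card Ch"
        using j(2) \<open>card Ch = card A'\<close> by (metis A'_def of_nat_le_iff of_nat_mult)
      finally show ?thesis
        using finite_J J_nonempty by (simp add: card_gt_0_iff)
    qed
    moreover have "\<forall>h'\<in>Ch. link h h' \<and> nrm h' \<le> nrm h + N"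
      using low(2,3) by (simp add: Ch_def del: o_apply)
    moreover have "\<forall>h1\<in>Ch. \<forall>h2\<in>Ch. h1 \<noteq> h2 \<longrightarrow> (\<forall>\<eta>1\<in>shadow h1. \<forall>\<eta>2\<in>shadow h2. c0 * b powr (- nrm h) < D \<eta>1 \<eta>2)"
      unfolding Ch_def using far by blast
    ultimately show ?thesis unfolding children_def by (intro exI[of _ Ch] conjI)
  qed
  have "0 < c0" "0 \<le> N" using b_gt_1 K_nonneg by (auto simp: c0_def N_def)
  then show ?thesis unfolding branching_def using main by (intro exI[of _ N] exI[of _ c0] conjI ballI)
qed

end

section \<open>Descending past a weighted cover\<close>

lemma infsum_ennreal_Un_le:
  fixes f :: "'i \<Rightarrow> ennreal"
  shows "infsum f (A \<union> B) \<le> infsum f A + infsum f B"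
proof -
  have "infsum f (A \<union> (B - A)) = infsum f A + infsum f (B - A)"
    by (rule infsum_Un_disjoint) (auto intro: nonneg_summable_on_complete)
  also have "\<dots> \<le> infsum f A + infsum f B"
    by (intro add_left_mono infsum_ennreal_mono2) auto
  finally show ?thesis by simp
qed

text \<open>The weight \<open>a A\<close> dominates \<open>diam A powr s\<close>; it is kept separate so that it can be positive
  also on sets of diameter \<open>0\<close>.\<close>

locale weighted_cover = turning_group x0 E b Cv D G J K
  for x0 :: "'a::metric_space" and E b Cv D G J K +
  fixes \<C> :: "'a bdpoint set set" and a :: "'a bdpoint set \<Rightarrow> ennreal" and s :: real
  assumes s_pos: "0 < s" and countable_C: "countable \<C>"
    and weight: "\<And>A x y. A \<in> \<C> \<Longrightarrow> x \<in> A \<Longrightarrow> y \<in> A \<Longrightarrow> ennreal (D x y powr s) \<le> a A"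
begin

definition hit :: "('a \<Rightarrow> 'a) \<Rightarrow> 'a bdpoint set set" where
  "hit h = {A \<in> \<C>. A \<inter> shadow h \<noteq> {}}"

definition mass :: "('a \<Rightarrow> 'a) \<Rightarrow> ennreal" where
  "mass h = infsum a (hit h)"

lemma hit_desc: "desc h h' \<Longrightarrow> hit h' \<subseteq> hit h"
  using desc_shadow[of h h'] by (auto simp: hit_def)

lemma le_mass: "A \<in> hit h \<Longrightarrow> a A \<le> mass h"
  unfolding mass_def by (rule le_infsum_ennreal)

lemma weight_realD:
  assumes "A \<in> \<C>" "x \<in> A" "y \<in> A" "a A \<le> ennreal (r powr s)" "0 \<le> r"
  shows "D x y \<le> r"
proof (rule ccontr)
  assume "\<not> D x y \<le> r"
  then have "r powr s < D x y powr s" using assms(5) s_pos by (intro powr_less_mono2) auto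
  moreover have "ennreal (D x y powr s) \<le> ennreal (r powr s)"
    using weight[OF assms(1-3)] assms(4) by (rule order_trans)
  ultimately show False by (simp add: ennreal_le_iff)
qed

text \<open>Origin of the threshold \<open>c0 powr s\<close>: a set meeting two children's shadows
  has diameter above \<open>c0 * b powr (- nrm h)\<close>, hence more weight than all the mass of
  \<open>h\<close>. So the children share this mass, and the lightest gets at most the
  average.\<close>

lemma descend_step:
  assumes br: "branching t N c0" and h: "h \<in> G" and \<kappa>: "0 \<le> \<kappa>" "\<kappa> \<le> c0 powr s"
    and m: "mass h \<le> ennreal (\<kappa> * b powr (- s * nrm h))"
  shows "\<exists>h'. link h h' \<and> nrm h' \<le> nrm h + N \<and> mass h' \<le> ennreal (b powr (- t * N)) * mass h"
proof -
  have c0: "0 < c0" using br by (simp add: branching_def)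
  obtain Ch where Ch: "finite Ch" "b powr (t * N) \<le> card Ch"
    "\<forall>h'\<in>Ch. link h h' \<and> nrm h' \<le> nrm h + N"
    "\<forall>h1\<in>Ch. \<forall>h2\<in>Ch. h1 \<noteq> h2 \<longrightarrow> (\<forall>\<eta>1\<in>shadow h1. \<forall>\<eta>2\<in>shadow h2. c0 * b powr (- nrm h) < D \<eta>1 \<eta>2)"
    using br[unfolded branching_def, THEN conjunct2, THEN conjunct2, THEN bspec, OF h]
    unfolding children_def by (elim exE conjE)
  have "disjoint_family_on hit Ch"
    unfolding disjoint_family_on_def
  proof (intro ballI impI, rule ccontr)
    fix h1 h2 assume h12: "h1 \<in> Ch" "h2 \<in> Ch" "h1 \<noteq> h2" "hit h1 \<inter> hit h2 \<noteq> {}"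
    then obtain A z1 z2 where A: "A \<in> \<C>" "A \<in> hit h1" "z1 \<in> A" "z1 \<in> shadow h1" "z2 \<in> A" "z2 \<in> shadow h2"
      by (auto simp: hit_def)
    have far: "c0 * b powr (- nrm h) < D z1 z2" using Ch(4) h12 A by blast
    have "desc h h1" using Ch(3) h12 by blast
    then have "a A \<le> mass h" using hit_desc A(2) le_mass by blast
    also have "\<dots> \<le> ennreal (\<kappa> * b powr (- s * nrm h))" by (rule m)
    also have "\<dots> \<le> ennreal (c0 powr s * b powr (- s * nrm h))"
      using \<kappa> by (intro ennreal_leI mult_right_mono) auto
    also have "c0 powr s * b powr (- s * nrm h) = (c0 * b powr (- nrm h)) powr s"
      using c0 by (simp add: powr_mult powr_powr mult.commute)
    finally have "D z1 z2 \<le> c0 * b powr (- nrm h)"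
      using A c0 by (intro weight_realD[of A]) auto
    then show False using far by simp
  qed
  then have sum: "(\<Sum>h'\<in>Ch. mass h') \<le> mass h"
    unfolding mass_def
  proof (rule sum_disjoint_infsum_ennreal_le[OF Ch(1)])
    show "hit h' \<subseteq> hit h" if "h' \<in> Ch" for h' using Ch(3) that by (intro hit_desc) auto
  qed
  have "0 < real (card Ch)" using Ch(2) b_gt_1 by (smt (verit) powr_gt_zero)
  then have "Ch \<noteq> {}" by auto
  obtain h' where h': "h' \<in> Ch" "\<forall>k\<in>Ch. mass h' \<le> mass k"
    using ex_is_arg_min_if_finite[OF Ch(1) \<open>Ch \<noteq> {}\<close>, of mass] unfolding is_arg_min_linorder by blast
  have "mass h' = ennreal (b powr (- t * N)) * (ennreal (b powr (t * N)) * mass h')"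
    using b_gt_1 by (simp add: mult.assoc[symmetric] ennreal_mult[symmetric] powr_add[symmetric])
  also have "\<dots> \<le> ennreal (b powr (- t * N)) * (ennreal (card Ch) * mass h')"
    using Ch(2) by (intro mult_left_mono mult_right_mono ennreal_leI) auto
  also have "ennreal (card Ch) * mass h' = (\<Sum>k\<in>Ch. mass h')" by (simp add: ennreal_of_nat_eq_real_of_nat)
  also have "\<dots> \<le> (\<Sum>k\<in>Ch. mass k)" using h'(2) by (intro sum_mono) auto
  also have "\<dots> \<le> mass h" by (rule sum)
  finally have "mass h' \<le> ennreal (b powr (- t * N)) * mass h" by (simp add: mult_left_mono)
  then show ?thesis using Ch(3) h'(1) by blast
qed

text \<open>Mass decays at rate \<open>t\<close> while \<open>descend_step\<close> asks only for
  rate \<open>s\<close>, so \<open>s \<le> t\<close> keeps its hypothesis alive at every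
  node.\<close>

lemma descend:
  assumes br: "branching t N c0" and h: "h \<in> G" and \<kappa>: "0 \<le> \<kappa>" "\<kappa> \<le> c0 powr s" and st: "s \<le> t"
    and m: "mass h \<le> ennreal (\<kappa> * b powr (- s * nrm h))"
  shows "\<exists>h'\<in>G. (h' = h \<or> desc h h') \<and> T \<le> nrm h' \<and> nrm h' \<le> max T (nrm h) + N \<and>
    mass h' \<le> ennreal (\<kappa> * b powr (- s * nrm h) * b powr (- t * (nrm h' - nrm h)))"
proof -
  have N: "0 \<le> N" using br by (simp add: branching_def)
  \<comment> \<open>Each step adds between 1 and \<open>N\<close> to the norm, so \<open>k\<close>
    steps gain at least \<open>k\<close>, and the level \<open>T\<close> is overshot by at most
    \<open>N\<close>.\<close>
  have "\<exists>h'\<in>G. (h' = h \<or> desc h h') \<and> (T \<le> nrm h' \<or> nrm h + real k \<le> nrm h') \<and>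
    nrm h \<le> nrm h' \<and> nrm h' \<le> max T (nrm h) + N \<and>
    mass h' \<le> ennreal (\<kappa> * b powr (- s * nrm h) * b powr (- t * (nrm h' - nrm h)))" for k
  proof (induction k)
    case 0
    then show ?case using h m N b_gt_1 by (intro bexI[of _ h]) auto
  next
    case (Suc k)
    then obtain h' where h': "h' \<in> G" "h' = h \<or> desc h h'" "T \<le> nrm h' \<or> nrm h + real k \<le> nrm h'"
      "nrm h \<le> nrm h'" "nrm h' \<le> max T (nrm h) + N"
      "mass h' \<le> ennreal (\<kappa> * b powr (- s * nrm h) * b powr (- t * (nrm h' - nrm h)))"
      by (elim bexE conjE)
    show ?case
    proof (cases "T \<le> nrm h'")
      case True
      then have "T \<le> nrm h' \<or> nrm h + real (Suc k) \<le> nrm h'" ..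
      then show ?thesis using h'(1,2,4-6) by (intro bexI[of _ h'] conjI)
    next
      case False
      have "\<kappa> * b powr (- s * nrm h) * b powr (- t * (nrm h' - nrm h)) \<le> \<kappa> * b powr (- s * nrm h')"
      proof -
        have "s * (nrm h' - nrm h) \<le> t * (nrm h' - nrm h)" using st h'(4) by (intro mult_right_mono) auto
        then have "b powr (- s * nrm h + - t * (nrm h' - nrm h)) \<le> b powr (- s * nrm h')"
          using b_gt_1 by (intro powr_mono) (auto simp: algebra_simps)
        from mult_left_mono[OF this \<kappa>(1)] show ?thesis by (simp only: powr_add mult.assoc)
      qed
      with h'(6) have "mass h' \<le> ennreal (\<kappa> * b powr (- s * nrm h'))"
        by (meson ennreal_leI order_trans)
      from descend_step[OF br h'(1) \<kappa> this]
      obtain h'' where h'': "link h' h''" "nrm h'' \<le> nrm h' + N" "mass h'' \<le> ennreal (b powr (- t * N)) * mass h'"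
        by (elim exE conjE)
      have G'': "h'' \<in> G" "nrm h' + 1 \<le> nrm h''" using h''(1) Q_tau by (auto simp: link_def)
      have desc: "desc h h''" using h'(2) h''(1) by (auto intro: tranclp.trancl_into_trancl)
      have "mass h'' \<le> ennreal (b powr (- t * N)) * ennreal (\<kappa> * b powr (- s * nrm h) * b powr (- t * (nrm h' - nrm h)))"
        using h''(3) mult_left_mono[OF h'(6), of "ennreal (b powr (- t * N))"] by (meson order_trans zero_le)
      also have "\<dots> = ennreal (\<kappa> * b powr (- s * nrm h) * b powr (- t * (nrm h' + N - nrm h)))"
        using \<kappa>(1) by (simp add: ennreal_mult[symmetric] powr_add[symmetric] algebra_simps)
      also have "\<dots> \<le> ennreal (\<kappa> * b powr (- s * nrm h) * b powr (- t * (nrm h'' - nrm h)))"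
      proof (rule ennreal_leI, rule mult_left_mono, rule powr_mono)
        have "t * (nrm h'' - nrm h) \<le> t * (nrm h' + N - nrm h)"
          using h''(2) s_pos st by (intro mult_left_mono) auto
        then show "- t * (nrm h' + N - nrm h) \<le> - t * (nrm h'' - nrm h)" by simp
      qed (use \<kappa> b_gt_1 in auto)
      finally have m'': "mass h'' \<le> ennreal (\<kappa> * b powr (- s * nrm h) * b powr (- t * (nrm h'' - nrm h)))" .
      have "nrm h + real (Suc k) \<le> nrm h''" "nrm h \<le> nrm h''" "nrm h'' \<le> max T (nrm h) + N"
        using False h' h''(2) G''(2) by auto
      then show ?thesis using G''(1) desc m'' by blast
    qed
  qed
  moreover obtain k :: nat where "T - nrm h \<le> k" using real_arch_simple by blast
  ultimately obtain h' where "h' \<in> G" "h' = h \<or> desc h h'" "T \<le> nrm h' \<or> nrm h + real k \<le> nrm h'"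
      "nrm h' \<le> max T (nrm h) + N"
      "mass h' \<le> ennreal (\<kappa> * b powr (- s * nrm h) * b powr (- t * (nrm h' - nrm h)))"
    by blast
  then show ?thesis using \<open>T - nrm h \<le> k\<close> by (intro bexI[of _ h']) auto
qed

text \<open>Vitali-type covering argument: a family of shadows carrying too much mass is covered, up to a
  constant, by the sets of the cover that are large for one of these shadows, and by a subfamily of
  shadows that hit disjoint parts of the cover.\<close>

lemma content_heavy_shadows:
  assumes fin: "mass h < \<infinity>" and B: "\<forall>u\<in>B. link h u"
    and heavy: "\<forall>u\<in>B. ennreal (\<kappa> * b powr (- s * nrm u)) < mass u"
    and \<kappa>: "0 < \<kappa>" and \<rho>: "\<tau> \<le> \<rho>" and S: "S \<subseteq> (\<Union>u\<in>B. wide_shadow \<rho> u)"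
  shows "hausdorff_content bdry D s S
    \<le> ennreal ((3 * b powr (kv + \<rho> + E) + 2) powr s * (1 + 1 / \<kappa>)) * mass h"
proof -
  define k where "k = b powr (kv + \<rho> + E)"
  \<comment> \<open>Points of \<open>Y v\<close> are joined through two errors \<open>k + 1\<close>
    and one shadow of diameter \<open>k\<close>; for \<open>X A\<close> already
    \<open>2 * k + 1\<close> would do.\<close>
  define L where "L = 3 * k + 2"
  have k: "0 < k" "0 < L" using b_gt_1 by (auto simp: k_def L_def add_pos_pos)
  have diam: "D x y \<le> k * b powr (- nrm u)" if "x \<in> wide_shadow \<rho> u" "y \<in> wide_shadow \<rho> u" for x y u
  proof -
    have "k * b powr (- nrm u) = b powr (kv + \<rho> + E - nrm u)"
      unfolding k_def by (subst powr_add[symmetric]) simp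
    then show ?thesis using wide_shadow_diam[OF that] by simp
  qed
  have sub: "shadow u \<subseteq> wide_shadow \<rho> u" for u by (rule wide_shadow_mono[OF \<rho>])
  have BG: "B \<subseteq> G" using B by (auto simp: link_def)
  have hitB: "hit u \<subseteq> hit h" if "u \<in> B" for u using B that by (intro hit_desc) auto
  \<comment> \<open>Nodes that hit only sets of diameter at most \<open>b powr (- nrm u)\<close>,
    the scale of their shadow. Vitali selection applies to these.\<close>
  define B2 where "B2 = {u \<in> B. \<forall>A\<in>hit u. a A \<le> ennreal ((b powr (- nrm u)) powr s)}"
  have "B2 \<subseteq> B" by (auto simp: B2_def)
  have hit_ne: "hit u \<noteq> {}" if "u \<in> B2" for u
  proof
    assume "hit u = {}"
    then have "mass u = 0" by (simp add: mass_def)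
    moreover have "u \<in> B" using that \<open>B2 \<subseteq> B\<close> by blast
    ultimately show False using heavy[rule_format, of u] by simp
  qed
  have "countable B2" using BG \<open>B2 \<subseteq> B\<close> countable_G countable_subset by (metis subset_trans)
  moreover have "finite {u \<in> B2. nrm u \<le> r}" for r
    using BG \<open>B2 \<subseteq> B\<close> by (intro finite_subset[OF _ finite_ball_G[of r]]) auto
  ultimately obtain V where V: "V \<subseteq> B2" "disjoint_family_on hit V"
    and V_cover: "\<forall>u\<in>B2. \<exists>v\<in>V. nrm v \<le> nrm u \<and> hit u \<inter> hit v \<noteq> {}"
    using hit_ne greedy_disjoint_selection[of B2 nrm hit] by auto
  \<comment> \<open>Shadows in \<open>X A\<close> meet \<open>A\<close> and have scale below the
    diameter corresponding to its weight. Those in \<open>Y v\<close> have at most the scale of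
    \<open>v\<close> and reach its shadow through a common set of the cover.\<close>
  define X where "X A = (\<Union>u\<in>{u \<in> B. A \<in> hit u \<and> ennreal ((b powr (- nrm u)) powr s) < a A}. wide_shadow \<rho> u)" for A
  define Y where "Y v = (\<Union>u\<in>{u \<in> B2. nrm v \<le> nrm u \<and> hit u \<inter> hit v \<noteq> {}}. wide_shadow \<rho> u)" for v
  have S_cover: "S \<subseteq> (\<Union>i\<in>Inl ` hit h \<union> Inr ` V. case_sum X Y i)"
  proof
    fix x assume "x \<in> S"
    then obtain u where u: "u \<in> B" "x \<in> wide_shadow \<rho> u" using S by blast
    show "x \<in> (\<Union>i\<in>Inl ` hit h \<union> Inr ` V. case_sum X Y i)"
    proof (cases "u \<in> B2")
      case True
      then obtain v where v: "v \<in> V" "nrm v \<le> nrm u" "hit u \<inter> hit v \<noteq> {}" using V_cover by blast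
      have "x \<in> Y v" unfolding Y_def using True v(2,3) u(2) by blast
      then show ?thesis using v(1) by auto
    next
      case False
      then obtain A where A: "A \<in> hit u" "ennreal ((b powr (- nrm u)) powr s) < a A"
        using u(1) by (auto simp: B2_def not_le)
      have "x \<in> X A" unfolding X_def using u A by blast
      moreover have "A \<in> hit h" using A(1) hitB[OF u(1)] by blast
      ultimately show ?thesis by auto
    qed
  qed
  have X_diam: "ediam_powr D s (X A) \<le> ennreal (L powr s) * a A" if A: "A \<in> hit h" for A
  proof -
    have "a A < \<infinity>" using le_mass[OF A] fin by simp
    then obtain r where r: "0 \<le> r" "a A = ennreal r" by (cases "a A") auto
    define q where "q = r powr (1 / s)"
    have q: "0 \<le> q" "q powr s = r" using r s_pos by (auto simp: q_def powr_powr)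
    have AC: "A \<in> \<C>" using A by (simp add: hit_def)
    have pick: "\<exists>z\<in>A. z \<in> bdry \<and> x \<in> bdry \<and> D x z \<le> k * q" if "x \<in> X A" for x
    proof -
      obtain u where u: "u \<in> B" "A \<in> hit u" "ennreal ((b powr (- nrm u)) powr s) < a A" "x \<in> wide_shadow \<rho> u"
        using \<open>x \<in> X A\<close> by (auto simp: X_def)
      obtain z where z: "z \<in> A" "z \<in> shadow u" using u(2) by (auto simp: hit_def)
      have "(b powr (- nrm u)) powr s < q powr s" using u(3) r q by (simp add: ennreal_less_iff)
      then have "\<not> q < b powr (- nrm u)" using s_pos q(1) powr_less_mono2[of s q "b powr (- nrm u)"] by auto
      then have "b powr (- nrm u) \<le> q" by simp
      have "D x z \<le> k * b powr (- nrm u)" using u(4) z(2) sub by (intro diam) auto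
      also have "\<dots> \<le> k * q" using \<open>b powr (- nrm u) \<le> q\<close> k by (intro mult_left_mono) auto
      finally have "D x z \<le> k * q" .
      moreover have "z \<in> bdry" "x \<in> bdry" using z(2) u(4) wide_shadow_boundary by blast+
      ultimately show ?thesis using z(1) by blast
    qed
    have "ediam_powr D s (X A) \<le> ennreal ((L * q) powr s)"
    proof (rule ediam_powr_le[OF s_pos])
      show "0 \<le> L * q" using k q by simp
      fix x y assume "x \<in> X A" "y \<in> X A"
      then obtain z w where zw: "z \<in> A" "z \<in> bdry" "x \<in> bdry" "D x z \<le> k * q"
          "w \<in> A" "w \<in> bdry" "y \<in> bdry" "D y w \<le> k * q"
        using pick[of x] pick[of y] by blast
      have "D z w \<le> q" using AC zw q r by (intro weight_realD[of A]) auto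
      moreover have "D x y \<le> D x z + D z w + D y w"
        using D_triangle[of x z y] D_triangle[of z w y] zw D_commute[of y w] by simp
      moreover have "L * q = k * q + k * q + k * q + 2 * q" by (simp add: L_def algebra_simps)
      moreover have "0 \<le> k * q" using k q by simp
      ultimately show "D x y \<le> L * q" using zw q(1) by linarith
    qed
    also have "(L * q) powr s = L powr s * r" using k q by (simp add: powr_mult)
    also have "ennreal (L powr s * r) = ennreal (L powr s) * a A" using r by (simp add: ennreal_mult)
    finally show ?thesis .
  qed
  have Y_diam: "ediam_powr D s (Y v) \<le> ennreal (L powr s / \<kappa>) * mass v" if v: "v \<in> V" for v
  proof -
    define q where "q = b powr (- nrm v)"
    have q: "0 < q" using b_gt_1 by (simp add: q_def)
    have vB: "v \<in> B2" "v \<in> B" using v V(1) \<open>B2 \<subseteq> B\<close> by auto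
    have pick: "\<exists>z\<in>shadow v. x \<in> bdry \<and> D x z \<le> (k + 1) * q" if "x \<in> Y v" for x
    proof -
      obtain u where u: "u \<in> B2" "nrm v \<le> nrm u" "hit u \<inter> hit v \<noteq> {}" "x \<in> wide_shadow \<rho> u"
        using \<open>x \<in> Y v\<close> by (auto simp: Y_def)
      then obtain A z z' where A: "A \<in> \<C>" "A \<in> hit v" "z \<in> A" "z \<in> shadow u" "z' \<in> A" "z' \<in> shadow v"
        by (auto simp: hit_def)
      have bd: "x \<in> bdry" "z \<in> bdry" "z' \<in> bdry" using u(4) A wide_shadow_boundary by blast+
      have "D x z \<le> k * b powr (- nrm u)" using u(4) A(4) sub by (intro diam) auto
      also have "\<dots> \<le> k * q" unfolding q_def using u(2) k b_gt_1 by (intro mult_left_mono powr_mono) auto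
      finally have "D x z \<le> k * q" .
      moreover have "D z z' \<le> q"
        using A vB(1) q unfolding q_def B2_def by (intro weight_realD[of A]) auto
      ultimately have "D x z' \<le> (k + 1) * q"
        using D_triangle[OF bd] by (simp add: algebra_simps)
      then show ?thesis using bd A(6) by blast
    qed
    have "ediam_powr D s (Y v) \<le> ennreal ((L * q) powr s)"
    proof (rule ediam_powr_le[OF s_pos])
      show "0 \<le> L * q" using k q by simp
      fix x y assume "x \<in> Y v" "y \<in> Y v"
      then obtain z w where zw: "z \<in> shadow v" "x \<in> bdry" "D x z \<le> (k + 1) * q"
          "w \<in> shadow v" "y \<in> bdry" "D y w \<le> (k + 1) * q"
        using pick[of x] pick[of y] by blast
      have bd: "z \<in> bdry" "w \<in> bdry" using zw wide_shadow_boundary by blast+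
      have "D z w \<le> k * q" unfolding q_def using zw sub by (intro diam) auto
      moreover have "D x y \<le> D x z + D z w + D y w"
        using D_triangle[of x z y] D_triangle[of z w y] zw bd D_commute[of y w] by simp
      ultimately show "D x y \<le> L * q" using zw by (simp add: L_def algebra_simps)
    qed
    also have "(L * q) powr s = L powr s / \<kappa> * (\<kappa> * b powr (- s * nrm v))"
      using k \<kappa> by (simp add: q_def powr_mult powr_powr mult.commute)
    also have "ennreal \<dots> = ennreal (L powr s / \<kappa>) * ennreal (\<kappa> * b powr (- s * nrm v))"
      using \<kappa> by (intro ennreal_mult) auto
    \<comment> \<open>Heaviness of \<open>v\<close> trades the power of the diameter for mass;
      masses of disjoint hit families then add up to at most \<open>mass h\<close>.\<close>
    also have "\<dots> \<le> ennreal (L powr s / \<kappa>) * mass v"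
      using heavy vB(2) by (intro mult_left_mono) (auto intro: less_imp_le)
    finally show ?thesis .
  qed
  have "countable (Inl ` hit h \<union> Inr ` V)"
  proof -
    have "countable (hit h)" by (rule countable_subset[OF _ countable_C]) (auto simp: hit_def)
    moreover have "countable V" using V(1) \<open>countable B2\<close> countable_subset by blast
    ultimately show ?thesis by simp
  qed
  then have "hausdorff_content bdry D s S \<le> (\<Sum>\<^sub>\<infinity>i\<in>Inl ` hit h \<union> Inr ` V. ediam_powr D s (case_sum X Y i))"
  proof (rule hausdorff_content_le_cover[OF _ _ S_cover])
    show "case_sum X Y i \<subseteq> bdry" for i
      using wide_shadow_boundary by (cases i) (auto simp: X_def Y_def)
  qed
  also have "\<dots> \<le> (\<Sum>\<^sub>\<infinity>i\<in>Inl ` hit h. ediam_powr D s (case_sum X Y i)) + (\<Sum>\<^sub>\<infinity>i\<in>Inr ` V. ediam_powr D s (case_sum X Y i))"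
    by (rule infsum_ennreal_Un_le)
  also have "\<dots> \<le> (\<Sum>\<^sub>\<infinity>A\<in>hit h. ediam_powr D s (X A)) + (\<Sum>\<^sub>\<infinity>v\<in>V. ediam_powr D s (Y v))"
    using infsum_ennreal_image_le[of "\<lambda>i. ediam_powr D s (case_sum X Y i)" Inl "hit h"]
      infsum_ennreal_image_le[of "\<lambda>i. ediam_powr D s (case_sum X Y i)" Inr V]
    by (intro add_mono) simp_all
  also have "\<dots> \<le> ennreal (L powr s) * mass h + ennreal (L powr s / \<kappa>) * mass h"
  proof (rule add_mono)
    show "(\<Sum>\<^sub>\<infinity>A\<in>hit h. ediam_powr D s (X A)) \<le> ennreal (L powr s) * mass h"
      unfolding mass_def by (rule infsum_ennreal_cmult_le[OF X_diam])
    have "(\<Sum>\<^sub>\<infinity>v\<in>V. ediam_powr D s (Y v)) \<le> ennreal (L powr s / \<kappa>) * infsum mass V"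
      by (rule infsum_ennreal_cmult_le[OF Y_diam])
    also have "infsum mass V \<le> mass h"
      unfolding mass_def
    proof (rule infsum_disjoint_infsum_ennreal_le[OF V(2)])
      show "hit v \<subseteq> hit h" if "v \<in> V" for v using that V(1) \<open>B2 \<subseteq> B\<close> by (intro hitB) auto
    qed
    finally show "(\<Sum>\<^sub>\<infinity>v\<in>V. ediam_powr D s (Y v)) \<le> ennreal (L powr s / \<kappa>) * mass h"
      by (simp add: mult_left_mono)
  qed
  also have "\<dots> = ennreal (L powr s * (1 + 1 / \<kappa>)) * mass h"
    using \<kappa> by (simp add: distrib_right[symmetric] ennreal_plus[symmetric] ring_distribs del: ennreal_plus)
  finally show ?thesis by (simp add: L_def k_def)
qed

end

section \<open>The lower bound\<close>

lemma infsum_ennreal_add_le: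
  fixes f g :: "'i \<Rightarrow> ennreal"
  shows "infsum (\<lambda>i. f i + g i) A \<le> infsum f A + infsum g A"
  by (rule infsum_ennreal_leI) (simp add: sum.distrib add_mono sum_le_infsum_ennreal)

context visual_group
begin

text \<open>The constant \<open>C\<close> disappears after division by \<open>nrm g\<close>: for
  \<open>z < u\<close> it is enough that \<open>nrm g\<close> exceeds
  \<open>C / (u - z)\<close>.\<close>

lemma approx_exponent_geI:
  assumes "\<And>N. \<exists>g\<in>G. N < nrm g \<and> D (act g \<xi>) \<eta> \<le> b powr (C - u * nrm g)"
  shows "ereal u \<le> approx_exponent b x0 D G \<xi> \<eta>"
proof (rule ccontr)
  let ?F = "inf (filtercomap (\<lambda>g. nrm g) at_top) (principal G)"
  let ?q = "\<lambda>g. - elog b (ennreal (D (act g \<xi>) \<eta>)) / ereal (nrm g)"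
  assume "\<not> ?thesis"
  then have "Limsup ?F ?q < ereal u" by (simp add: approx_exponent_def)
  then obtain z where z: "Limsup ?F ?q < ereal z" "ereal z < ereal u" using ereal_dense2 by blast
  then have z': "z < u" by simp
  from z(1) have "\<forall>\<^sub>F g in ?F. ?q g < ereal z" by (rule Limsup_lessD)
  then obtain N where N: "\<And>g. N \<le> nrm g \<Longrightarrow> g \<in> G \<Longrightarrow> ?q g < ereal z"
    unfolding eventually_inf_principal eventually_filtercomap_at_top_linorder by blast
    obtain g where g: "g \<in> G" "max (max N 1) (C / (u - z)) < nrm g" "D (act g \<xi>) \<eta> \<le> b powr (C - u * nrm g)"
      using assms by blast
    then have n: "0 < nrm g" "N \<le> nrm g" by linarith+
    have "C < (u - z) * nrm g" using g(2) z' by (simp add: divide_less_eq mult.commute)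
    then have z_le: "z * nrm g \<le> u * nrm g - C" by (simp add: algebra_simps)
    have "ereal z \<le> ?q g"
    proof (cases "D (act g \<xi>) \<eta> = 0")
      case True
      then show ?thesis using n by (simp add: elog_def)
    next
      case False
      then have pos: "0 < D (act g \<xi>) \<eta>" using D_nonneg[of "act g \<xi>" \<eta>] by simp
      then have "log b (D (act g \<xi>) \<eta>) \<le> C - u * nrm g"
        using g(3) b_gt_1 by (simp add: log_le_iff)
      then have "z * nrm g \<le> - log b (D (act g \<xi>) \<eta>)" using z_le by simp
      then have le: "z \<le> - log b (D (act g \<xi>) \<eta>) / nrm g" unfolding pos_le_divide_eq[OF n(1)] .
      have "elog b (ennreal (D (act g \<xi>) \<eta>)) = ereal (log b (D (act g \<xi>) \<eta>))"
        using pos by (simp add: elog_def)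
      moreover have "ereal x / ereal (nrm g) = ereal (x / nrm g)" for x
        using n(1) by simp
      ultimately show ?thesis using le by (metis ereal_less_eq(3) uminus_ereal.simps(1))
    qed
    then show False using N[OF n(2) g(1)] by simp
qed

end

context turning_group
begin

text \<open>Here \<open>h\<close> is the current node, and \<open>f = h \<circ> j\<close> turns away from \<open>\<xi>\<close>, so that \<open>f \<xi>\<close> lies deep
  in the shadow of \<open>h\<close>. A radial ray from a point \<open>a\<close> close to \<open>\<xi>\<close> is carried by \<open>f\<close> to descendants
  of \<open>h\<close> whose shadows are close to \<open>f \<xi>\<close>.\<close>

lemma ray_step:
  assumes h: "h \<in> G" and j: "j \<in> J" and \<xi>: "\<xi> \<in> bdry" and a: "a \<in> rad \<sigma>"
    and turned: "\<not> ereal (2 * K) \<le> bp x0 \<xi> (pt (iv (h \<circ> j) x0))"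
    and m: "2 * K + 2 * E \<le> m" and \<xi>a: "ereal m \<le> bp x0 \<xi> a"
  shows "\<exists>g\<in>G. link h (h \<circ> j \<circ> g) \<and> act (h \<circ> j) a \<in> wide_shadow (\<sigma> + 1 + 4 * K + 4 * E) (h \<circ> j \<circ> g) \<and>
    (\<forall>\<eta>\<in>shadow (h \<circ> j \<circ> g). ereal (m + nrm (h \<circ> j) - 4 * K - 4 * E) \<le> bp x0 (act (h \<circ> j) \<xi>) \<eta>)"
proof -
  define f where "f = h \<circ> j"
  have jG: "j \<in> G" using j J_G by auto
  have f: "f \<in> G" using comp_G[OF h jG] by (simp add: f_def)
  define v where "v = iv f x0"
  have dv: "dist x0 v = nrm f" using nrm_inv[OF f] by (simp add: v_def)
  have turned': "\<not> ereal (2 * K) \<le> bp x0 \<xi> (pt v)" using turned by (simp add: v_def f_def)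
  have bd: "a \<in> bdry" by (rule radD(1)[OF a])
  have ne: "a \<noteq> {}" by (rule boundary_nonempty[OF bd])
  have fh: "dist (f x0) (h x0) \<le> K"
    using dist_isometry[OF h, of "j x0" x0] nrm_J[OF j] by (simp add: f_def dist_commute)
  then have nf: "nrm h - K \<le> nrm f" using dist_triangle[of x0 "h x0" "f x0"] by simp
  \<comment> \<open>Following the ray to depth \<open>M\<close> makes the new node long enough for
    \<open>link\<close> and its shadow finer than the accuracy claimed at the end.\<close>
  define M where "M = m + 7 * K + 5 * E + 2 * \<tau> + 1"
  have "m \<le> M" using K_nonneg E_nonneg Q_tau by (simp add: M_def)
  obtain g where g: "g \<in> G" "ereal M \<le> bp x0 a (pt (g x0))" "bp (g x0) a (pt x0) \<le> ereal \<sigma>"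
    using radD(2)[OF a] by blast
  have nM: "M \<le> nrm g" by (rule le_bp_ptD[OF g(2) ne])
  have "ereal m \<le> bp x0 a (pt (g x0))"
    using \<open>m \<le> M\<close> g(2) by (meson ereal_less_eq(3) order_trans)
  with \<xi>a have \<xi>g: "ereal (m - E) \<le> bp x0 \<xi> (pt (g x0))" using ne by (rule le_bp_trans)
  \<comment> \<open>\<xi> is turned away from \<open>v\<close> and has a large product with
    \<open>g x0\<close>, so \<open>g x0\<close> is turned away too; the same argument then applies
    to \<open>a\<close>.\<close>
  have gpg: "gp x0 (g x0) v \<le> 2 * K + E"
  proof (rule ccontr)
    assume "\<not> ?thesis"
    then have "ereal (2 * K + E) \<le> bp x0 (pt (g x0)) (pt v)" by (simp add: le_bp_pt_iff)
    moreover have "ereal (2 * K + E) \<le> ereal (m - E)" using m by simp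
    then have "ereal (2 * K + E) \<le> bp x0 \<xi> (pt (g x0))" using \<xi>g by (rule order_trans)
    ultimately have "ereal (2 * K + E - E) \<le> bp x0 \<xi> (pt v)"
      using le_bp_trans[OF _ _ pt_nonempty] by blast
    then show False using turned' by simp
  qed
  have "\<not> ereal (2 * K + E) \<le> bp x0 a (pt v)"
  proof
    assume *: "ereal (2 * K + E) \<le> bp x0 a (pt v)"
    have "ereal (2 * K + E) \<le> ereal m" using m E_nonneg by simp
    then have "ereal (2 * K + E) \<le> bp x0 \<xi> a" using \<xi>a by (rule order_trans)
    then have "ereal (2 * K + E - E) \<le> bp x0 \<xi> (pt v)" using * ne by (rule le_bp_trans)
    then show False using turned' by simp
  qed
  then have as_a: "asymp_le x0 v a (2 * K + E + E)" by (rule asymp_le_boundary[OF bd])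
  have as_\<xi>: "asymp_le x0 v \<xi> (2 * K + E)" by (rule asymp_le_boundary[OF \<xi> turned'])
  have as_g: "asymp_le x0 v (pt (g x0)) (2 * K + E)" by (rule asymp_le_pt[OF gpg])
  have gpg': "gp x0 v (g x0) \<le> 2 * K + E" using gpg by (simp add: gp_commute)
  have nfg: "nrm f + nrm g - 4 * K - 2 * E \<le> nrm (f \<circ> g)"
    using nrm_comp[OF f, of g] gpg' by (simp add: v_def)
  have "link h (f \<circ> g)"
    unfolding link_def
  proof (intro conjI h comp_G f g)
    \<comment> \<open>Origin of \<open>Q\<close>: the turn costs \<open>2 * K + E\<close>, replacing
      \<open>f x0\<close> by \<open>h x0\<close> costs \<open>K\<close>, and replacing
      \<open>nrm f\<close> by \<open>nrm h\<close> another \<open>K\<close>.\<close>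
    have "nrm f - 2 * K - E \<le> gp x0 (f x0) (f (g x0))"
      using gp_comp[OF f, of g] gpg' by (simp add: v_def)
    moreover have "gp x0 (f x0) (f (g x0)) - K \<le> gp x0 (h x0) (f (g x0))"
      using gp_lipschitz[of x0 "f x0" "f (g x0)" "h x0"] fh by simp
    ultimately show "nrm h - Q \<le> gp x0 (h x0) ((f \<circ> g) x0)" using nf by (simp add: Q_def)
    show "nrm h + \<tau> + 1 \<le> nrm (f \<circ> g)"
      using nfg nf nM m K_nonneg E_nonneg Q_tau by (simp add: M_def)
  qed
  moreover have "act f a \<in> wide_shadow (\<sigma> + 1 + 4 * K + 4 * E) (f \<circ> g)"
  proof -
    have "\<not> ereal (\<sigma> + 1) \<le> bp (g x0) a (pt x0)"
    proof
      assume "ereal (\<sigma> + 1) \<le> bp (g x0) a (pt x0)"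
      then have "ereal (\<sigma> + 1) \<le> ereal \<sigma>" using g(3) by (rule order_trans)
      then show False by simp
    qed
    then have "asymp_le (g x0) x0 a (\<sigma> + 1 + E)" by (rule asymp_le_boundary[OF bd])
    then have "ereal (nrm g - (\<sigma> + 1 + E)) \<le> bp x0 a (pt (g x0))"
      using asymp_le_sum[of "g x0" x0 a "\<sigma> + 1 + E"] by (simp add: dist_commute)
    from le_bp_change_base[OF this as_a as_g]
    have "ereal (nrm g - (\<sigma> + 1 + E) + nrm f - (2 * K + E + E) - (2 * K + E)) \<le> bp x0 (act f a) (pt ((f \<circ> g) x0))"
      using bp_act[OF f, of a "pt (g x0)"] dv by (simp add: boundary_action_pt v_def)
    moreover have "ereal (nrm (f \<circ> g) - (\<sigma> + 1 + 4 * K + 4 * E))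
        \<le> ereal (nrm g - (\<sigma> + 1 + E) + nrm f - (2 * K + E + E) - (2 * K + E))"
      using nrm_comp_le[OF f, of g] by simp
    ultimately show ?thesis
      using act_boundary[OF f bd] unfolding wide_shadow_def by (blast intro: order_trans)
  qed
  moreover have "ereal (m + nrm f - 4 * K - 4 * E) \<le> bp x0 (act f \<xi>) \<eta>" if \<eta>: "\<eta> \<in> shadow (f \<circ> g)" for \<eta>
  proof -
    from le_bp_change_base[OF \<xi>g as_\<xi> as_g]
    have 1: "ereal (m - E + nrm f - (2 * K + E) - (2 * K + E)) \<le> bp x0 (act f \<xi>) (pt ((f \<circ> g) x0))"
      using bp_act[OF f, of \<xi> "pt (g x0)"] dv by (simp add: boundary_action_pt v_def)
    have "ereal (m - E + nrm f - (2 * K + E) - (2 * K + E)) \<le> ereal (nrm (f \<circ> g) - \<tau>)"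
      using nfg nM K_nonneg E_nonneg Q_tau by (simp add: M_def)
    also have "\<dots> \<le> bp x0 (pt ((f \<circ> g) x0)) \<eta>" using \<eta> by (simp add: wide_shadow_def bp_commute)
    finally have 2: "ereal (m - E + nrm f - (2 * K + E) - (2 * K + E)) \<le> bp x0 (pt ((f \<circ> g) x0)) \<eta>" .
    have "ereal (m - E + nrm f - (2 * K + E) - (2 * K + E) - E) \<le> bp x0 (act f \<xi>) \<eta>"
      using 1 2 pt_nonempty by (rule le_bp_trans)
    then show ?thesis by (simp add: algebra_simps)
  qed
  ultimately show ?thesis using g(1) unfolding f_def by blast
qed

end

context weighted_cover
begin

text \<open>If every node reached along rays from the ball were too heavy,
  \<open>content_heavy_shadows\<close> would bound the content of the image of the ball by the small
  mass of \<open>h'\<close>. Pulling back by \<open>f\<close> would give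
  \<open>r powr p < C * b powr ((s - t) * nrm h')\<close>, impossible at great depth because
  \<open>s + c * p < t\<close>. The new node obeys the same mass bound, so the step can be
  iterated.\<close>

lemma approximation_step:
  assumes \<xi>: "\<xi> \<in> bdry" and br: "branching t N c0" and \<kappa>: "0 < \<kappa>" "\<kappa> \<le> c0 powr s" and st: "s \<le> t"
    and c: "0 < c" and p: "0 \<le> p" "s + c * p < t" and \<sigma>: "0 < \<sigma>"
    and freq: "\<forall>r0>0. \<exists>r. 0 < r \<and> r < r0 \<and> ennreal (r powr p) < local_content x0 D G \<xi> \<sigma> s r"
    and h: "h \<in> G" "mass h \<le> ennreal (\<kappa> * b powr (- s * nrm h))"
  shows "\<exists>u f. desc h u \<and> f \<in> G \<and> n \<le> nrm f \<and> mass u \<le> ennreal (\<kappa> * b powr (- s * nrm u)) \<and>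
    (\<forall>\<eta>\<in>shadow u. D (act f \<xi>) \<eta> \<le> b powr (2 * kv + 4 * K + 4 * E + c * (K + N) - (1 + c) * nrm f))"
proof -
  define \<rho> where "\<rho> = \<sigma> + 1 + 4 * K + 4 * E + \<tau>"
  define C2 where "C2 = (3 * b powr (kv + \<rho> + E) + 2) powr s * (1 + 1 / \<kappa>)"
  have "0 < 3 * b powr (kv + \<rho> + E) + 2" using b_gt_1 by (intro add_pos_pos) auto
  then have "0 < C2" unfolding C2_def using \<kappa>(1) by (intro mult_pos_pos add_pos_pos) auto
  \<comment> \<open>The Vitali constant, doubled for strictness, times the losses from
    \<open>D_act_le\<close> and from the starting node; all are known before \<open>r\<close> is
    chosen.\<close>
  define C where "C = 2 * C2 * \<kappa> * b powr (s * (2 * kv + K) + (t - s) * nrm h)"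
  have "0 < C" using \<open>0 < C2\<close> \<kappa>(1) b_gt_1 by (simp add: C_def)
  define \<epsilon> where "\<epsilon> = t - s - c * p"
  have "0 < \<epsilon>" using p by (simp add: \<epsilon>_def)
  \<comment> \<open>In this order: \<open>nrm h'\<close> is at most \<open>T + N\<close>,
    \<open>f\<close> has norm at least \<open>n\<close>, \<open>m\<close> is large enough for
    \<open>ray_step\<close>, and the final inequality fails.\<close>
  define T0 where "T0 = Max {nrm h, n + K, (kv + 2 * K + 2 * E) / c, log b C / \<epsilon>}"
  have T0: "nrm h \<le> T0" "n + K \<le> T0" "(kv + 2 * K + 2 * E) / c \<le> T0" "log b C / \<epsilon> \<le> T0"
    by (simp_all add: T0_def)
  have "0 < b powr (- c * T0)" using b_gt_1 by simp
  then obtain r where r: "0 < r" "r < b powr (- c * T0)" "ennreal (r powr p) < local_content x0 D G \<xi> \<sigma> s r"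
    using freq by blast
  define T where "T = - log b r / c"
  have rT: "r = b powr (- c * T)" using r(1) b_gt_1 c by (simp add: T_def)
  have "T0 < T"
  proof -
    have "- c * T < - c * T0" using r(2) b_gt_1 unfolding rT by simp
    then show ?thesis using c by simp
  qed
  obtain h' where h': "h' \<in> G" "h' = h \<or> desc h h'" "T \<le> nrm h'" "nrm h' \<le> max T (nrm h) + N"
    "mass h' \<le> ennreal (\<kappa> * b powr (- s * nrm h) * b powr (- t * (nrm h' - nrm h)))"
    using descend[OF br h(1) less_imp_le[OF \<kappa>(1)] \<kappa>(2) st h(2), of T] by (elim bexE conjE)
  have h'T: "nrm h' \<le> T + N" using h'(4) \<open>T0 < T\<close> T0(1) by simp
  obtain j where j: "j \<in> J" "\<not> ereal K \<le> bp x0 (act j \<xi>) (pt (iv h' x0))"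
    using turn_boundary[OF \<xi>] by blast
  have jG: "j \<in> G" using j(1) J_G by auto
  define f where "f = h' \<circ> j"
  have f: "f \<in> G" using comp_G[OF h'(1) jG] by (simp add: f_def)
  have "dist (h' x0) (f x0) \<le> K"
    using dist_isometry[OF h'(1), of x0 "j x0"] nrm_J[OF j(1)] by (simp add: f_def)
  then have nf: "nrm f \<le> nrm h' + K" "nrm h' - K \<le> nrm f"
    using dist_triangle[of x0 "f x0" "h' x0"] dist_triangle[of x0 "h' x0" "f x0"] by (auto simp: dist_commute)
  \<comment> \<open>\<open>turn_boundary\<close> compares \<open>act j \<xi>\<close> with
    \<open>iv h' x0\<close>; moving both back by \<open>j\<close> costs \<open>nrm j\<close>, hence
    \<open>2 * K\<close> in place of \<open>K\<close>.\<close>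
  have turned: "\<not> ereal (2 * K) \<le> bp x0 \<xi> (pt (iv (h' \<circ> j) x0))"
  proof
    assume *: "ereal (2 * K) \<le> bp x0 \<xi> (pt (iv (h' \<circ> j) x0))"
    have "h' (j (iv f x0)) = x0" using isometry_groupD(3)[OF carrier_G[OF f], of x0] by (simp add: f_def)
    then have "j (iv f x0) = iv h' x0"
      using isometry_groupD(4)[OF carrier_G[OF h'(1)]] by metis
    then have "ereal (2 * K - nrm j) \<le> bp x0 (act j \<xi>) (pt (iv h' x0))"
      using le_bp_act[OF jG *] by (simp add: boundary_action_pt f_def)
    moreover have "ereal K \<le> ereal (2 * K - nrm j)" using nrm_J[OF j(1)] by simp
    ultimately show False using j(2) by (meson order_trans)
  qed
  define m where "m = c * T - kv"
  have m: "2 * K + 2 * E \<le> m"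
  proof -
    have "(kv + 2 * K + 2 * E) / c \<le> T" using T0(3) \<open>T0 < T\<close> by simp
    then have "kv + 2 * K + 2 * E \<le> c * T" using c by (simp add: divide_le_eq mult.commute)
    then show ?thesis by (simp add: m_def)
  qed
  define F where "F = Metric_space.mcball bdry D \<xi> r \<inter> rad \<sigma>"
  have Fbd: "F \<subseteq> bdry" using rad_boundary by (auto simp: F_def)
  have \<xi>F: "ereal m \<le> bp x0 \<xi> a" if "a \<in> F" for a
  proof -
    have "D \<xi> a \<le> b powr - (m + kv)"
      using that by (simp add: F_def Metric_space.in_mcball[OF metric] m_def rT)
    then show ?thesis using that Fbd \<xi> by (intro bp_of_D_le) auto
  qed
  have ray: "\<exists>g\<in>G. link h' (f \<circ> g) \<and> act f a \<in> wide_shadow \<rho> (f \<circ> g) \<and>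
    (\<forall>\<eta>\<in>shadow (f \<circ> g). ereal (m + nrm f - 4 * K - 4 * E) \<le> bp x0 (act f \<xi>) \<eta>)" if "a \<in> F" for a
  proof -
    have "a \<in> rad \<sigma>" using that by (simp add: F_def)
    from ray_step[OF h'(1) j(1) \<xi> this turned m \<xi>F[OF that]]
    obtain g where g: "g \<in> G" "link h' (f \<circ> g)" "act f a \<in> wide_shadow (\<sigma> + 1 + 4 * K + 4 * E) (f \<circ> g)"
      "\<forall>\<eta>\<in>shadow (f \<circ> g). ereal (m + nrm f - 4 * K - 4 * E) \<le> bp x0 (act f \<xi>) \<eta>"
      unfolding f_def by (elim bexE conjE)
    have "act f a \<in> wide_shadow \<rho> (f \<circ> g)"
      using wide_shadow_mono[of "\<sigma> + 1 + 4 * K + 4 * E" \<rho>] g(3) Q_tau by (auto simp: \<rho>_def)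
    then show ?thesis using g by blast
  qed
  have "\<exists>g\<in>G. link h' (f \<circ> g) \<and> mass (f \<circ> g) \<le> ennreal (\<kappa> * b powr (- s * nrm (f \<circ> g))) \<and>
    (\<forall>\<eta>\<in>shadow (f \<circ> g). ereal (m + nrm f - 4 * K - 4 * E) \<le> bp x0 (act f \<xi>) \<eta>)"
  proof (rule ccontr)
    assume none: "\<not> ?thesis"
    define B where "B = {u. link h' u \<and> ennreal (\<kappa> * b powr (- s * nrm u)) < mass u}"
    have cover: "act f ` F \<subseteq> (\<Union>u\<in>B. wide_shadow \<rho> u)"
    proof
      fix x assume "x \<in> act f ` F"
      then obtain a where a: "a \<in> F" "x = act f a" by blast
      from ray[OF a(1)] obtain g where g: "g \<in> G" "link h' (f \<circ> g)" "act f a \<in> wide_shadow \<rho> (f \<circ> g)"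
        "\<forall>\<eta>\<in>shadow (f \<circ> g). ereal (m + nrm f - 4 * K - 4 * E) \<le> bp x0 (act f \<xi>) \<eta>"
        by (elim bexE conjE)
      have "\<not> mass (f \<circ> g) \<le> ennreal (\<kappa> * b powr (- s * nrm (f \<circ> g)))" using none g by blast
      then have "f \<circ> g \<in> B" using g(2) unfolding B_def by (simp only: mem_Collect_eq not_le simp_thms)
      then show "x \<in> (\<Union>u\<in>B. wide_shadow \<rho> u)" using g(3) a(2) by blast
    qed
    define \<mu> where "\<mu> = \<kappa> * b powr (- s * nrm h) * b powr (- t * (nrm h' - nrm h))"
    have "0 < \<mu>" using \<kappa>(1) b_gt_1 by (simp add: \<mu>_def)
    have mass_h': "mass h' \<le> ennreal \<mu>" using h'(5) by (simp add: \<mu>_def)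
    have "mass h' < \<infinity>" using mass_h' by (simp add: order_le_less_trans)
    then have "hausdorff_content bdry D s (act f ` F) \<le> ennreal C2 * mass h'"
      unfolding C2_def using cover \<sigma> Q_tau K_nonneg E_nonneg
      by (intro content_heavy_shadows[OF _ _ _ \<kappa>(1)]) (auto simp: B_def \<rho>_def)
    also have "\<dots> \<le> ennreal C2 * ennreal \<mu>" by (rule mult_left_mono[OF mass_h']) simp
    also have "\<dots> = ennreal (C2 * \<mu>)" using \<open>0 < C2\<close> \<open>0 < \<mu>\<close> by (simp add: ennreal_mult)
    also have "\<dots> < ennreal (2 * C2 * \<mu>)" using \<open>0 < C2\<close> \<open>0 < \<mu>\<close> by (simp add: ennreal_less_iff)
    finally have cf: "hausdorff_content bdry D s (act f ` F) < ennreal (2 * C2 * \<mu>)" .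
    define L where "L = b powr (2 * kv + nrm f)"
    have "0 < L" using b_gt_1 by (simp add: L_def)
    have F_eq: "act (iv f) ` (act f ` F) = F" unfolding image_image using act_inv[OF f] by simp
    have "hausdorff_content bdry D s (act (iv f) ` (act f ` F)) \<le> ennreal (L powr s) * ennreal (2 * C2 * \<mu>)"
    proof (rule hausdorff_content_Lipschitz_image[OF s_pos \<open>0 < L\<close> _ _ D_nonneg cf])
      show "act (iv f) ` (act f ` F) \<subseteq> bdry" using Fbd F_eq by simp
      show "D (act (iv f) x) (act (iv f) y) \<le> L * D x y" if "x \<in> act f ` F" "y \<in> act f ` F" for x y
      proof -
        have "x \<in> bdry" "y \<in> bdry" using that Fbd act_boundary[OF f] by auto
        then show ?thesis using D_act_le[OF inv_G[OF f]] nrm_inv[OF f] by (simp add: L_def)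
      qed
    qed
    then have "hausdorff_content bdry D s F \<le> ennreal (L powr s * (2 * C2 * \<mu>))"
      using F_eq \<open>0 < C2\<close> \<open>0 < \<mu>\<close> by (simp add: ennreal_mult)
    then have "ennreal (r powr p) < ennreal (L powr s * (2 * C2 * \<mu>))"
      using r(3) unfolding local_content_def F_def by (rule less_le_trans[rotated])
    then have "r powr p < L powr s * (2 * C2 * \<mu>)" by (simp add: ennreal_less_iff)
    also have "\<dots> = 2 * C2 * \<kappa> * b powr (s * (2 * kv + nrm f) + (- s * nrm h) + (- t * (nrm h' - nrm h)))"
    proof -
      have "L powr s = b powr (s * (2 * kv + nrm f))" unfolding L_def powr_powr by (simp only: mult.commute)
      then show ?thesis unfolding \<mu>_def powr_add[of b "_ + _"] powr_add[of b "s * _"] by simp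
    qed
    also have "\<dots> \<le> 2 * C2 * \<kappa> * b powr (s * (2 * kv + K) + (t - s) * nrm h + (s - t) * nrm h')"
    proof (rule mult_left_mono, rule powr_mono)
      have "s * nrm f \<le> s * (nrm h' + K)" using nf(1) s_pos by (intro mult_left_mono) auto
      then show "s * (2 * kv + nrm f) + (- s * nrm h) + (- t * (nrm h' - nrm h))
          \<le> s * (2 * kv + K) + (t - s) * nrm h + (s - t) * nrm h'"
        by (simp add: algebra_simps)
    qed (use b_gt_1 \<open>0 < C2\<close> \<kappa> in auto)
    also have "\<dots> = C * b powr ((s - t) * nrm h')" by (simp add: C_def powr_add)
    finally have rp: "r powr p < C * b powr ((s - t) * nrm h')" .
    have "r powr p = b powr (- (c * T) * p)" by (simp add: rT powr_powr)
    moreover have "- (c * nrm h') * p \<le> - (c * T) * p"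
      using c p h'(3) by (simp add: mult_left_mono mult_right_mono)
    ultimately have "b powr (- (c * nrm h') * p) \<le> r powr p" using b_gt_1 by simp
    then have "b powr (- (c * nrm h') * p) < C * b powr ((s - t) * nrm h')" using rp by simp
    then have "b powr (- (c * nrm h') * p) * b powr ((t - s) * nrm h') < C * b powr ((s - t) * nrm h') * b powr ((t - s) * nrm h')"
      using b_gt_1 by (intro mult_strict_right_mono) auto
    also have "\<dots> = C" using b_gt_1 by (simp add: mult.assoc powr_add[symmetric] algebra_simps)
    also have "b powr (- (c * nrm h') * p) * b powr ((t - s) * nrm h') = b powr (\<epsilon> * nrm h')"
      by (simp add: powr_add[symmetric] \<epsilon>_def algebra_simps)
    finally have "\<epsilon> * nrm h' < log b C" using \<open>0 < C\<close> b_gt_1 by (simp add: less_log_iff)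
    moreover have "log b C / \<epsilon> \<le> nrm h'" using T0(4) \<open>T0 < T\<close> h'(3) by simp
    ultimately show False using \<open>0 < \<epsilon>\<close> by (simp add: divide_le_eq mult.commute)
  qed
  then obtain g where g: "g \<in> G" "link h' (f \<circ> g)" "mass (f \<circ> g) \<le> ennreal (\<kappa> * b powr (- s * nrm (f \<circ> g)))"
    "\<forall>\<eta>\<in>shadow (f \<circ> g). ereal (m + nrm f - 4 * K - 4 * E) \<le> bp x0 (act f \<xi>) \<eta>"
    by (elim bexE conjE)
  have "desc h (f \<circ> g)"
    using h'(2) g(2) by (auto intro: tranclp.trancl_into_trancl simp del: o_apply)
  moreover have "n \<le> nrm f" using nf(2) h'(3) T0(2) \<open>T0 < T\<close> by simp
  moreover have "D (act f \<xi>) \<eta> \<le> b powr (2 * kv + 4 * K + 4 * E + c * (K + N) - (1 + c) * nrm f)"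
    if \<eta>: "\<eta> \<in> shadow (f \<circ> g)" for \<eta>
  proof -
    have "D (act f \<xi>) \<eta> \<le> b powr (kv - (m + nrm f - 4 * K - 4 * E))"
      using g(4) \<eta> wide_shadow_boundary act_boundary[OF f \<xi>] by (intro D_le_of_bp) auto
    also have "\<dots> \<le> b powr (2 * kv + 4 * K + 4 * E + c * (K + N) - (1 + c) * nrm f)"
    proof (rule powr_mono)
      \<comment> \<open>\<open>nrm f\<close> overshoots \<open>T\<close> by at most
        \<open>K + N\<close>, which explains the term \<open>c * (K + N)\<close>.\<close>
      have "c * (nrm f - K - N) \<le> c * T" using nf(1) h'T c by (intro mult_left_mono) auto
      then show "kv - (m + nrm f - 4 * K - 4 * E) \<le> 2 * kv + 4 * K + 4 * E + c * (K + N) - (1 + c) * nrm f"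
        by (simp add: m_def algebra_simps)
    qed (use b_gt_1 in auto)
    finally show ?thesis .
  qed
  ultimately show ?thesis using f g(3) by blast
qed

end

text \<open>A set of the cover containing the limit point would be hit by every node of the path,
  while the masses of these nodes tend to 0.\<close>

lemma (in turning_group) content_well_approximable_nonzero:
  assumes \<xi>: "\<xi> \<in> bdry" and s: "0 < s" and c: "0 < c" and p: "0 \<le> p" "s + c * p < t"
    and t: "ereal t < poincare_exponent b x0 G" and \<sigma>: "0 < \<sigma>"
    and freq: "\<forall>r0>0. \<exists>r. 0 < r \<and> r < r0 \<and> ennreal (r powr p) < local_content x0 D G \<xi> \<sigma> s r"
  shows "hausdorff_content bdry D s (well_approximable_set b x0 D G c \<xi>) \<noteq> 0"
proof
  let ?W = "well_approximable_set b x0 D G c \<xi>"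
  assume zero: "hausdorff_content bdry D s ?W = 0"
  have "0 \<le> c * p" using c p by simp
  then have st: "s \<le> t" "0 \<le> t" using p s by auto
  obtain N c0 where br: "branching t N c0"
    using branching_exists[OF st(2) t] by (elim exE)
  define \<kappa> where "\<kappa> = c0 powr s"
  have \<kappa>: "0 < \<kappa>" "\<kappa> \<le> c0 powr s" using br by (auto simp: \<kappa>_def branching_def)
  have "hausdorff_content bdry D s ?W < ennreal (\<kappa> / 2)" using zero \<kappa> by simp
  then obtain \<C> where \<C>: "countable \<C>" "\<C> \<subseteq> Pow bdry" "?W \<subseteq> \<Union>\<C>" "(\<Sum>\<^sub>\<infinity>A\<in>\<C>. ediam_powr D s A) < ennreal (\<kappa> / 2)"
    by (rule hausdorff_content_less_cover)
  have "0 < \<kappa> / 2" using \<kappa> by simp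
  obtain w :: "_ \<Rightarrow> real" where w: "\<forall>A. 0 < w A" "infsum (\<lambda>A. ennreal (w A)) \<C> \<le> ennreal (\<kappa> / 2)"
    by (rule ennreal_geometric_weights[OF \<C>(1) \<open>0 < \<kappa> / 2\<close>]) blast
  \<comment> \<open>Without the positive summand, a set of diameter 0, such as the singleton of the
    limit point, would have no weight and could not be excluded.\<close>
  define a where "a A = ediam_powr D s A + ennreal (w A)" for A
  interpret weighted_cover x0 E b Cv D G J K \<C> a s
  proof unfold_locales
    fix A x y assume "A \<in> \<C>" "x \<in> A" "y \<in> A"
    then have "ennreal (D x y powr s) \<le> ediam_powr D s A" using s D_nonneg by (intro le_ediam_powr) auto
    then show "ennreal (D x y powr s) \<le> a A" unfolding a_def by (rule add_increasing2[OF zero_le])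
  qed (use s \<C> in auto)
  have "mass id \<le> infsum a \<C>"
    unfolding mass_def by (rule infsum_ennreal_mono2) (auto simp: hit_def)
  also have "\<dots> \<le> (\<Sum>\<^sub>\<infinity>A\<in>\<C>. ediam_powr D s A) + infsum (\<lambda>A. ennreal (w A)) \<C>"
    unfolding a_def by (rule infsum_ennreal_add_le)
  also have "\<dots> \<le> ennreal (\<kappa> / 2) + ennreal (\<kappa> / 2)"
    using \<C>(4) w(2) by (intro add_mono) auto
  also have "\<dots> = ennreal \<kappa>" using \<kappa> by (simp add: ennreal_plus[symmetric] del: ennreal_plus)
  finally have mass_id: "mass id \<le> ennreal (\<kappa> * b powr (- s * nrm id))" using b_gt_1 by simp
  define C where "C = 2 * kv + 4 * K + 4 * E + c * (K + N)"
  define good where "good u \<longleftrightarrow> u \<in> G \<and> mass u \<le> ennreal (\<kappa> * b powr (- s * nrm u))" for u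
  \<comment> \<open>The bound \<open>real n \<le> nrm f\<close> makes the norms of the approximating
    elements tend to infinity.\<close>
  define step where "step n u u' \<longleftrightarrow> desc u u' \<and> (\<exists>f\<in>G. real n \<le> nrm f \<and>
      (\<forall>\<eta>\<in>shadow u'. D (act f \<xi>) \<eta> \<le> b powr (C - (1 + c) * nrm f)))" for n u u'
  have "\<exists>u. \<forall>n. good (u n) \<and> step n (u n) (u (Suc n))"
  proof (rule dependent_nat_choice)
    show "\<exists>u. good u" using mass_id id_G by (intro exI[of _ id]) (auto simp: good_def)
    fix u n assume "good u"
    then have u: "u \<in> G" "mass u \<le> ennreal (\<kappa> * b powr (- s * nrm u))" by (auto simp: good_def)
    obtain u' f where u': "desc u u'" "f \<in> G" "real n \<le> nrm f" "mass u' \<le> ennreal (\<kappa> * b powr (- s * nrm u'))"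
      "\<forall>\<eta>\<in>shadow u'. D (act f \<xi>) \<eta> \<le> b powr (C - (1 + c) * nrm f)"
      using approximation_step[OF \<xi> br \<kappa> st(1) c p \<sigma> freq u, of "real n"] unfolding C_def
      by (elim exE conjE)
    have "good u'" using u'(4) descD(2)[OF u'(1)] by (simp add: good_def)
    moreover have "step n u u'" using u' by (auto simp: step_def)
    ultimately show "\<exists>u'. good u' \<and> step n u u'" by blast
  qed
  then obtain u where u: "\<And>n. good (u n)" "\<And>n. step n (u n) (u (Suc n))" by blast
  have desc: "\<And>n. desc (u n) (u (Suc n))" using u(2) by (simp add: step_def)
  obtain \<eta> where \<eta>: "\<eta> \<in> bdry" "\<And>n. \<eta> \<in> shadow (u n)"
    using desc_chain_limit[of u, OF desc] by blast
  have "\<eta> \<in> radial_limit_set x0 G"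
  proof -
    have "\<eta> \<in> rad \<tau>" by (rule desc_chain_limit_radial[of u, OF desc \<eta>])
    then have "\<eta> \<in> rad (\<tau> + 1)" using radial_limit_set_upto_mono[of \<tau> "\<tau> + 1" x0 G] by auto
    moreover have "0 < \<tau> + 1" using Q_tau by simp
    ultimately show ?thesis by (auto simp: radial_limit_set_def)
  qed
  moreover have "ereal (1 + c) \<le> approx_exponent b x0 D G \<xi> \<eta>"
  proof (rule approx_exponent_geI)
    fix M :: real
    obtain n :: nat where n: "M < n" using reals_Archimedean2 by blast
    obtain f where "f \<in> G" "real n \<le> nrm f" "D (act f \<xi>) \<eta> \<le> b powr (C - (1 + c) * nrm f)"
      using u(2)[of n] \<eta>(2) unfolding step_def by blast
    then show "\<exists>g\<in>G. M < nrm g \<and> D (act g \<xi>) \<eta> \<le> b powr (C - (1 + c) * nrm g)"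
      using n by (intro bexI[of _ f]) auto
  qed
  ultimately have "\<eta> \<in> ?W" by (simp add: well_approximable_set_def)
  then obtain A where A: "A \<in> \<C>" "\<eta> \<in> A" using \<C>(3) by blast
  have le: "w A \<le> \<kappa> * b powr (- s * nrm (u n))" for n
  proof -
    have "A \<in> hit (u n)" using A \<eta>(2) by (auto simp: hit_def)
    have "ennreal (w A) \<le> a A" by (simp add: a_def)
    also have "\<dots> \<le> mass (u n)" by (rule le_mass[OF \<open>A \<in> hit (u n)\<close>])
    also have "\<dots> \<le> ennreal (\<kappa> * b powr (- s * nrm (u n)))" using u(1)[of n] by (simp add: good_def)
    finally show ?thesis using \<kappa> by (simp add: ennreal_le_iff)
  qed
  obtain n :: nat where n: "- log b (w A / \<kappa>) / s < n" using reals_Archimedean2 by blast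
  have "real n \<le> nrm (u n)" by (rule desc_chain_nrm[of u, OF desc])
  then have "- log b (w A / \<kappa>) / s < nrm (u n)" using n by linarith
  then have "- log b (w A / \<kappa>) < s * nrm (u n)"
    unfolding pos_divide_less_eq[OF s] by (simp only: mult.commute)
  then have "- s * nrm (u n) < log b (w A / \<kappa>)" by simp
  then have "b powr (- s * nrm (u n)) < w A / \<kappa>"
    using w(1) \<kappa> b_gt_1 by (subst (asm) less_log_iff) auto
  then have "\<kappa> * b powr (- s * nrm (u n)) < w A" using \<kappa> by (simp add: less_divide_eq mult.commute)
  then show False using le[of n] by simp
qed

section \<open>The exponent \<open>P\<close> and the dimension formulas\<close>

text \<open>Removes the conventions for the logarithm: as \<open>log b r\<close> is negative,
  content 0 gives the quotient \<infinity> and infinite content gives \<open>-\<infinity>\<close>,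
  both in agreement with the right-hand side.\<close>

lemma le_elog_quotient_iff:
  assumes "1 < b" "0 < r" "r < 1"
  shows "ereal p \<le> elog b H / ereal (log b r) \<longleftrightarrow> H \<le> ennreal (r powr p)"
proof -
  have neg: "log b r < 0" using assms by simp
  consider "H = 0" | "H = \<infinity>" | h where "0 < h" "H = ennreal h"
    by (cases H) (auto simp: less_le)
  then show ?thesis
  proof cases
    case 1
    then show ?thesis using neg by (simp add: elog_def)
  next
    case 2
    then show ?thesis using neg by (simp add: elog_def top_unique)
  next
    case 3
    have "elog b H / ereal (log b r) = ereal (log b h / log b r)"
      using 3 neg by (simp add: elog_def)
    moreover have "p \<le> log b h / log b r \<longleftrightarrow> log b h \<le> p * log b r"
      using neg by (rule neg_le_divide_eq)
    moreover have "log b h \<le> p * log b r \<longleftrightarrow> h \<le> r powr p"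
      using assms 3 log_le_cancel_iff[of b h "r powr p"] by (simp add: log_powr)
    ultimately show ?thesis using 3 by (simp add: ennreal_le_iff)
  qed
qed

lemma P_exponent_le:
  assumes "1 < b"
  shows "P_exponent b x0 D G \<xi> s \<le> lower_local_exponent b x0 D G \<xi> s \<sigma>"
proof (rule tendsto_upperbound[OF tendsto_P_exponent[OF assms]])
  show "\<forall>\<^sub>F \<sigma>' in at_top. lower_local_exponent b x0 D G \<xi> s \<sigma>' \<le> lower_local_exponent b x0 D G \<xi> s \<sigma>"
    using eventually_ge_at_top[of \<sigma>] by eventually_elim (rule lower_local_exponent_antimono[OF assms])
qed simp

lemma P_exponent_lessD:
  assumes "1 < b" "P_exponent b x0 D G \<xi> s < p"
  shows "\<exists>\<sigma>>0. lower_local_exponent b x0 D G \<xi> s \<sigma> < p"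
proof -
  have "\<forall>\<^sub>F \<sigma> in at_top. lower_local_exponent b x0 D G \<xi> s \<sigma> < p"
    by (rule order_tendstoD(2)[OF tendsto_P_exponent[OF assms(1)] assms(2)])
  moreover have "\<forall>\<^sub>F \<sigma>::real in at_top. 0 < \<sigma>" by (rule eventually_gt_at_top)
  ultimately have "\<forall>\<^sub>F \<sigma> in at_top. 0 < \<sigma> \<and> lower_local_exponent b x0 D G \<xi> s \<sigma> < p"
    by eventually_elim simp
  then show ?thesis by (rule eventually_happens'[OF trivial_limit_at_top_linorder])
qed

lemma lower_local_exponent_gtD:
  assumes "1 < b" "ereal p < lower_local_exponent b x0 D G \<xi> s \<sigma>"
  shows "\<exists>r0>0. \<forall>r. 0 < r \<and> r < r0 \<longrightarrow> local_content x0 D G \<xi> \<sigma> s r \<le> ennreal (r powr p)"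
proof -
  have "\<forall>\<^sub>F r in at_right 0. ereal p < elog b (local_content x0 D G \<xi> \<sigma> s r) / ereal (log b r)"
    using assms(2) unfolding lower_local_exponent_def by (rule less_LiminfD)
  then obtain r1 where r1: "0 < r1"
    "\<And>r. 0 < r \<Longrightarrow> r < r1 \<Longrightarrow> ereal p < elog b (local_content x0 D G \<xi> \<sigma> s r) / ereal (log b r)"
    unfolding eventually_at_right_field by blast
  have "local_content x0 D G \<xi> \<sigma> s r \<le> ennreal (r powr p)" if "0 < r" "r < min r1 1" for r
  proof -
    have "r < r1" "r < 1" using that by auto
    from less_imp_le[OF r1(2)[OF that(1) this(1)]] show ?thesis
      by (simp only: le_elog_quotient_iff[OF assms(1) that(1) \<open>r < 1\<close>])
  qed
  then show ?thesis using r1(1) by (intro exI[of _ "min r1 1"]) auto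
qed

lemma lower_local_exponent_lessD:
  assumes "1 < b" "lower_local_exponent b x0 D G \<xi> s \<sigma> < ereal p"
  shows "\<forall>r0>0. \<exists>r. 0 < r \<and> r < r0 \<and> ennreal (r powr p) < local_content x0 D G \<xi> \<sigma> s r"
proof (rule ccontr)
  assume "\<not> ?thesis"
  then obtain r0 where r0: "0 < r0"
    "\<not> (\<exists>r. 0 < r \<and> r < r0 \<and> ennreal (r powr p) < local_content x0 D G \<xi> \<sigma> s r)"
    by blast
  have "\<forall>\<^sub>F r in at_right 0. ereal p \<le> elog b (local_content x0 D G \<xi> \<sigma> s r) / ereal (log b r)"
    unfolding eventually_at_right_field
  proof (intro exI[of _ "min r0 1"] conjI allI impI)
    show "0 < min r0 1" using r0(1) by simp
    fix r assume "0 < r" "r < min r0 1"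
    then have "0 < r" "r < r0" "r < 1" by auto
    moreover from this have "local_content x0 D G \<xi> \<sigma> s r \<le> ennreal (r powr p)"
      using r0(2) not_less by blast
    ultimately show "ereal p \<le> elog b (local_content x0 D G \<xi> \<sigma> s r) / ereal (log b r)"
      by (simp only: le_elog_quotient_iff[OF assms(1)])
  qed
  then have "ereal p \<le> lower_local_exponent b x0 D G \<xi> s \<sigma>"
    unfolding lower_local_exponent_def by (rule Liminf_bounded)
  then show False using assms(2) by simp
qed

context visual_group
begin

text \<open>The ball covers itself. This makes local exponents \<open>p\<close> with
  \<open>s \<le> p\<close> available in the upper bound.\<close>

lemma local_content_le:
  assumes "0 < s" "0 < r"
  shows "local_content x0 D G \<xi> \<sigma> s r \<le> ennreal (2 powr s * r powr s)"
proof -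
  let ?B = "Metric_space.mcball bdry D \<xi> r"
  have "local_content x0 D G \<xi> \<sigma> s r \<le> (\<Sum>\<^sub>\<infinity>i\<in>{()}. ediam_powr D s ?B)"
    unfolding local_content_def
    by (rule hausdorff_content_le_cover) (auto simp: Metric_space.in_mcball[OF metric])
  also have "\<dots> \<le> ennreal ((2 * r) powr s)"
  proof -
    have "D x y \<le> 2 * r" if "x \<in> ?B" "y \<in> ?B" for x y
      using that D_triangle[of x \<xi> y] D_commute[of x \<xi>] by (auto simp: Metric_space.in_mcball[OF metric])
    then show ?thesis using assms by (simp add: ediam_powr_le)
  qed
  finally show ?thesis using assms by (simp add: powr_mult)
qed

text \<open>Balls of radius below 1/2 have diameter at most 1, where contents decrease in the
  exponent; division by the negative \<open>log b r\<close> reverses this.\<close>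

lemma P_exponent_mono:
  assumes "0 < s'" "s' \<le> s"
  shows "P_exponent b x0 D G \<xi> s' \<le> P_exponent b x0 D G \<xi> s"
proof (rule tendsto_le[OF _ tendsto_P_exponent[OF b_gt_1] tendsto_P_exponent[OF b_gt_1]])
  have "lower_local_exponent b x0 D G \<xi> s' \<sigma> \<le> lower_local_exponent b x0 D G \<xi> s \<sigma>" for \<sigma>
    unfolding lower_local_exponent_def
  proof (rule Liminf_mono)
    show "\<forall>\<^sub>F r in at_right 0. elog b (local_content x0 D G \<xi> \<sigma> s' r) / ereal (log b r)
        \<le> elog b (local_content x0 D G \<xi> \<sigma> s r) / ereal (log b r)"
      unfolding eventually_at_right_field
    proof (intro exI[of _ "1/2"] conjI allI impI)
      fix r :: real assume r: "0 < r" "r < 1/2"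
      let ?S = "Metric_space.mcball bdry D \<xi> r \<inter> rad \<sigma>"
      have "local_content x0 D G \<xi> \<sigma> s r \<le> local_content x0 D G \<xi> \<sigma> s' r"
        unfolding local_content_def
      proof (rule hausdorff_content_exponent_antimono[OF assms _ _ D_nonneg])
        show "?S \<subseteq> bdry" using rad_boundary by auto
        show "D x y \<le> 1" if "x \<in> ?S" "y \<in> ?S" for x y
          using that r D_triangle[of x \<xi> y] D_commute[of x \<xi>] by (auto simp: Metric_space.in_mcball[OF metric])
      qed
      then have le: "local_content x0 D G \<xi> \<sigma> s' r \<le> ennreal (r powr p) \<Longrightarrow>
          local_content x0 D G \<xi> \<sigma> s r \<le> ennreal (r powr p)" for p
        by (rule order_trans)
      have "r < 1" using r by simp
      note iff = le_elog_quotient_iff[OF b_gt_1 r(1) this]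
      show "elog b (local_content x0 D G \<xi> \<sigma> s' r) / ereal (log b r)
          \<le> elog b (local_content x0 D G \<xi> \<sigma> s r) / ereal (log b r)"
        by (rule ereal_leI_real) (unfold iff, rule le)
    qed simp
  qed
  then show "\<forall>\<^sub>F \<sigma> in at_top. lower_local_exponent b x0 D G \<xi> s' \<sigma> \<le> lower_local_exponent b x0 D G \<xi> s \<sigma>"
    by simp
qed simp

text \<open>A real \<open>q\<close> between the two sides gives \<open>\<delta> < s + q * c\<close>.
  Replacing it by \<open>max s q\<close> meets the requirement \<open>s \<le> p\<close>; for
  \<open>q \<le> s\<close> the trivial bound on the local content takes over.\<close>

lemma content_well_approximable_eq_0:
  assumes \<xi>: "\<xi> \<in> bdry" and s: "0 < s" and c: "0 < c" and \<delta>: "poincare_exponent b x0 G = ereal \<delta>"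
    and P: "ereal ((\<delta> - s) / c) < P_exponent b x0 D G \<xi> s"
  shows "hausdorff_content bdry D s (well_approximable_set b x0 D G c \<xi>) = 0"
proof -
  obtain q where q: "ereal ((\<delta> - s) / c) < ereal q" "ereal q < P_exponent b x0 D G \<xi> s"
    using ereal_dense2[OF P] by auto
  have "\<delta> < s + q * c" using q(1) c by (simp add: divide_less_eq algebra_simps)
  also have "\<dots> \<le> s + max s q * c" using c by simp
  finally have "poincare_exponent b x0 G < ereal (s + max s q * c)" by (simp add: \<delta>)
  then have \<delta>': "poincare_exponent b x0 G < ereal (s + max s q * c)" .
  show ?thesis
  proof (rule content_well_approximable_zero[OF \<xi> s _ c \<delta>'])
    fix \<sigma> :: real
    show "\<exists>A>0. \<exists>r0>0. \<forall>r. 0 < r \<and> r < r0 \<longrightarrow>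
        local_content x0 D G \<xi> \<sigma> s r \<le> ennreal (A * r powr max s q)"
    proof (cases "q \<le> s")
      case True
      then show ?thesis
        using local_content_le[OF s] by (intro exI[of _ "2 powr s"] exI[of _ 1] conjI) (auto simp: max_def)
    next
      case False
      have "ereal q < lower_local_exponent b x0 D G \<xi> s \<sigma>"
        using q(2) P_exponent_le[OF b_gt_1] by (rule less_le_trans)
      from lower_local_exponent_gtD[OF b_gt_1 this] show ?thesis
        using False by (intro exI[of _ 1]) (auto simp: max_def)
    qed
  qed simp
qed

text \<open>The exponent \<open>p = s\<close> needs no information on \<open>P\<close> and is the
  source of the bound \<open>\<delta> / (c + 1)\<close>.\<close>

lemma content_well_approximable_eq_0_trivial:
  assumes \<xi>: "\<xi> \<in> bdry" and s: "0 < s" and c: "0 < c" and \<delta>: "poincare_exponent b x0 G = ereal \<delta>"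
    and large: "\<delta> < s + s * c"
  shows "hausdorff_content bdry D s (well_approximable_set b x0 D G c \<xi>) = 0"
proof (rule content_well_approximable_zero[OF \<xi> s order_refl c])
  show "poincare_exponent b x0 G < ereal (s + s * c)" using large by (simp add: \<delta>)
  fix \<sigma> :: real
  show "\<exists>A>0. \<exists>r0>0. \<forall>r. 0 < r \<and> r < r0 \<longrightarrow>
      local_content x0 D G \<xi> \<sigma> s r \<le> ennreal (A * r powr s)"
    using local_content_le[OF s] by (intro exI[of _ "2 powr s"] exI[of _ 1] conjI) auto
qed

lemma radial_limit_set_boundary: "radial_limit_set x0 G \<subseteq> bdry"
  using rad_boundary by (auto simp: radial_limit_set_def)

end

text \<open>The strict gap leaves room for a real \<open>p\<close> above \<open>P\<close> and then
  for \<open>t\<close> below \<delta>; the maximum with 0 provides \<open>0 \<le> p\<close>.\<close>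

lemma (in turning_group) content_well_approximable_neq_0:
  assumes \<xi>: "\<xi> \<in> bdry" and s: "0 < s" "s < \<delta>" and c: "0 < c" and \<delta>: "poincare_exponent b x0 G = ereal \<delta>"
    and P: "P_exponent b x0 D G \<xi> s < ereal ((\<delta> - s) / c)"
  shows "hausdorff_content bdry D s (well_approximable_set b x0 D G c \<xi>) \<noteq> 0"
proof -
  have "0 < (\<delta> - s) / c" using s c by simp
  then have "max 0 (P_exponent b x0 D G \<xi> s) < ereal ((\<delta> - s) / c)" using P by simp
  then obtain p where p: "max 0 (P_exponent b x0 D G \<xi> s) < ereal p" "ereal p < ereal ((\<delta> - s) / c)"
    using ereal_dense2 by blast
  then have p0: "0 \<le> p" and Pp: "P_exponent b x0 D G \<xi> s < ereal p" by auto
  have "c * p < \<delta> - s" using p(2) c by (simp add: less_divide_eq mult.commute)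
  then have "s + c * p < \<delta>" by simp
  then obtain t where t: "s + c * p < t" "t < \<delta>" using dense by blast
  obtain \<sigma> where \<sigma>: "0 < \<sigma>" "lower_local_exponent b x0 D G \<xi> s \<sigma> < ereal p"
    using P_exponent_lessD[OF b_gt_1 Pp] by blast
  show ?thesis
    by (rule content_well_approximable_nonzero[OF \<xi> s(1) c p0 t(1) _ \<sigma>(1) lower_local_exponent_lessD[OF b_gt_1 \<sigma>(2)]])
      (simp add: \<delta> t(2))
qed

text \<open>As \<open>A\<close> and \<open>B\<close> exhaust the interval and lie on opposite sides
  of \<open>x\<close>, all points strictly below \<open>x\<close> are in \<open>A\<close> and all
  strictly above in \<open>B\<close>. An empty \<open>A\<close> forces \<open>x = 0\<close> and an
  empty \<open>B\<close> forces \<open>x = \<delta>\<close>, matching the conventions.\<close>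

lemma eq_Sup_or_Inf_or:
  fixes x :: ereal
  assumes x: "0 \<le> x" "x \<le> ereal \<delta>" and AB: "A \<union> B = {0<..<\<delta>}"
    and A: "\<And>a. a \<in> A \<Longrightarrow> ereal a \<le> x" and B: "\<And>b. b \<in> B \<Longrightarrow> x \<le> ereal b"
  shows "x = ereal (Sup_or 0 A)" "x = ereal (Inf_or \<delta> B)"
proof -
  obtain y where y: "x = ereal y" "0 \<le> y" "y \<le> \<delta>" using x by (cases x) auto
  have Ay: "a \<le> y" if "a \<in> A" for a using A[OF that] y by simp
  have By: "y \<le> b" if "b \<in> B" for b using B[OF that] y by simp
  have inA: "z \<in> A" if "0 < z" "z < y" for z
  proof -
    have "z \<in> A \<union> B" using that y by (simp add: AB)
    then show ?thesis using By[of z] that by auto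
  qed
  have inB: "z \<in> B" if "y < z" "z < \<delta>" for z
  proof -
    have "z \<in> A \<union> B" using that y by (simp add: AB)
    then show ?thesis using Ay[of z] that by auto
  qed
  have "Sup_or 0 A = y"
  proof (cases "A = {}")
    case True
    then have "y = 0" using inA[of "y / 2"] y by (cases "y = 0") auto
    then show ?thesis using True by (simp add: Sup_or_def)
  next
    case False
    then obtain a where a: "a \<in> A" by blast
    have "0 < a" using a AB by auto
    have "Sup A = y"
    proof (rule cSup_eq_non_empty[OF False Ay])
      fix z assume z: "\<And>a. a \<in> A \<Longrightarrow> a \<le> z"
      show "y \<le> z"
      proof (rule ccontr)
        assume "\<not> y \<le> z"
        then have "(y + z) / 2 \<in> A" using z[OF a] \<open>0 < a\<close> by (intro inA) auto
        then show False using z[of "(y + z) / 2"] \<open>\<not> y \<le> z\<close> by simp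
      qed
    qed
    then show ?thesis using False by (simp add: Sup_or_def)
  qed
  then show "x = ereal (Sup_or 0 A)" using y by simp
  have "Inf_or \<delta> B = y"
  proof (cases "B = {}")
    case True
    then have "y = \<delta>" using inB[of "(y + \<delta>) / 2"] y by (cases "y = \<delta>") auto
    then show ?thesis using True by (simp add: Inf_or_def)
  next
    case False
    then obtain d where d: "d \<in> B" by blast
    have "d < \<delta>" using d AB by auto
    have "Inf B = y"
    proof (rule cInf_eq_non_empty[OF False By])
      fix z assume z: "\<And>d. d \<in> B \<Longrightarrow> z \<le> d"
      show "z \<le> y"
      proof (rule ccontr)
        assume "\<not> z \<le> y"
        then have "(y + z) / 2 \<in> B" using z[OF d] \<open>d < \<delta>\<close> by (intro inB) auto
        then show False using z[of "(y + z) / 2"] \<open>\<not> z \<le> y\<close> by simp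
      qed
    qed
    then show ?thesis using False by (simp add: Inf_or_def)
  qed
  then show "x = ereal (Inf_or \<delta> B)" using y by simp
qed

theorem theorem7p1:
  fixes x\<^sub>0 :: "'a::metric_space" and b \<delta> :: real
    and D :: "'a bdpoint \<Rightarrow> 'a bdpoint \<Rightarrow> real"
    and G :: "('a \<Rightarrow> 'a) set" and \<xi> :: "'a bdpoint"
  assumes "gromov_hyperbolic (UNIV :: 'a set)"
    and "1 < b"
    and "visual_metric b x\<^sub>0 D"
    and "subgroup G isometry_group"
    and "strongly_discrete x\<^sub>0 G"
    and "general_type x\<^sub>0 D G"
    and "\<xi> \<in> gromov_boundary x\<^sub>0"
    and "poincare_exponent b x\<^sub>0 G = ereal \<delta>"
  shows "(\<forall>c>0.
            hausdorff_dim (gromov_boundary x\<^sub>0) D (well_approximable_set b x\<^sub>0 D G c \<xi>)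
              = ereal (Sup_or 0 {s \<in> {0<..<\<delta>}. P_exponent b x\<^sub>0 D G \<xi> s \<le> ereal ((\<delta> - s) / c)}) \<and>
            hausdorff_dim (gromov_boundary x\<^sub>0) D (well_approximable_set b x\<^sub>0 D G c \<xi>)
              = ereal (Inf_or \<delta> {s \<in> {0<..<\<delta>}. P_exponent b x\<^sub>0 D G \<xi> s \<ge> ereal ((\<delta> - s) / c)}) \<and>
            hausdorff_dim (gromov_boundary x\<^sub>0) D (well_approximable_set b x\<^sub>0 D G c \<xi>)
              \<le> ereal (\<delta> / (c + 1)))
       \<and> hausdorff_dim (gromov_boundary x\<^sub>0) D (VWA b x\<^sub>0 D G \<xi>)
              = ereal (Sup_or 0 {s \<in> {0<..<\<delta>}. P_exponent b x\<^sub>0 D G \<xi> s < \<infinity>})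
       \<and> hausdorff_dim (gromov_boundary x\<^sub>0) D (VWA b x\<^sub>0 D G \<xi>)
              = ereal (Inf_or \<delta> {s \<in> {0<..<\<delta>}. P_exponent b x\<^sub>0 D G \<xi> s = \<infinity>})
       \<and> hausdorff_dim (gromov_boundary x\<^sub>0) D (Liouville b x\<^sub>0 D G \<xi>) = 0"
proof -
  obtain E where E: "0 \<le> E" "\<And>x y z w :: 'a. min (gp w x y) (gp w y z) - E \<le> gp w x z"
    using assms(1) unfolding gromov_hyperbolic_def by (simp only: ball_UNIV) blast
  obtain Cv where Cv: "1 \<le> Cv" "\<forall>\<xi>\<in>gromov_boundary x\<^sub>0. \<forall>\<eta>\<in>gromov_boundary x\<^sub>0.
        inverse Cv * powr_neg b (bp x\<^sub>0 \<xi> \<eta>) \<le> D \<xi> \<eta> \<and>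
        D \<xi> \<eta> \<le> Cv * powr_neg b (bp x\<^sub>0 \<xi> \<eta>)"
    using assms(3) unfolding visual_metric_def by (elim conjE exE)
  have metric: "Metric_space (gromov_boundary x\<^sub>0) D"
    using assms(3) unfolding visual_metric_def by (elim conjE)
  have vg: "visual_group x\<^sub>0 E b Cv D G"
    by (intro visual_group.intro hyperbolic.intro visual_group_axioms.intro) (use E Cv metric assms(2,4,5) in auto)
  obtain J K where JK: "finite J" "J \<subseteq> G" "J \<noteq> {}" "0 \<le> K" "\<forall>j\<in>J. dist x\<^sub>0 (j x\<^sub>0) \<le> K"
    "\<forall>x. \<forall>g\<in>G. \<exists>j\<in>J. gp x\<^sub>0 x (j (g x\<^sub>0)) \<le> K"
    "\<forall>x. \<forall>\<eta>\<in>gromov_boundary x\<^sub>0. \<exists>j\<in>J. \<not> ereal K \<le> bp x\<^sub>0 (boundary_action j \<eta>) (pt x)"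
    using visual_group.turning[OF vg assms(6)] by (elim exE conjE)
  interpret turning_group x\<^sub>0 E b Cv D G J K
    by (intro turning_group.intro turning_group_axioms.intro vg) (use JK in auto)
  let ?P = "P_exponent b x\<^sub>0 D G \<xi>" and ?W = "\<lambda>c. well_approximable_set b x\<^sub>0 D G c \<xi>"
    and ?dim = "hausdorff_dim bdry D" and ?content = "hausdorff_content bdry D"
  have \<delta>0: "0 \<le> \<delta>"
  proof -
    have "0 \<le> poincare_exponent b x\<^sub>0 G" unfolding poincare_exponent_def by (rule INF_greatest) auto
    then show ?thesis by (simp add: assms(8))
  qed
  have dim_le: "?dim S \<le> ereal s" if "\<And>s'. s < s' \<Longrightarrow> ?content s' S = 0" "0 \<le> s" for S s
  proof (rule ereal_le_epsilon2)
    fix e :: real assume "0 < e"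
    then have "?dim S \<le> ereal (s + e)"
      using that D_nonneg by (intro hausdorff_content_zero_imp_dim_le) auto
    then show "?dim S \<le> ereal s + ereal e" by simp
  qed
  have W_bd: "?W c \<subseteq> bdry" for c
    using radial_limit_set_boundary by (auto simp: well_approximable_set_def)
  have small: "?content s (?W c) = 0" if "0 < c" "\<delta> < s + s * c" for s c
  proof -
    have "0 < s * (1 + c)" using that \<delta>0 by (simp add: algebra_simps)
    then have "0 < s" using that(1) by (simp add: zero_less_mult_iff)
    then show ?thesis using content_well_approximable_eq_0_trivial[OF assms(7) _ that(1) assms(8) that(2)] by blast
  qed
  have W: "?dim (?W c) = ereal (Sup_or 0 {s \<in> {0<..<\<delta>}. ?P s \<le> ereal ((\<delta> - s) / c)})"
    "?dim (?W c) = ereal (Inf_or \<delta> {s \<in> {0<..<\<delta>}. ?P s \<ge> ereal ((\<delta> - s) / c)})"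
    "?dim (?W c) \<le> ereal (\<delta> / (c + 1))" if c: "0 < c" for c
  proof -
    let ?A = "{s \<in> {0<..<\<delta>}. ?P s \<le> ereal ((\<delta> - s) / c)}"
    let ?B = "{s \<in> {0<..<\<delta>}. ?P s \<ge> ereal ((\<delta> - s) / c)}"
    show le: "?dim (?W c) \<le> ereal (\<delta> / (c + 1))"
    proof (rule dim_le)
      fix s assume "\<delta> / (c + 1) < s"
      then have "\<delta> < s + s * c" using c by (simp add: divide_less_eq algebra_simps)
      then show "?content s (?W c) = 0" by (rule small[OF c])
    qed (use c \<delta>0 in simp)
    have "\<delta> / (c + 1) \<le> \<delta>" using c \<delta>0 by (simp add: divide_le_eq mult_left_le algebra_simps)
    then have le\<delta>: "?dim (?W c) \<le> ereal \<delta>" using le by (meson ereal_less_eq(3) order_trans)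
    have AB: "?A \<union> ?B = {0<..<\<delta>}" by auto
    \<comment> \<open>The inequality for \<open>?P\<close> at \<open>a\<close> need not be strict,
      but it is at every smaller \<open>s\<close>: there \<open>?P\<close> is no larger, while
      \<open>(\<delta> - s) / c\<close> is larger.\<close>
    have A: "ereal a \<le> ?dim (?W c)" if a: "a \<in> ?A" for a
    proof (rule ereal_leI_real)
      fix M assume "ereal M \<le> ereal a"
      show "ereal M \<le> ?dim (?W c)"
      proof (rule ccontr)
        assume "\<not> ?thesis"
        then have dim: "?dim (?W c) < ereal M" by simp
        also have "\<dots> \<le> ereal a" by fact
        finally obtain s where s: "?dim (?W c) < ereal s" "ereal s < ereal a" using ereal_dense2 by blast
        have "0 < ereal s" using hausdorff_dim_nonneg s(1) by (rule le_less_trans)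
        then have s0: "0 < s" "s < a" "s < \<delta>" using s(2) a by auto
        have "?P s \<le> ?P a" using s0 by (intro P_exponent_mono) auto
        also have "\<dots> \<le> ereal ((\<delta> - a) / c)" using a by simp
        also have "\<dots> < ereal ((\<delta> - s) / c)" using s0 c by (simp add: divide_strict_right_mono)
        finally have "?content s (?W c) \<noteq> 0"
          by (intro content_well_approximable_neq_0[OF assms(7) s0(1,3) c assms(8)])
        then have "ereal s \<le> ?dim (?W c)"
          using s0 W_bd D_nonneg by (intro hausdorff_content_nonzero_imp_dim_ge) auto
        then show False using s(1) by simp
      qed
    qed
    \<comment> \<open>Symmetrically, the inequality becomes strict at every \<open>s\<close> above
      \<open>d\<close>.\<close>
    have B: "?dim (?W c) \<le> ereal d" if d: "d \<in> ?B" for d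
    proof (rule dim_le)
      fix s assume s: "d < s"
      have "ereal ((\<delta> - s) / c) < ereal ((\<delta> - d) / c)" using s c by (simp add: divide_strict_right_mono)
      also have "\<dots> \<le> ?P d" using d by simp
      also have "\<dots> \<le> ?P s" using s d by (intro P_exponent_mono) auto
      finally show "?content s (?W c) = 0"
        using s d by (intro content_well_approximable_eq_0[OF assms(7) _ c assms(8)]) auto
    qed (use d in auto)
    show "?dim (?W c) = ereal (Sup_or 0 ?A)" "?dim (?W c) = ereal (Inf_or \<delta> ?B)"
      using eq_Sup_or_Inf_or[OF hausdorff_dim_nonneg le\<delta> AB A B] by blast+
  qed
  let ?V = "VWA b x\<^sub>0 D G \<xi>" and ?L = "Liouville b x\<^sub>0 D G \<xi>"
  \<comment> \<open>The strict condition on the exponent is a countable union: \<open>?V\<close> is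
    covered by the sets \<open>?W c\<close> with \<open>c = 1 / (n + 1)\<close>.\<close>
  have V_zero: "?content s ?V = 0" if "\<And>c. 0 < c \<Longrightarrow> ?content s (?W c) = 0" for s
  proof (rule hausdorff_content_zero_UN[of "UNIV :: nat set" _ _ _ "\<lambda>n. ?W (inverse (real (Suc n)))"])
    show "?V \<subseteq> (\<Union>n. ?W (inverse (real (Suc n))))"
    proof
      fix \<eta> assume \<eta>: "\<eta> \<in> ?V"
      then have "ereal 1 < approx_exponent b x\<^sub>0 D G \<xi> \<eta>" by (simp add: VWA_def one_ereal_def)
      then obtain z where z: "1 < z" "ereal z < approx_exponent b x\<^sub>0 D G \<xi> \<eta>"
        using ereal_dense2 by (metis ereal_less(2) less_ereal.simps(1))
      obtain n where "inverse (real (Suc n)) < z - 1" using reals_Archimedean[of "z - 1"] z(1) by auto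
      then have "ereal (1 + inverse (real (Suc n))) \<le> ereal z" by simp
      then have "ereal (1 + inverse (real (Suc n))) \<le> approx_exponent b x\<^sub>0 D G \<xi> \<eta>"
        using z(2) by (meson less_imp_le order_trans)
      then have "\<eta> \<in> ?W (inverse (real (Suc n)))" using \<eta> by (simp add: VWA_def well_approximable_set_def)
      then show "\<eta> \<in> (\<Union>n. ?W (inverse (real (Suc n))))" by blast
    qed
  qed (use that in auto)
  have W_V: "?W c \<subseteq> ?V" if "0 < c" for c
  proof
    fix \<eta> assume \<eta>: "\<eta> \<in> ?W c"
    have "1 < ereal (1 + c)" using that by (simp add: one_ereal_def)
    also have "\<dots> \<le> approx_exponent b x\<^sub>0 D G \<xi> \<eta>" using \<eta> by (simp add: well_approximable_set_def)
    finally show "\<eta> \<in> ?V" using \<eta> by (simp add: VWA_def well_approximable_set_def)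
  qed
  have V_bd: "?V \<subseteq> bdry" using radial_limit_set_boundary by (auto simp: VWA_def)
  let ?A = "{s \<in> {0<..<\<delta>}. ?P s < \<infinity>}" and ?B = "{s \<in> {0<..<\<delta>}. ?P s = \<infinity>}"
  have V_le: "?dim ?V \<le> ereal \<delta>"
  proof (rule dim_le)
    fix s assume s: "\<delta> < s"
    have "\<delta> < s + s * c" if "0 < c" for c
    proof -
      have "0 \<le> s * c" using s \<delta>0 that by simp
      then show ?thesis using s by simp
    qed
    then show "?content s ?V = 0" using small by (intro V_zero) auto
  qed (rule \<delta>0)
  have V_A: "ereal a \<le> ?dim ?V" if a: "a \<in> ?A" for a
  proof -
    obtain M where M: "?P a < ereal M" using a ereal_dense2[of "?P a" \<infinity>] by auto
    \<comment> \<open>\<open>c\<close> is so small that \<open>(\<delta> - a) / c\<close> exceeds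
      the bound \<open>M\<close> on \<open>?P a\<close> or equals it; the maximum with 1 keeps
      \<open>c\<close> positive.\<close>
    define c where "c = (\<delta> - a) / max M 1"
    have c: "0 < c" using a by (simp add: c_def)
    have "(\<delta> - a) / c = max M 1" using a by (simp add: c_def)
    then have "?P a < ereal ((\<delta> - a) / c)" using M by (simp add: less_le_trans[of _ "ereal M"])
    then have "?content a (?W c) \<noteq> 0"
      using a by (intro content_well_approximable_neq_0[OF assms(7) _ _ c assms(8)]) auto
    then have "?content a ?V \<noteq> 0"
      using hausdorff_content_mono[OF W_V[OF c], of bdry D a] by auto
    then show ?thesis using a V_bd D_nonneg by (intro hausdorff_content_nonzero_imp_dim_ge) auto
  qed
  have V_B: "?dim ?V \<le> ereal d" if d: "d \<in> ?B" for d
  proof -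
    have "?content d (?W c) = 0" if "0 < c" for c
      using d by (intro content_well_approximable_eq_0[OF assms(7) _ that assms(8)]) auto
    then have "?content d ?V = 0" by (rule V_zero)
    then show ?thesis using d D_nonneg by (intro hausdorff_content_zero_imp_dim_le) auto
  qed
  have V_AB: "?A \<union> ?B = {0<..<\<delta>}" by auto
  note V = eq_Sup_or_Inf_or[OF hausdorff_dim_nonneg V_le V_AB V_A V_B]
  have "?dim ?L \<le> ereal 0"
  proof (rule dim_le)
    fix s :: real assume s: "0 < s"
    \<comment> \<open>For this value of \<open>c\<close>, the sum \<open>s + s * c\<close> is
      \<open>s + \<delta> + 1\<close>, which exceeds \<delta>.\<close>
    have "?L \<subseteq> ?W ((\<delta> + 1) / s)" by (auto simp: Liouville_def well_approximable_set_def)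
    moreover have "?content s (?W ((\<delta> + 1) / s)) = 0" using s \<delta>0 by (intro small) auto
    ultimately show "?content s ?L = 0" using hausdorff_content_mono by (metis le_zero_eq)
  qed simp
  then have "?dim ?L = 0" using hausdorff_dim_nonneg[of bdry D ?L] by (simp add: zero_ereal_def)
  then show ?thesis using W V by blast
qed

end
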